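(* Let $\Sigma$ be an orientable $(n-1)$-dimensional compact submanifold of a round sphere $\mathbb S^n(\varrho)\subset\mathbb R^{n+1}$ of radius $\varrho$, and let $\psi:M^n\to\mathbb R^{n+1}$ be an immersed orientable compact minimal hypersurface with boundary $\Sigma=\psi(\partial M)\subset\mathbb S^n(\varrho)$. Then $$\mathrm{vol}(M)\le\frac{\varrho}{n}\,\mathrm{vol}(\partial M),$$ and equality holds if and only if $M$ is orthogonal to $\mathbb S^n(\varrho)$ along the boundary $\partial M$.
   Context: A hypersurface is an isometric immersion of a connected orientable manifold $M^n$ with smooth boundary $\partial M$; it has boundary $\Sigma$ if $\psi|_{\partial M}$ is a diffeomorphism onto $\Sigma$. Minimal means that the mean curvature vanishes identically. $M$ is orthogonal to $\mathbb S^n(\varrho)$ along $\partial M$ if $\langle{\bf N},\xi\rangle=0$ on $\partial M$, where ${\bf N}$ is the unit normal of $M$ and $\xi$ the unit normal of $\mathbb S^n(\varrho)$. $\mathrm{vol}(M)$ is $n$-dimensional and $\mathrm{vol}(\partial M)$ is $(n-1)$-dimensional volume. *)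

theory Defs
  imports "HOL-Analysis.Analysis"
begin

section \<open>Smooth maps on subsets of Euclidean spaces\<close>

text \<open>Meant for open sets only.\<close>

primrec C_k_on :: "nat \<Rightarrow> ('v::euclidean_space \<Rightarrow> 'w::real_normed_vector) \<Rightarrow> 'v set \<Rightarrow> bool" where
  "C_k_on 0 f S \<longleftrightarrow> continuous_on S f"
| "C_k_on (Suc k) f S \<longleftrightarrow> f differentiable_on S \<and>
     (\<forall>v. C_k_on k (\<lambda>x. frechet_derivative f (at x) v) S)"

text \<open>On an arbitrary set, smooth means that near each point of the set there is a smooth extension
  to an open set of the surrounding space.\<close>

definition smooth_on :: "'v::euclidean_space set \<Rightarrow> ('v \<Rightarrow> 'w::real_normed_vector) \<Rightarrow> bool" where
  "smooth_on S f \<longleftrightarrow> (\<forall>x\<in>S. \<exists>W g. open W \<and> x \<in> W \<and> (\<forall>k. C_k_on k g W) \<and> (\<forall>y\<in>W \<inter> S. g y = f y))"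


section \<open>Model spaces\<close>

text \<open>All manifolds are modelled on subsets of one space \<open>real ^ 'n\<close>. For a set \<open>I\<close> of
  indices, \<open>coord_space I\<close> is the coordinate subspace of dimension \<open>card I\<close>, that is
  \<open>\<real>\<^sup>I\<close>. The index \<open>bdry_index\<close> is an arbitrary fixed one; if it lies in \<open>I\<close>, then \<open>model I\<close> is
  a half-space of \<open>\<real>\<^sup>I\<close>, and otherwise \<open>model I\<close> is all of \<open>\<real>\<^sup>I\<close>. So \<open>I = UNIV\<close> gives
  \<open>n\<close>-manifolds with boundary and \<open>I = UNIV - {bdry_index}\<close> gives \<open>(n-1)\<close>-manifolds without
  boundary, where \<open>n = CARD('n)\<close>. For \<open>n = 1\<close> the latter are modelled on a point.\<close>

definition bdry_index :: "'n::finite" where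
  "bdry_index = (SOME i. True)"

definition coord_space :: "'n::finite set \<Rightarrow> (real ^ 'n) set" where
  "coord_space I = {x. \<forall>i. i \<notin> I \<longrightarrow> x $ i = 0}"

definition model :: "'n::finite set \<Rightarrow> (real ^ 'n) set" where
  "model I = {x \<in> coord_space I. 0 \<le> x $ bdry_index}"

text \<open>Lebesgue measure of dimension \<open>card I\<close> on \<open>\<real>\<^sup>I\<close>, as a measure on \<open>real ^ 'n\<close>. For \<open>I = {}\<close> it
  is the unit point mass at the origin, so that volume in dimension 0 is the counting measure.\<close>

definition coord_lborel :: "'n::finite set \<Rightarrow> (real ^ 'n) measure" where
  "coord_lborel I = distr (Pi\<^sub>M I (\<lambda>_. lborel)) borel (\<lambda>f. \<chi> i. if i \<in> I then f i else 0)"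

text \<open>The determinant of the submatrix with rows and columns in \<open>I\<close>.\<close>

definition minor :: "'n::finite set \<Rightarrow> real ^ 'n ^ 'n \<Rightarrow> real" where
  "minor I G = det (\<chi> i j. if i \<in> I \<and> j \<in> I then G $ i $ j else if i = j then 1 else 0)"

lemma minor_UNIV: "minor UNIV G = det G"
  by (simp add: minor_def vec_lambda_eta)

lemma coord_lborel_UNIV: "coord_lborel (UNIV :: 'n::finite set) = lborel"
proof (rule lborel_eqI [symmetric])
  show "sets (coord_lborel (UNIV :: 'n set)) = sets borel"
    by (simp add: coord_lborel_def)
next
  fix l u :: "real ^ 'n"
  assume lu: "\<And>b. b \<in> Basis \<Longrightarrow> l \<bullet> b \<le> u \<bullet> b"
  have le: "l $ i \<le> u $ i" for i
    using lu[of "axis i 1"] by (simp add: inner_axis)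
  interpret product_sigma_finite "\<lambda>_::'n. lborel :: real measure"
    by standard
  let ?F = "\<lambda>f::'n \<Rightarrow> real. (\<chi> i. if i \<in> UNIV then f i else 0) :: real ^ 'n"
  have meas: "?F \<in> measurable (Pi\<^sub>M UNIV (\<lambda>_. lborel)) borel"
  proof (subst borel_measurable_euclidean_space, intro ballI)
    fix b :: "real ^ 'n"
    assume "b \<in> Basis"
    then obtain i where b: "b = axis i 1"
      by (auto simp: Basis_vec_def)
    have "(\<lambda>f::'n \<Rightarrow> real. f i) \<in> borel_measurable (Pi\<^sub>M UNIV (\<lambda>_. lborel))"
      by measurable
    then show "(\<lambda>f. ?F f \<bullet> b) \<in> borel_measurable (Pi\<^sub>M UNIV (\<lambda>_. lborel))"
      by (simp add: b inner_axis)
  qed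
  have vimage: "?F -` box l u \<inter> space (Pi\<^sub>M UNIV (\<lambda>_. lborel)) = (\<Pi>\<^sub>E i\<in>UNIV. {l $ i <..< u $ i})"
    by (auto simp: box_def Basis_vec_def inner_axis space_PiM PiE_def Pi_def)
  have "emeasure (coord_lborel UNIV) (box l u)
      = emeasure (Pi\<^sub>M UNIV (\<lambda>_. lborel)) (\<Pi>\<^sub>E i\<in>UNIV. {l $ i <..< u $ i})"
    unfolding coord_lborel_def by (subst emeasure_distr[OF meas]) (simp_all add: vimage[simplified])
  also have "\<dots> = (\<Prod>i\<in>UNIV. ennreal (u $ i - l $ i))"
    by (subst emeasure_PiM) (auto simp: le)
  also have "\<dots> = ennreal (\<Prod>i\<in>UNIV. u $ i - l $ i)"
    by (subst prod_ennreal) (auto simp: le)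
  also have "(\<Prod>i\<in>UNIV. u $ i - l $ i) = (\<Prod>b\<in>Basis. (u - l) \<bullet> b)"
  proof -
    have "bij_betw (\<lambda>i::'n. axis i (1::real)) UNIV Basis"
      by (auto simp: bij_betw_def inj_on_def axis_eq_axis Basis_vec_def)
    from prod.reindex_bij_betw[OF this, of "\<lambda>b. (u - l) \<bullet> b"] show ?thesis
      by (simp add: inner_axis)
  qed
  finally show "emeasure (coord_lborel UNIV) (box l u) = ennreal (\<Prod>b\<in>Basis. (u - l) \<bullet> b)" .
qed


section \<open>Smooth manifolds with boundary\<close>

text \<open>A chart is a pair of its domain and its coordinate map; values of the map outside the domain
  are irrelevant.\<close>

type_synonym ('a, 'n) chart = "'a set \<times> ('a \<Rightarrow> real ^ 'n)"

definition chart_image :: "('a, 'n::finite) chart \<Rightarrow> (real ^ 'n) set" where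
  "chart_image c = snd c ` fst c"

definition chart_inv :: "('a, 'n::finite) chart \<Rightarrow> real ^ 'n \<Rightarrow> 'a" where
  "chart_inv c = inv_into (fst c) (snd c)"

definition transition :: "('a, 'n::finite) chart \<Rightarrow> ('a, 'n) chart \<Rightarrow> real ^ 'n \<Rightarrow> real ^ 'n" where
  "transition c d = snd d \<circ> chart_inv c"

definition is_chart :: "'n::finite set \<Rightarrow> 'a::topological_space set \<Rightarrow> ('a, 'n) chart \<Rightarrow> bool" where
  "is_chart I M c \<longleftrightarrow>
     openin (top_of_set M) (fst c) \<and>
     openin (top_of_set (model I)) (chart_image c) \<and>
     homeomorphism (fst c) (chart_image c) (snd c) (chart_inv c)"

text \<open>\<open>M\<close>, with the subspace topology and the smooth structure generated by the atlas \<open>A\<close>, is a smooth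
  manifold of dimension \<open>card I\<close>. The atlas need not be maximal. The type classes supply the Hausdorff
  property and second countability.\<close>

definition smooth_manifold ::
  "'n::finite set \<Rightarrow> 'a::{t2_space,second_countable_topology} set \<Rightarrow> ('a, 'n) chart set \<Rightarrow> bool" where
  "smooth_manifold I M A \<longleftrightarrow>
     (\<forall>c\<in>A. is_chart I M c) \<and> \<Union> (fst ` A) = M \<and>
     (\<forall>c\<in>A. \<forall>d\<in>A. smooth_on (snd c ` (fst c \<inter> fst d)) (transition c d))"

text \<open>The boundary (for \<open>bdry_index \<in> I\<close>) and the atlas it inherits, with model \<open>I - {bdry_index}\<close>.\<close>

definition mfd_boundary :: "('a, 'n::finite) chart set \<Rightarrow> 'a set" where
  "mfd_boundary A = {p. \<exists>c\<in>A. p \<in> fst c \<and> snd c p $ bdry_index = 0}"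

definition boundary_atlas :: "('a, 'n::finite) chart set \<Rightarrow> ('a, 'n) chart set" where
  "boundary_atlas A = (\<lambda>c. (fst c \<inter> mfd_boundary A, snd c)) ` A"

text \<open>Partial derivatives are taken within the domain \<open>S\<close> in the model space. The derivative within
  \<open>S\<close> is determined in the directions of \<open>I\<close>, also at boundary points; only these directions are used.\<close>

definition pderiv_in :: "(real ^ 'n::finite) set \<Rightarrow> 'n \<Rightarrow> (real ^ 'n \<Rightarrow> 'w::real_normed_vector) \<Rightarrow>
    real ^ 'n \<Rightarrow> 'w" where
  "pderiv_in S i f x = frechet_derivative f (at x within S) (axis i 1)"

text \<open>An orientation prescribes for each chart \<open>c\<close> and point \<open>p\<close> of its domain whether the coordinate
  frame of \<open>c\<close> at \<open>p\<close> is positive (value 1) or negative (value -1), continuously in \<open>p\<close> and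
  consistently with the Jacobian determinants of the transitions.\<close>

definition jacobian :: "'n::finite set \<Rightarrow> ('a, 'n) chart \<Rightarrow> ('a, 'n) chart \<Rightarrow> 'a \<Rightarrow> real" where
  "jacobian I c d p = minor I
     (\<chi> i j. pderiv_in (snd c ` (fst c \<inter> fst d)) j (transition c d) (snd c p) $ i)"

definition orientable :: "'n::finite set \<Rightarrow> ('a::topological_space, 'n) chart set \<Rightarrow> bool" where
  "orientable I A \<longleftrightarrow> (\<exists>s :: ('a, 'n) chart \<Rightarrow> 'a \<Rightarrow> real.
     (\<forall>c\<in>A. continuous_on (fst c) (s c) \<and> (\<forall>p\<in>fst c. s c p \<in> {-1, 1})) \<and>
     (\<forall>c\<in>A. \<forall>d\<in>A. \<forall>p\<in>fst c \<inter> fst d. s d p = sgn (jacobian I c d p) * s c p))"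

definition smooth_map :: "'a::topological_space set \<Rightarrow> ('a, 'n::finite) chart set \<Rightarrow>
    'b::topological_space set \<Rightarrow> ('b, 'k::finite) chart set \<Rightarrow> ('a \<Rightarrow> 'b) \<Rightarrow> bool" where
  "smooth_map M A M' A' f \<longleftrightarrow> continuous_on M f \<and> f ` M \<subseteq> M' \<and>
     (\<forall>c\<in>A. \<forall>d\<in>A'. smooth_on (snd c ` (fst c \<inter> f -` fst d)) (snd d \<circ> f \<circ> chart_inv c))"

definition diffeomorphism :: "'a::topological_space set \<Rightarrow> ('a, 'n::finite) chart set \<Rightarrow>
    'b::topological_space set \<Rightarrow> ('b, 'k::finite) chart set \<Rightarrow> ('a \<Rightarrow> 'b) \<Rightarrow> bool" where
  "diffeomorphism M A M' A' f \<longleftrightarrow>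
     bij_betw f M M' \<and> smooth_map M A M' A' f \<and> smooth_map M' A' M A (inv_into M f)"


section \<open>Immersions into Euclidean space\<close>

definition smooth_fun :: "('a, 'n::finite) chart set \<Rightarrow> ('a \<Rightarrow> 'v::real_normed_vector) \<Rightarrow> bool" where
  "smooth_fun A f \<longleftrightarrow> (\<forall>c\<in>A. smooth_on (chart_image c) (f \<circ> chart_inv c))"

definition immersion :: "'n::finite set \<Rightarrow> ('a, 'n) chart set \<Rightarrow> ('a \<Rightarrow> 'v::euclidean_space) \<Rightarrow> bool" where
  "immersion I A \<psi> \<longleftrightarrow> smooth_fun A \<psi> \<and>
     (\<forall>c\<in>A. \<forall>x\<in>chart_image c.
        inj_on (frechet_derivative (\<psi> \<circ> chart_inv c) (at x within chart_image c)) (coord_space I))"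

text \<open>Since \<open>S\<close> carries the subspace topology, the inclusion is then an embedding.\<close>

definition embedded_submanifold ::
  "'n::finite set \<Rightarrow> 'v::euclidean_space set \<Rightarrow> ('v, 'n) chart set \<Rightarrow> bool" where
  "embedded_submanifold I S B \<longleftrightarrow> smooth_manifold I S B \<and> immersion I B (\<lambda>x. x)"

text \<open>The matrix of the metric induced by \<open>\<psi>\<close>, in the chart \<open>c\<close> at the coordinate point \<open>x\<close>.\<close>

definition metric_matrix ::
  "('a, 'n::finite) chart \<Rightarrow> ('a \<Rightarrow> 'v::euclidean_space) \<Rightarrow> real ^ 'n \<Rightarrow> real ^ 'n ^ 'n" where
  "metric_matrix c \<psi> x = (\<chi> i j.
     pderiv_in (chart_image c) i (\<psi> \<circ> chart_inv c) x \<bullet> pderiv_in (chart_image c) j (\<psi> \<circ> chart_inv c) x)"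

text \<open>The Riemannian volume measure of the induced metric: the unique Borel measure on \<open>M\<close> that in
  every chart has density \<open>sqrt (det g)\<close> with respect to Lebesgue measure.\<close>

definition volume_measure :: "'n::finite set \<Rightarrow> 'a::topological_space set \<Rightarrow> ('a, 'n) chart set \<Rightarrow>
    ('a \<Rightarrow> 'v::euclidean_space) \<Rightarrow> 'a measure" where
  "volume_measure I M A \<psi> = (THE \<mu>. sets \<mu> = sets (restrict_space borel M) \<and>
     (\<forall>c\<in>A. \<forall>E\<in>sets \<mu>. E \<subseteq> fst c \<longrightarrow>
        emeasure \<mu> E = (\<integral>\<^sup>+ x. ennreal (sqrt (minor I (metric_matrix c \<psi> x))) * indicator (snd c ` E) x
                          \<partial>coord_lborel I)))"

definition vol :: "'n::finite set \<Rightarrow> 'a::topological_space set \<Rightarrow> ('a, 'n) chart set \<Rightarrow>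
    ('a \<Rightarrow> 'v::euclidean_space) \<Rightarrow> real" where
  "vol I M A \<psi> = measure (volume_measure I M A \<psi>) M"


section \<open>Hypersurfaces\<close>

definition unit_normal_field ::
  "('a, 'n::finite) chart set \<Rightarrow> ('a \<Rightarrow> 'v::euclidean_space) \<Rightarrow> ('a \<Rightarrow> 'v) \<Rightarrow> bool" where
  "unit_normal_field A \<psi> N \<longleftrightarrow> smooth_fun A N \<and>
     (\<forall>c\<in>A. \<forall>p\<in>fst c. norm (N p) = 1 \<and>
        (\<forall>i. pderiv_in (chart_image c) i (\<psi> \<circ> chart_inv c) (snd c p) \<bullet> N p = 0))"

definition second_fundamental_matrix :: "('a, 'n::finite) chart \<Rightarrow> ('a \<Rightarrow> 'v::euclidean_space) \<Rightarrow>
    ('a \<Rightarrow> 'v) \<Rightarrow> 'a \<Rightarrow> real ^ 'n ^ 'n" where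
  "second_fundamental_matrix c \<psi> N p = (\<chi> i j.
     pderiv_in (chart_image c) i (pderiv_in (chart_image c) j (\<psi> \<circ> chart_inv c)) (snd c p) \<bullet> N p)"

text \<open>\<open>H = (1/n) g\<^sup>i\<^sup>j h\<^sub>i\<^sub>j\<close>, computed in the chart \<open>c\<close>.\<close>

definition mean_curvature :: "('a, 'n::finite) chart \<Rightarrow> ('a \<Rightarrow> 'v::euclidean_space) \<Rightarrow>
    ('a \<Rightarrow> 'v) \<Rightarrow> 'a \<Rightarrow> real" where
  "mean_curvature c \<psi> N p =
     trace (matrix_inv (metric_matrix c \<psi> (snd c p)) ** second_fundamental_matrix c \<psi> N p) / real CARD('n)"

definition minimal ::
  "('a, 'n::finite) chart set \<Rightarrow> ('a \<Rightarrow> 'v::euclidean_space) \<Rightarrow> ('a \<Rightarrow> 'v) \<Rightarrow> bool" where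
  "minimal A \<psi> N \<longleftrightarrow> (\<forall>c\<in>A. \<forall>p\<in>fst c. mean_curvature c \<psi> N p = 0)"

text \<open>The unit normal at \<open>x\<close> of the sphere with centre \<open>z\<close> and radius \<open>r\<close>.\<close>

definition sphere_normal :: "'v::euclidean_space \<Rightarrow> real \<Rightarrow> 'v \<Rightarrow> 'v" where
  "sphere_normal z r x = (1 / r) *\<^sub>R (x - z)"

definition orthogonal_to_sphere :: "('a, 'n::finite) chart set \<Rightarrow> ('a \<Rightarrow> 'v::euclidean_space) \<Rightarrow>
    ('a \<Rightarrow> 'v) \<Rightarrow> 'v \<Rightarrow> real \<Rightarrow> bool" where
  "orthogonal_to_sphere A \<psi> N z r \<longleftrightarrow> (\<forall>p\<in>mfd_boundary A. N p \<bullet> sphere_normal z r (\<psi> p) = 0)"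

end

theory Submission
  imports Defs
begin

text \<open>Let \<open>\<Psi> = \<psi> - z\<close> be the position vector and \<open>X\<close> its tangential part. Minimality gives
  \<open>div X = n\<close>, so by the divergence theorem \<open>n vol(M)\<close> is the integral over the boundary of
  \<open>\<langle>\<Psi>, \<nu>\<rangle>\<close>, where \<open>\<nu>\<close> is the outer unit conormal. There \<open>\<bar>\<Psi>\<bar> = \<rho>\<close>, and Cauchy-Schwarz yields the
  inequality. Equality forces \<open>\<Psi> = \<rho> \<nu>\<close>, hence \<open>\<langle>N, \<Psi>\<rangle> = 0\<close>. Conversely, if \<open>\<langle>N, \<Psi>\<rangle> = 0\<close> then \<open>\<Psi>\<close> is
  tangent to \<open>M\<close> and normal to the boundary, so \<open>\<Psi> = \<plusminus> \<rho> \<nu>\<close>; the sign is \<open>+\<close> because \<open>M\<close> lies in the ball,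
  by the maximum principle.\<close>


section \<open>Calculus on relatively open subsets of the model spaces\<close>

text \<open>The differential of \<Psi> is the identity of the surrounding space, and its tangential
  trace is n; the second derivatives enter div X beyond that only through the trace that minimality
  kills. The definition of volume dictates much of the rest: \<open>vol\<close> rests on a definite
  description over all charts, so the measures on M and on its boundary must first be constructed.
  Boundary charts take values in a coordinate subspace of lower dimension, where integrals are
  thickened to full dimension before variables are changed. In a boundary chart the density of the
  boundary is the density of M times the length of the gradient of the boundary coordinate. This
  turns \<rho> vol(boundary) - n vol(M) into an integral over the boundary of one continuous
  nonnegative function, \<open>gap\<close>, whose zeros are the points of orthogonality. The ball
  enters only through the sign of the inward derivative of |\<Psi>|^2 along the boundary, so a weak
  maximum principle suffices, and the same divergence theorem supplies it.\<close>

lemma openin_model_axis_segment: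
  fixes x :: "real ^ 'n::finite"
  assumes S: "openin (top_of_set (model I)) S" and x: "x \<in> S" and i: "i \<in> I"
  obtains e where "e > 0" "\<And>t. t \<in> {0..e} \<Longrightarrow> x + t *\<^sub>R axis i 1 \<in> S"
proof -
  obtain r where r: "r > 0" "ball x r \<inter> model I \<subseteq> S"
    using S x unfolding openin_contains_ball by blast
  have xm: "x \<in> model I" using S x openin_imp_subset by blast
  have "x + t *\<^sub>R axis i 1 \<in> S" if t: "t \<in> {0..r/2}" for t
  proof -
    have "x + t *\<^sub>R axis i 1 \<in> ball x r"
      using t r(1) by (simp add: dist_norm)
    moreover have "x + t *\<^sub>R axis i 1 \<in> model I"
      using xm t i unfolding model_def coord_space_def
      by (auto simp: axis_def)
    ultimately show ?thesis using r by blast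
  qed
  then show ?thesis using that[of "r/2"] r(1) by auto
qed

text \<open>Derivatives within a thin set are ambiguous in general. In the directions of
  \<open>I\<close> they are not, since a forward segment from \<open>x\<close> stays in
  \<open>S\<close>, also at boundary points, and 0 is a limit point of its parameter
  interval.\<close>

lemma has_derivative_within_axis_unique:
  fixes x :: "real ^ 'n::finite" and f :: "real ^ 'n \<Rightarrow> 'w::real_normed_vector"
  assumes S: "openin (top_of_set (model I)) S" and x: "x \<in> S" and i: "i \<in> I"
    and f': "(f has_derivative f') (at x within S)"
    and f'': "(f has_derivative f'') (at x within S)"
  shows "f' (axis i 1) = f'' (axis i 1)"
proof -
  obtain e where e: "e > 0" "\<And>t. t \<in> {0..e} \<Longrightarrow> x + t *\<^sub>R axis i 1 \<in> S"
    using openin_model_axis_segment[OF S x i] by blast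
  have *: "((\<lambda>t. f (x + t *\<^sub>R axis i 1)) has_vector_derivative D (axis i 1)) (at 0 within {0..e})"
    if D: "(f has_derivative D) (at x within S)" for D
  proof -
    have "((\<lambda>t. x + t *\<^sub>R axis i 1) has_derivative (\<lambda>t. t *\<^sub>R axis i 1)) (at 0 within {0..e})"
      by (auto intro!: derivative_eq_intros)
    moreover have "(f has_derivative D) (at (x + 0 *\<^sub>R axis i 1) within (\<lambda>t. x + t *\<^sub>R axis i 1) ` {0..e})"
      using has_derivative_subset[OF D, of "(\<lambda>t. x + t *\<^sub>R axis i 1) ` {0..e}"] e by force
    ultimately have "((\<lambda>t. f (x + t *\<^sub>R axis i 1)) has_derivative (\<lambda>t. D (t *\<^sub>R axis i 1))) (at 0 within {0..e})"
      by (rule has_derivative_in_compose)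
    then show ?thesis
      using has_derivative_bounded_linear[OF D] unfolding has_vector_derivative_def
      by (simp add: linear_simps)
  qed
  show ?thesis
    using vector_derivative_unique_within[OF _ *[OF f'] *[OF f'']] e(1)
    by (simp add: trivial_limit_within islimpt_Icc)
qed

lemma pderiv_in_eq:
  fixes x :: "real ^ 'n::finite"
  assumes "openin (top_of_set (model I)) S" "x \<in> S" "i \<in> I"
    and "(f has_derivative f') (at x within S)"
  shows "pderiv_in S i f x = f' (axis i 1)"
  unfolding pderiv_in_def
  using has_derivative_within_axis_unique[OF assms(1-3)] assms(4)
    frechet_derivative_works differentiable_def by metis

lemma has_derivative_coord_space_eq_sum:
  fixes x :: "real ^ 'n::finite"
  assumes S: "openin (top_of_set (model I)) S" and x: "x \<in> S"
    and f': "(f has_derivative f') (at x within S)" and v: "v \<in> coord_space I"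
  shows "f' v = (\<Sum>i\<in>I. (v $ i) *\<^sub>R pderiv_in S i f x)"
proof -
  interpret bounded_linear f' using f' has_derivative_bounded_linear by blast
  have "v = (\<Sum>i\<in>UNIV. (v $ i) *\<^sub>R axis i 1)" 
    using basis_expansion[of v] by (simp add: scalar_mult_eq_scaleR)
  also have "\<dots> = (\<Sum>i\<in>I. (v $ i) *\<^sub>R axis i 1)"
    using v by (intro sum.mono_neutral_right) (auto simp: coord_space_def)
  finally have "f' v = (\<Sum>i\<in>I. (v $ i) *\<^sub>R f' (axis i 1))"
    by (metis (no_types, lifting) scale sum sum.cong)
  then show ?thesis
    using pderiv_in_eq[OF S x _ f'] by simp
qed

lemma has_derivative_transform_within_openin:
  assumes g: "(g has_derivative g') (at x within S)" and W: "open W" "x \<in> W" and x: "x \<in> S"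
    and eq: "\<And>y. y \<in> W \<inter> S \<Longrightarrow> g y = f y"
  shows "(f has_derivative g') (at x within S)"
proof -
  obtain e where "e > 0" "ball x e \<subseteq> W" using W openE by blast
  then show ?thesis
    using has_derivative_transform_within[OF g _ x, of e f] eq by (auto simp: dist_commute subset_iff)
qed

lemma C_k_on_differentiable:
  assumes "\<forall>k. C_k_on k g W" "open W" "x \<in> W"
  shows "(g has_derivative frechet_derivative g (at x)) (at x)"
proof -
  have "C_k_on (Suc 0) g W" using assms by blast
  then have "g differentiable_on W" by simp
  then have "g differentiable (at x)"
    using assms differentiable_on_eq_differentiable_at by blast
  then show ?thesis using frechet_derivative_works by blast
qed

lemma C_k_on_frechet_derivative:
  assumes "\<forall>k. C_k_on k g W"
  shows "\<forall>k. C_k_on k (\<lambda>x. frechet_derivative g (at x) v) W"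
  using assms C_k_on.simps(2) by blast

lemma smooth_on_differentiable:
  assumes "smooth_on S f" "x \<in> S"
  shows "f differentiable (at x within S)"
proof -
  obtain W g where W: "open W" "x \<in> W" "\<forall>k. C_k_on k g W" "\<forall>y\<in>W \<inter> S. g y = f y"
    using assms unfolding smooth_on_def by blast
  have "(g has_derivative frechet_derivative g (at x)) (at x within S)"
    using C_k_on_differentiable[OF W(3,1,2)] has_derivative_at_withinI by blast
  then have "(f has_derivative frechet_derivative g (at x)) (at x within S)"
    by (rule has_derivative_transform_within_openin[OF _ W(1,2)]) (use W(4) assms(2) in auto)
  then show ?thesis by (auto simp: differentiable_def)
qed

lemma smooth_on_continuous_on: "smooth_on S f \<Longrightarrow> continuous_on S f"
  using smooth_on_differentiable differentiable_imp_continuous_within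
  by (metis continuous_on_eq_continuous_within)

text \<open>A smooth extension to an open set computes the one-sided derivatives too. Higher partial
  derivatives at boundary points thereby become ordinary derivatives of the extension.\<close>

lemma pderiv_in_extension:
  fixes f :: "real ^ 'n::finite \<Rightarrow> 'w::real_normed_vector"
  assumes S: "openin (top_of_set (model I)) S" and i: "i \<in> I"
    and W: "open W" "\<forall>k. C_k_on k g W" "\<forall>y\<in>W \<inter> S. g y = f y" and y: "y \<in> W \<inter> S"
  shows "pderiv_in S i f y = frechet_derivative g (at y) (axis i 1)"
proof -
  have "(g has_derivative frechet_derivative g (at y)) (at y within S)"
    using C_k_on_differentiable[OF W(2,1)] y has_derivative_at_withinI by blast
  then have "(f has_derivative frechet_derivative g (at y)) (at y within S)"
    by (rule has_derivative_transform_within_openin[OF _ W(1)]) (use W(3) y in auto)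
  from pderiv_in_eq[OF S _ i this] show ?thesis using y by blast
qed

lemma smooth_on_pderiv_in:
  fixes f :: "real ^ 'n::finite \<Rightarrow> 'w::real_normed_vector"
  assumes S: "openin (top_of_set (model I)) S" and i: "i \<in> I" and f: "smooth_on S f"
  shows "smooth_on S (pderiv_in S i f)"
  unfolding smooth_on_def
proof (intro ballI)
  fix x assume x: "x \<in> S"
  obtain W g where W: "open W" "x \<in> W" "\<forall>k. C_k_on k g W" "\<forall>y\<in>W \<inter> S. g y = f y"
    using f x unfolding smooth_on_def by blast
  then show "\<exists>W g. open W \<and> x \<in> W \<and> (\<forall>k. C_k_on k g W) \<and> (\<forall>y\<in>W \<inter> S. g y = pderiv_in S i f y)"
    using C_k_on_frechet_derivative[OF W(3), of "axis i 1"] pderiv_in_extension[OF S i W(1,3,4)]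
    by (metis (no_types, lifting))
qed

text \<open>Both mixed derivatives are values of the second difference quotient, by the mean value theorem
  applied in either order.\<close>

lemma second_difference_mean_value:
  fixes g :: "'v::euclidean_space \<Rightarrow> real"
  assumes "h > 0"
    and W: "\<And>s t. s \<in> {0..h} \<Longrightarrow> t \<in> {0..h} \<Longrightarrow> x + s *\<^sub>R u + t *\<^sub>R v \<in> W"
    and D: "\<And>y. y \<in> W \<Longrightarrow> (g has_derivative g' y) (at y)"
    and DD: "\<And>y. y \<in> W \<Longrightarrow> ((\<lambda>y. g' y u) has_derivative g'' y) (at y)"
  obtains s t where "s \<in> {0..h}" "t \<in> {0..h}"
    "g (x + h *\<^sub>R u + h *\<^sub>R v) - g (x + h *\<^sub>R u) - g (x + h *\<^sub>R v) + g x
       = h\<^sup>2 * g'' (x + s *\<^sub>R u + t *\<^sub>R v) v"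
proof -
  define \<phi> where "\<phi> s = g (x + s *\<^sub>R u + h *\<^sub>R v) - g (x + s *\<^sub>R u)" for s
  have \<phi>: "DERIV \<phi> s :> g' (x + s *\<^sub>R u + h *\<^sub>R v) u - g' (x + s *\<^sub>R u) u" if s: "0 \<le> s" "s \<le> h" for s
  proof -
    have *: "((\<lambda>s. g (x + s *\<^sub>R u + c *\<^sub>R v)) has_derivative (\<lambda>r. g' (x + s *\<^sub>R u + c *\<^sub>R v) (r *\<^sub>R u))) (at s)"
      if "c \<in> {0..h}" for c
    proof (rule has_derivative_compose[where g = g and f = "\<lambda>s. x + s *\<^sub>R u + c *\<^sub>R v" and x = s])
      show "((\<lambda>s. x + s *\<^sub>R u + c *\<^sub>R v) has_derivative (\<lambda>r. r *\<^sub>R u)) (at s)"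
        by (auto intro!: derivative_eq_intros)
      show "(g has_derivative g' (x + s *\<^sub>R u + c *\<^sub>R v)) (at (x + s *\<^sub>R u + c *\<^sub>R v))"
        using D W s that by auto
    qed
    have lin: "g' (x + s *\<^sub>R u + c *\<^sub>R v) (r *\<^sub>R u) = r * g' (x + s *\<^sub>R u + c *\<^sub>R v) u" if "c \<in> {0..h}" for r c
      using has_derivative_bounded_linear[OF D[OF W[of s c]]] s that
      by (simp add: linear_simps)
    have "(\<phi> has_derivative (\<lambda>r. r * g' (x + s *\<^sub>R u + h *\<^sub>R v) u - r * g' (x + s *\<^sub>R u) u)) (at s)"
      unfolding \<phi>_def
      using has_derivative_diff[OF *[of h] *[of 0]] \<open>h > 0\<close> lin[of h] lin[of 0] by simp
    moreover have "(\<lambda>r. r * a - r * b) = (*) (a - b)" for a b :: real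
      by (auto simp: algebra_simps)
    ultimately show ?thesis
      unfolding has_field_derivative_def by metis
  qed
  obtain s where s: "0 < s" "s < h" "\<phi> h - \<phi> 0 = (h - 0) * (g' (x + s *\<^sub>R u + h *\<^sub>R v) u - g' (x + s *\<^sub>R u) u)"
    using MVT2[OF \<open>h > 0\<close> \<phi>] by auto
  have \<theta>: "DERIV (\<lambda>t. g' (x + s *\<^sub>R u + t *\<^sub>R v) u) t :> g'' (x + s *\<^sub>R u + t *\<^sub>R v) v" if t: "0 \<le> t" "t \<le> h" for t
  proof -
    have "((\<lambda>t. g' (x + s *\<^sub>R u + t *\<^sub>R v) u) has_derivative (\<lambda>r. g'' (x + s *\<^sub>R u + t *\<^sub>R v) (r *\<^sub>R v))) (at t)"
    proof (rule has_derivative_compose[where g = "\<lambda>y. g' y u" and f = "\<lambda>t. x + s *\<^sub>R u + t *\<^sub>R v" and x = t])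
      show "((\<lambda>t. x + s *\<^sub>R u + t *\<^sub>R v) has_derivative (\<lambda>r. r *\<^sub>R v)) (at t)"
        by (auto intro!: derivative_eq_intros)
      show "((\<lambda>y. g' y u) has_derivative g'' (x + s *\<^sub>R u + t *\<^sub>R v)) (at (x + s *\<^sub>R u + t *\<^sub>R v))"
        using DD W s t by auto
    qed
    moreover have "g'' (x + s *\<^sub>R u + t *\<^sub>R v) (r *\<^sub>R v) = g'' (x + s *\<^sub>R u + t *\<^sub>R v) v * r" for r
      using has_derivative_bounded_linear[OF DD[OF W[of s t]]] s t
      by (simp add: linear_simps)
    ultimately show ?thesis by (simp add: has_field_derivative_def)
  qed
  obtain t where t: "0 < t" "t < h" "g' (x + s *\<^sub>R u + h *\<^sub>R v) u - g' (x + s *\<^sub>R u + 0 *\<^sub>R v) u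
      = (h - 0) * g'' (x + s *\<^sub>R u + t *\<^sub>R v) v"
    using MVT2[OF \<open>h > 0\<close> \<theta>] by auto
  have "\<phi> h - \<phi> 0 = h\<^sup>2 * g'' (x + s *\<^sub>R u + t *\<^sub>R v) v"
    using s(3) t(3) by (simp add: power2_eq_square)
  then show ?thesis
    using that[of s t] s t by (auto simp: \<phi>_def algebra_simps)
qed

lemma mixed_second_derivatives_eq:
  fixes g :: "'v::euclidean_space \<Rightarrow> real"
  assumes "open W" "x \<in> W"
    and D: "\<And>y. y \<in> W \<Longrightarrow> (g has_derivative g' y) (at y)"
    and DDu: "\<And>y. y \<in> W \<Longrightarrow> ((\<lambda>y. g' y u) has_derivative gu y) (at y)"
    and DDv: "\<And>y. y \<in> W \<Longrightarrow> ((\<lambda>y. g' y v) has_derivative gv y) (at y)"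
    and cu: "continuous_on W (\<lambda>y. gu y v)" and cv: "continuous_on W (\<lambda>y. gv y u)"
  shows "gu x v = gv x u"
proof (rule ccontr)
  assume ne: "gu x v \<noteq> gv x u"
  define \<epsilon> where "\<epsilon> = \<bar>gu x v - gv x u\<bar> / 2"
  have \<epsilon>: "\<epsilon> > 0" using ne by (simp add: \<epsilon>_def)
  obtain d0 where d0: "d0 > 0" "ball x d0 \<subseteq> W" using assms(1,2) openE by blast
  obtain d1 where d1: "d1 > 0" "\<And>y. y \<in> W \<Longrightarrow> dist y x < d1 \<Longrightarrow> dist (gu y v) (gu x v) < \<epsilon>"
    using cu \<epsilon> \<open>x \<in> W\<close> unfolding continuous_on_iff by blast
  obtain d2 where d2: "d2 > 0" "\<And>y. y \<in> W \<Longrightarrow> dist y x < d2 \<Longrightarrow> dist (gv y u) (gv x u) < \<epsilon>"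
    using cv \<epsilon> \<open>x \<in> W\<close> unfolding continuous_on_iff by blast
  define d where "d = min d0 (min d1 d2)"
  \<comment> \<open>The parallelogram with sides \<open>h *\<^sub>R u\<close> and
    \<open>h *\<^sub>R v\<close> then stays within \<open>d\<close> of \<open>x\<close>; the summand
    1 keeps the denominator positive.\<close>
  define h where "h = d / (2 * (norm u + norm v + 1))"
  have d: "d > 0" using d0 d1 d2 by (simp add: d_def)
  have h: "h > 0" unfolding h_def by (intro divide_pos_pos mult_pos_pos add_nonneg_pos d) auto
  have near: "dist (x + s *\<^sub>R a + t *\<^sub>R b) x < d"
    if "s \<in> {0..h}" "t \<in> {0..h}" "norm a + norm b = norm u + norm v" for s t a b
  proof -
    have "dist (x + s *\<^sub>R a + t *\<^sub>R b) x = norm (s *\<^sub>R a + t *\<^sub>R b)"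
      by (simp add: dist_norm algebra_simps)
    also have "\<dots> \<le> \<bar>s\<bar> * norm a + \<bar>t\<bar> * norm b"
      by (rule order_trans[OF norm_triangle_ineq]) simp
    also have "\<dots> \<le> h * norm a + h * norm b"
      using that by (intro add_mono mult_right_mono) auto
    also have "\<dots> = h * (norm u + norm v)" by (metis distrib_left that(3))
    also have "\<dots> < h * (2 * (norm u + norm v + 1))"
      using h by (intro mult_strict_left_mono) (auto simp: add_nonneg_pos add_strict_increasing2)
    also have "\<dots> = d"
    proof -
      have "norm u + norm v + 1 > 0" by (simp add: add_nonneg_pos)
      then show ?thesis by (simp add: h_def)
    qed
    finally show ?thesis .
  qed
  have inW: "y \<in> W" if "dist y x < d" for y
    using that d0 by (auto simp: d_def dist_commute)
  obtain s t where st: "s \<in> {0..h}" "t \<in> {0..h}"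
    "g (x + h *\<^sub>R u + h *\<^sub>R v) - g (x + h *\<^sub>R u) - g (x + h *\<^sub>R v) + g x
       = h\<^sup>2 * gu (x + s *\<^sub>R u + t *\<^sub>R v) v"
    using second_difference_mean_value[where W = W and x = x and u = u and v = v and g = g and g' = g' and g'' = gu, OF h]
      near inW D DDu by metis
  obtain s' t' where st': "s' \<in> {0..h}" "t' \<in> {0..h}"
    "g (x + h *\<^sub>R v + h *\<^sub>R u) - g (x + h *\<^sub>R v) - g (x + h *\<^sub>R u) + g x
       = h\<^sup>2 * gv (x + s' *\<^sub>R v + t' *\<^sub>R u) u"
    using second_difference_mean_value[where W = W and x = x and u = v and v = u and g = g and g' = g' and g'' = gv, OF h]
      near inW D DDv by (metis add.commute)
  have "h\<^sup>2 * gu (x + s *\<^sub>R u + t *\<^sub>R v) v = h\<^sup>2 * gv (x + s' *\<^sub>R v + t' *\<^sub>R u) u"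
    using st(3) st'(3) by (simp add: algebra_simps)
  then have eq: "gu (x + s *\<^sub>R u + t *\<^sub>R v) v = gv (x + s' *\<^sub>R v + t' *\<^sub>R u) u"
    using h by simp
  have n1: "dist (x + s *\<^sub>R u + t *\<^sub>R v) x < d" "dist (x + s' *\<^sub>R v + t' *\<^sub>R u) x < d"
    using near st st' by auto
  have "dist (gu (x + s *\<^sub>R u + t *\<^sub>R v) v) (gu x v) < \<epsilon>" "dist (gv (x + s' *\<^sub>R v + t' *\<^sub>R u) u) (gv x u) < \<epsilon>"
    using n1 inW d1(2) d2(2) by (auto simp: d_def)
  then show False
    using eq unfolding \<epsilon>_def dist_real_def by (simp add: abs_if split: if_splits)
qed

text \<open>Both sides are second derivatives of one smooth extension on an open set, so symmetry
  persists at the boundary. Components are taken because the mean value argument is for real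
  functions.\<close>

lemma pderiv_in_commute:
  fixes f :: "real ^ 'n::finite \<Rightarrow> 'w::euclidean_space"
  assumes S: "openin (top_of_set (model I)) S" and ij: "i \<in> I" "j \<in> I" and f: "smooth_on S f" and x: "x \<in> S"
  shows "pderiv_in S i (pderiv_in S j f) x = pderiv_in S j (pderiv_in S i f) x"
proof -
  obtain W g where W: "open W" "x \<in> W" "\<forall>k. C_k_on k g W" "\<forall>y\<in>W \<inter> S. g y = f y"
    using f x unfolding smooth_on_def by blast
  define G where "G i y = frechet_derivative g (at y) (axis i 1)" for i y
  have Ck: "\<forall>k. C_k_on k (G i) W" for i
    unfolding G_def by (rule C_k_on_frechet_derivative[OF W(3)])
  have G: "pderiv_in S i (pderiv_in S j f) x = frechet_derivative (G j) (at x) (axis i 1)" if "i \<in> I" "j \<in> I" for i j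
  proof (rule pderiv_in_extension[OF S that(1) W(1) Ck])
    show "\<forall>y\<in>W \<inter> S. G j y = pderiv_in S j f y"
      using pderiv_in_extension[OF S that(2) W(1,3,4)] by (simp add: G_def)
  qed (use W x in auto)
  have "frechet_derivative (G j) (at x) (axis i 1) = frechet_derivative (G i) (at x) (axis j 1)"
  proof (rule euclidean_eqI)
    fix b :: 'w assume "b \<in> Basis"
    have cont: "continuous_on W (\<lambda>y. frechet_derivative (G i) (at y) v \<bullet> b)" for i v
    proof -
      have "C_k_on 0 (\<lambda>y. frechet_derivative (G i) (at y) v) W"
        using C_k_on_frechet_derivative[OF Ck] by blast
      then show ?thesis by (auto intro!: continuous_intros)
    qed
    have GD: "((\<lambda>y. frechet_derivative g (at y) (axis j 1) \<bullet> b) has_derivative (\<lambda>v. frechet_derivative (G j) (at y) v \<bullet> b)) (at y)"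
      if "y \<in> W" for y j
      using C_k_on_differentiable[OF Ck W(1) that, of j]
      unfolding G_def by (rule has_derivative_inner_left)
    show "frechet_derivative (G j) (at x) (axis i 1) \<bullet> b = frechet_derivative (G i) (at x) (axis j 1) \<bullet> b"
    proof (rule mixed_second_derivatives_eq[OF W(1,2), where g = "\<lambda>y. g y \<bullet> b"
          and g' = "\<lambda>y v. frechet_derivative g (at y) v \<bullet> b"
          and gu = "\<lambda>y v. frechet_derivative (G j) (at y) v \<bullet> b"
          and gv = "\<lambda>y v. frechet_derivative (G i) (at y) v \<bullet> b"])
      show "((\<lambda>y. g y \<bullet> b) has_derivative (\<lambda>v. frechet_derivative g (at y) v \<bullet> b)) (at y)"
        if "y \<in> W" for y
        using C_k_on_differentiable[OF W(3) W(1) that] by (rule has_derivative_inner_left)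
    qed (rule GD cont; assumption?)+
  qed
  then show ?thesis using G ij by simp
qed

section \<open>Continuously differentiable functions on relatively open sets\<close>

text \<open>The class in which cutoffs and truncations built from \<open>(max 0 s)\<^sup>2\<close>
  live, and enough regularity for the divergence theorem. The witness \<open>f'\<close> is
  existential because derivatives within an arbitrary set need not be unique.\<close>

definition C1_on :: "'v::euclidean_space set \<Rightarrow> ('v \<Rightarrow> 'w::real_normed_vector) \<Rightarrow> bool" where
  "C1_on S f \<longleftrightarrow> (\<exists>f'. (\<forall>x\<in>S. (f has_derivative f' x) (at x within S)) \<and>
     (\<forall>v. continuous_on S (\<lambda>x. f' x v)))"

lemma C1_onI:
  assumes "\<And>x. x \<in> S \<Longrightarrow> (f has_derivative f' x) (at x within S)" "\<And>v. continuous_on S (\<lambda>x. f' x v)"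
  shows "C1_on S f"
  using assms unfolding C1_on_def by blast

lemma C1_onE:
  assumes "C1_on S f"
  obtains f' where "\<And>x. x \<in> S \<Longrightarrow> (f has_derivative f' x) (at x within S)" "\<And>v. continuous_on S (\<lambda>x. f' x v)"
  using assms unfolding C1_on_def by blast

lemma C1_on_differentiable: "C1_on S f \<Longrightarrow> x \<in> S \<Longrightarrow> f differentiable (at x within S)"
  by (auto simp: C1_on_def differentiable_def)

lemma C1_on_continuous_on: "C1_on S f \<Longrightarrow> continuous_on S f"
  by (meson C1_on_differentiable continuous_on_eq_continuous_within differentiable_imp_continuous_within)

lemma C1_on_pderiv_in_continuous:
  fixes f :: "real ^ 'n::finite \<Rightarrow> 'w::real_normed_vector"
  assumes S: "openin (top_of_set (model I)) S" and i: "i \<in> I" and f: "C1_on S f"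
  shows "continuous_on S (pderiv_in S i f)"
proof -
  obtain f' where f': "\<And>x. x \<in> S \<Longrightarrow> (f has_derivative f' x) (at x within S)" "\<And>v. continuous_on S (\<lambda>x. f' x v)"
    using C1_onE[OF f] by blast
  show ?thesis
    using f'(2)[of "axis i 1"] pderiv_in_eq[OF S _ i f'(1)] by (metis (no_types, lifting) continuous_on_cong)
qed

lemma coord_space_UNIV [simp]: "coord_space UNIV = UNIV"
  by (auto simp: coord_space_def)

lemma C1_onI_pderiv_in:
  fixes f :: "real ^ 'n::finite \<Rightarrow> 'w::real_normed_vector"
  assumes S: "openin (top_of_set (model UNIV)) S"
    and d: "\<And>x. x \<in> S \<Longrightarrow> f differentiable (at x within S)" and c: "\<And>i. continuous_on S (pderiv_in S i f)"
  shows "C1_on S f"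
proof (rule C1_onI)
  fix x assume x: "x \<in> S"
  then obtain f' where f': "(f has_derivative f') (at x within S)"
    using d by (auto simp: differentiable_def)
  have "f' = (\<lambda>v. \<Sum>i\<in>UNIV. (v $ i) *\<^sub>R pderiv_in S i f x)"
    using has_derivative_coord_space_eq_sum[OF S x f'] by auto
  then show "(f has_derivative (\<lambda>v. \<Sum>i\<in>UNIV. (v $ i) *\<^sub>R pderiv_in S i f x)) (at x within S)"
    using f' by simp
qed (intro continuous_intros c)

lemma smooth_on_C1_on:
  fixes f :: "real ^ 'n::finite \<Rightarrow> 'w::real_normed_vector"
  assumes S: "openin (top_of_set (model UNIV)) S" and f: "smooth_on S f"
  shows "C1_on S f"
  by (rule C1_onI_pderiv_in[OF S smooth_on_differentiable[OF f]
        smooth_on_continuous_on[OF smooth_on_pderiv_in[OF S _ f]]]) auto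

lemma C1_on_const: "C1_on S (\<lambda>x. c)"
  by (rule C1_onI[where f' = "\<lambda>x v. 0"]) auto

lemma C1_on_add:
  assumes "C1_on S f" "C1_on S g" shows "C1_on S (\<lambda>x. f x + g x)"
proof -
  obtain f' where f': "\<And>x. x \<in> S \<Longrightarrow> (f has_derivative f' x) (at x within S)" "\<And>v. continuous_on S (\<lambda>x. f' x v)"
    using C1_onE[OF assms(1)] by blast
  obtain g' where g': "\<And>x. x \<in> S \<Longrightarrow> (g has_derivative g' x) (at x within S)" "\<And>v. continuous_on S (\<lambda>x. g' x v)"
    using C1_onE[OF assms(2)] by blast
  show ?thesis
    by (rule C1_onI[where f' = "\<lambda>x v. f' x v + g' x v"]) (auto intro!: has_derivative_add continuous_intros f' g')
qed

lemma C1_on_sum: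
  assumes "\<And>i. i \<in> A \<Longrightarrow> C1_on S (f i)" shows "C1_on S (\<lambda>x. \<Sum>i\<in>A. f i x)"
  using assms by (induction A rule: infinite_finite_induct) (auto intro: C1_on_const C1_on_add)

lemma C1_on_bilinear:
  assumes B: "bounded_bilinear B" and "C1_on S f" "C1_on S g" shows "C1_on S (\<lambda>x. B (f x) (g x))"
proof -
  interpret bounded_bilinear B by (rule B)
  obtain f' where f': "\<And>x. x \<in> S \<Longrightarrow> (f has_derivative f' x) (at x within S)" "\<And>v. continuous_on S (\<lambda>x. f' x v)"
    using C1_onE[OF assms(2)] by blast
  obtain g' where g': "\<And>x. x \<in> S \<Longrightarrow> (g has_derivative g' x) (at x within S)" "\<And>v. continuous_on S (\<lambda>x. g' x v)"
    using C1_onE[OF assms(3)] by blast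
  show ?thesis
    by (rule C1_onI[where f' = "\<lambda>x v. B (f x) (g' x v) + B (f' x v) (g x)"])
      (simp_all add: FDERIV continuous_on_add continuous_on f' g' C1_on_continuous_on[OF assms(2)]
        C1_on_continuous_on[OF assms(3)])
qed

lemmas C1_on_mult = C1_on_bilinear[OF bounded_bilinear_mult]
lemmas C1_on_inner = C1_on_bilinear[OF bounded_bilinear_inner]

lemma C1_on_prod:
  fixes f :: "'i \<Rightarrow> 'v::euclidean_space \<Rightarrow> real"
  assumes "\<And>i. i \<in> A \<Longrightarrow> C1_on S (f i)" shows "C1_on S (\<lambda>x. \<Prod>i\<in>A. f i x)"
  using assms by (induction A rule: infinite_finite_induct) (auto intro: C1_on_const C1_on_mult)

lemma C1_on_compose_real:
  assumes f: "C1_on S f" and \<phi>: "\<And>x. x \<in> S \<Longrightarrow> (\<phi> has_real_derivative \<phi>' (f x)) (at (f x))"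
    and c: "continuous_on (f ` S) \<phi>'"
  shows "C1_on S (\<lambda>x. \<phi> (f x))"
proof -
  obtain f' where f': "\<And>x. x \<in> S \<Longrightarrow> (f has_derivative f' x) (at x within S)" "\<And>v. continuous_on S (\<lambda>x. f' x v)"
    using C1_onE[OF f] by blast
  show ?thesis
  proof (rule C1_onI[where f' = "\<lambda>x v. \<phi>' (f x) * f' x v"])
    show "((\<lambda>x. \<phi> (f x)) has_derivative (\<lambda>v. \<phi>' (f x) * f' x v)) (at x within S)" if "x \<in> S" for x
      using has_derivative_compose[OF f'(1)[OF that]] \<phi>[OF that] by (auto simp: has_field_derivative_def)
    show "continuous_on S (\<lambda>x. \<phi>' (f x) * f' x v)" for v
      by (intro continuous_intros f' continuous_on_compose2[OF c C1_on_continuous_on[OF f]]) auto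
  qed
qed

lemma C1_on_cong:
  assumes "C1_on S f" "\<And>x. x \<in> S \<Longrightarrow> f x = g x" shows "C1_on S g"
proof -
  obtain f' where f': "\<And>x. x \<in> S \<Longrightarrow> (f has_derivative f' x) (at x within S)" "\<And>v. continuous_on S (\<lambda>x. f' x v)"
    using C1_onE[OF assms(1)] by blast
  show ?thesis
    using has_derivative_transform[OF _ _ f'(1)] assms(2) f'(2) by (intro C1_onI[where f' = f']) metis+
qed


section \<open>Lebesgue measure on coordinate subspaces and change of variables\<close>

lemma Basis_real_vec: "(Basis :: (real ^ 'n::finite) set) = range (\<lambda>i. axis i 1)"
  by (auto simp: Basis_vec_def)

lemma inj_axis_1: "inj (\<lambda>i::'n::finite. axis i (1::real))"
  by (auto simp: inj_on_def axis_eq_axis)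

text \<open>The library states the change of variables formula for well-ordered index types only. A well-ordered
  copy of the index type makes it available for all finite ones.\<close>

typedef 'n ordered_copy = "UNIV :: 'n set" by simp

instance ordered_copy :: (finite) finite
proof
  have "finite (range (Abs_ordered_copy :: 'a \<Rightarrow> _))" by simp
  moreover have "range (Abs_ordered_copy :: 'a \<Rightarrow> _) = UNIV"
    by (metis Abs_ordered_copy_cases surj_def)
  ultimately show "finite (UNIV :: 'a ordered_copy set)" by simp
qed

definition ordered_copy_index :: "'n::finite ordered_copy \<Rightarrow> nat" where
  "ordered_copy_index = (SOME f. inj f)"

lemma inj_ordered_copy_index: "inj ordered_copy_index"
proof -
  have "\<exists>f :: 'a ordered_copy \<Rightarrow> nat. inj f"
    using finite_imp_inj_to_nat_seg[of "UNIV :: 'a ordered_copy set"] by auto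
  then show ?thesis unfolding ordered_copy_index_def by (rule someI_ex)
qed

instantiation ordered_copy :: (finite) wellorder
begin

definition "x \<le> y \<longleftrightarrow> ordered_copy_index x \<le> ordered_copy_index y"
definition "x < y \<longleftrightarrow> ordered_copy_index x < ordered_copy_index y"

instance
proof
  fix P :: "'a ordered_copy \<Rightarrow> bool" and a
  assume "\<And>x. (\<And>y. y < x \<Longrightarrow> P y) \<Longrightarrow> P x"
  then show "P a"
    by (induction "ordered_copy_index a" arbitrary: a rule: less_induct) (metis less_ordered_copy_def)
qed (auto simp: less_eq_ordered_copy_def less_ordered_copy_def dest: injD[OF inj_ordered_copy_index])

end

lemma bij_Rep_ordered_copy: "bij Rep_ordered_copy"
  by (metis Abs_ordered_copy_inverse Rep_ordered_copy_inverse UNIV_I bijI')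

definition to_copy :: "real ^ 'n::finite \<Rightarrow> real ^ 'n ordered_copy" where
  "to_copy x = (\<chi> i. x $ Rep_ordered_copy i)"

definition of_copy :: "real ^ 'n::finite ordered_copy \<Rightarrow> real ^ 'n" where
  "of_copy x = (\<chi> i. x $ Abs_ordered_copy i)"

lemma of_copy_to_copy [simp]: "of_copy (to_copy x) = x"
  by (simp add: of_copy_def to_copy_def Abs_ordered_copy_inverse)

lemma to_copy_of_copy [simp]: "to_copy (of_copy x) = x"
  by (simp add: of_copy_def to_copy_def Rep_ordered_copy_inverse)

lemma bounded_linear_to_copy: "bounded_linear to_copy"
  by (intro linear_conv_bounded_linear[THEN iffD1] linearI) (simp_all add: to_copy_def vec_eq_iff)

lemma bounded_linear_of_copy: "bounded_linear of_copy"
  by (intro linear_conv_bounded_linear[THEN iffD1] linearI) (simp_all add: of_copy_def vec_eq_iff)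

lemma measurable_to_copy [measurable]: "to_copy \<in> borel \<rightarrow>\<^sub>M borel"
  by (intro borel_measurable_continuous_onI linear_continuous_on bounded_linear_to_copy)

lemma measurable_of_copy [measurable]: "of_copy \<in> borel \<rightarrow>\<^sub>M borel"
  by (intro borel_measurable_continuous_onI linear_continuous_on bounded_linear_of_copy)

lemma lborel_ordered_copy: "(lborel :: (real ^ 'n::finite ordered_copy) measure) = distr lborel borel to_copy"
proof (rule lborel_eqI)
  fix l u :: "real ^ 'n ordered_copy"
  assume le: "\<And>b. b \<in> Basis \<Longrightarrow> l \<bullet> b \<le> u \<bullet> b"
  have le: "l $ i \<le> u $ i" for i
    using le[of "axis i 1"] by (simp add: inner_axis)
  have "to_copy -` box l u = box (of_copy l) (of_copy u)"
    by (auto simp: Basis_real_vec inner_axis box_def to_copy_def of_copy_def)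
      (metis Abs_ordered_copy_inverse Rep_ordered_copy_inverse UNIV_I)+
  then have "emeasure (distr lborel borel to_copy) (box l u) = emeasure lborel (box (of_copy l) (of_copy u))"
    by (simp add: emeasure_distr)
  also have "\<dots> = (\<Prod>b\<in>Basis. (of_copy u - of_copy l) \<bullet> b)"
    using le by (intro emeasure_lborel_box) (auto simp: Basis_real_vec inner_axis of_copy_def)
  also have "(\<Prod>b\<in>Basis. (of_copy u - of_copy l) \<bullet> b) = (\<Prod>i::'n\<in>UNIV. (u - l) $ Abs_ordered_copy i)"
    by (simp add: Basis_real_vec prod.reindex[OF inj_axis_1] inner_axis of_copy_def)
  also have "\<dots> = (\<Prod>i\<in>UNIV. (u - l) $ i)"
    by (rule prod.reindex_bij_witness[of _ Rep_ordered_copy Abs_ordered_copy])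
      (auto simp: Rep_ordered_copy_inverse Abs_ordered_copy_inverse)
  also have "\<dots> = (\<Prod>b\<in>Basis. (u - l) \<bullet> b)"
    by (simp add: Basis_real_vec prod.reindex[OF inj_axis_1] inner_axis)
  finally show "emeasure (distr lborel borel to_copy) (box l u) = (\<Prod>b\<in>Basis. (u - l) \<bullet> b)" .
qed simp

text \<open>Conjugation with the bijection \<open>Rep_ordered_copy\<close> matches the permutations
  of the two index types and preserves signs, so the Leibniz sums agree term by term.\<close>

lemma det_reindex_ordered_copy:
  fixes A :: "real ^ 'n::finite ^ 'n"
  shows "det (\<chi> i j. A $ Rep_ordered_copy i $ Rep_ordered_copy j) = det A"
proof -
  let ?R = "Rep_ordered_copy :: 'n ordered_copy \<Rightarrow> 'n"
  have R: "inj ?R" "range ?R = UNIV" using bij_Rep_ordered_copy by (auto simp: bij_def)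
  have m: "map_permutation UNIV ?R p = ?R \<circ> p \<circ> inv ?R" for p
    by (simp add: map_permutation_def restrict_id_def R fun_eq_iff)
  have "det (\<chi> i j. A $ ?R i $ ?R j)
      = (\<Sum>p | p permutes UNIV. of_int (sign p) * (\<Prod>i\<in>UNIV. A $ ?R i $ ?R (p i)))"
    by (simp add: det_def)
  also have "\<dots> = (\<Sum>p | p permutes UNIV. of_int (sign p) * (\<Prod>i\<in>UNIV. A $ i $ p i))"
  proof (rule sum.reindex_bij_witness[where j = "\<lambda>p. ?R \<circ> p \<circ> inv ?R" and i = "\<lambda>p. inv ?R \<circ> p \<circ> ?R"])
    fix p :: "'n ordered_copy \<Rightarrow> _" assume "p \<in> {p. p permutes UNIV}"
    then have p: "p permutes UNIV" by simp
    show "inv ?R \<circ> (?R \<circ> p \<circ> inv ?R) \<circ> ?R = p" using R by (auto simp: fun_eq_iff)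
    have "bij_betw ?R UNIV UNIV" using R by (simp add: bij_betw_def)
    from map_permutation_permutes[OF this p] show "?R \<circ> p \<circ> inv ?R \<in> {p. p permutes UNIV}"
      by (simp add: m)
    have "sign (?R \<circ> p \<circ> inv ?R) = sign p"
      using sign_map_permutation[OF R(1) p] by (simp add: m)
    moreover have "(\<Prod>i\<in>UNIV. A $ i $ (?R \<circ> p \<circ> inv ?R) i) = (\<Prod>i\<in>UNIV. A $ ?R i $ ?R (p i))"
      by (rule prod.reindex_bij_witness[of _ ?R "inv ?R"]) (use R in \<open>auto simp: surj_f_inv_f\<close>)
    ultimately show "of_int (sign (?R \<circ> p \<circ> inv ?R)) * (\<Prod>i\<in>UNIV. A $ i $ (?R \<circ> p \<circ> inv ?R) i)
      = (of_int (sign p) * (\<Prod>i\<in>UNIV. A $ ?R i $ ?R (p i)) :: real)" by simp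
  next
    fix p :: "'n \<Rightarrow> _" assume "p \<in> {p. p permutes UNIV}"
    then have p: "p permutes UNIV" by simp
    show "?R \<circ> (inv ?R \<circ> p \<circ> ?R) \<circ> inv ?R = p" using R by (auto simp: fun_eq_iff surj_f_inv_f)
    have "bij p" using p by (simp add: permutes_bij)
    then have "bij (inv ?R \<circ> p \<circ> ?R)"
      using bij_Rep_ordered_copy by (intro bij_comp bij_imp_bij_inv)
    then show "inv ?R \<circ> p \<circ> ?R \<in> {p. p permutes UNIV}"
      by (auto intro: bij_imp_permutes)
  qed
  finally show ?thesis by (simp add: det_def)
qed

section \<open>Change of variables for nonnegative integrands\<close>

text \<open>The formula for absolutely integrable functions says that one side has integral
  \<open>b\<close> iff the other has. For nonnegative integrands this compares the two sides at
  every finite value, hence they are also infinite together.\<close>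

lemma nn_integral_change_of_variables_wellorder:
  fixes f :: "real ^ 'n::{finite,wellorder} \<Rightarrow> real" and g :: "real ^ 'n::_ \<Rightarrow> real ^ 'n::_"
  assumes S: "S \<in> sets lebesgue"
    and der_g: "\<And>x. x \<in> S \<Longrightarrow> (g has_derivative g' x) (at x within S)"
    and inj: "inj_on g S"
    and f: "\<And>x. x \<in> S \<Longrightarrow> 0 \<le> f (g x)"
    and m1: "(\<lambda>x. \<bar>det (matrix (g' x))\<bar> * f (g x) * indicator S x) \<in> borel_measurable lebesgue"
    and m2: "(\<lambda>x. f x * indicator (g ` S) x) \<in> borel_measurable lebesgue"
  shows "(\<integral>\<^sup>+ x. ennreal (\<bar>det (matrix (g' x))\<bar> * f (g x) * indicator S x) \<partial>lborel)
    = (\<integral>\<^sup>+ x. ennreal (f x * indicator (g ` S) x) \<partial>lborel)"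
    (is "integral\<^sup>N lborel (\<lambda>x. ennreal (?h1 x)) = integral\<^sup>N lborel (\<lambda>x. ennreal (?h2 x))")
proof -
  have nn: "0 \<le> ?h1 x" "0 \<le> ?h2 x" for x
    using f by (auto simp: indicator_def)
  \<comment> \<open>The formula is for vector-valued integrands, so the real one passes through
    \<open>real ^ 1\<close>.\<close>
  have "(\<lambda>x. \<bar>det (matrix (g' x))\<bar> *\<^sub>R (vec (f (g x)) :: real ^ 1)) absolutely_integrable_on S \<and>
      integral S (\<lambda>x. \<bar>det (matrix (g' x))\<bar> *\<^sub>R (vec (f (g x)) :: real ^ 1)) = vec b
    \<longleftrightarrow> (\<lambda>x. vec (f x) :: real ^ 1) absolutely_integrable_on (g ` S) \<and> integral (g ` S) (\<lambda>x. vec (f x) :: real ^ 1) = vec b" for b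
    by (intro has_absolute_integral_change_of_variables S der_g inj) auto
  then have *: "(\<lambda>x. \<bar>det (matrix (g' x))\<bar> * f (g x)) absolutely_integrable_on S \<and>
      integral S (\<lambda>x. \<bar>det (matrix (g' x))\<bar> * f (g x)) = b
    \<longleftrightarrow> f absolutely_integrable_on (g ` S) \<and> integral (g ` S) f = b" for b
    by (simp add: absolutely_integrable_on_1_iff integral_on_1_eq)
  have ab: "h absolutely_integrable_on T \<and> integral T h = b \<longleftrightarrow> ((\<lambda>x. h x * indicator T x) has_integral b) UNIV"
    if "\<And>x. x \<in> T \<Longrightarrow> 0 \<le> h x" for h :: "real ^ 'n::{finite,wellorder} \<Rightarrow> real" and T b
  proof -
    have "(\<lambda>x. h x * indicator T x) = (\<lambda>x. if x \<in> T then h x else 0)" by (auto simp: indicator_def)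
    then show ?thesis
      using absolutely_integrable_on_iff_nonneg[of T h] that has_integral_restrict_UNIV[of T h b]
      by (auto simp: has_integral_iff)
  qed
  have iff: "(?h1 has_integral b) UNIV \<longleftrightarrow> (?h2 has_integral b) UNIV" for b
    using *[of b] ab[of S "\<lambda>x. \<bar>det (matrix (g' x))\<bar> * f (g x)" b] ab[of "g ` S" f b] f by force
  have eq: "integral\<^sup>N lborel (\<lambda>x. ennreal (?h1 x)) = ennreal r \<longleftrightarrow> integral\<^sup>N lborel (\<lambda>x. ennreal (?h2 x)) = ennreal r"
    if "r \<ge> 0" for r
    using iff[of r] has_integral_iff_nn_integral_lebesgue[of ?h1 r] has_integral_iff_nn_integral_lebesgue[of ?h2 r]
      nn m1 m2 that by (simp add: nn_integral_completion)
  show ?thesis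
  proof (cases "integral\<^sup>N lborel (\<lambda>x. ennreal (?h1 x))" rule: ennreal_cases)
    case (real r)
    then show ?thesis using eq[of r] by simp
  next
    case top
    then show ?thesis using eq by (cases "integral\<^sup>N lborel (\<lambda>x. ennreal (?h2 x))" rule: ennreal_cases) force+
  qed
qed

text \<open>Everything is conjugated with the relabelling \<open>to_copy\<close>, which preserves
  Lebesgue measure and, by \<open>det_reindex_ordered_copy\<close>, the Jacobian.\<close>

lemma nn_integral_change_of_variables:
  fixes f :: "real ^ 'n::finite \<Rightarrow> real" and g :: "real ^ 'n \<Rightarrow> real ^ 'n"
  assumes S: "S \<in> sets borel" and gS: "g ` S \<in> sets borel"
    and der_g: "\<And>x. x \<in> S \<Longrightarrow> (g has_derivative g' x) (at x within S)"
    and inj: "inj_on g S"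
    and f: "\<And>x. x \<in> S \<Longrightarrow> 0 \<le> f (g x)"
    and m1: "(\<lambda>x. \<bar>det (matrix (g' x))\<bar> * f (g x) * indicator S x) \<in> borel_measurable borel"
    and m2: "(\<lambda>x. f x * indicator (g ` S) x) \<in> borel_measurable borel"
  shows "(\<integral>\<^sup>+ x. ennreal (\<bar>det (matrix (g' x))\<bar> * f (g x) * indicator S x) \<partial>lborel)
    = (\<integral>\<^sup>+ x. ennreal (f x * indicator (g ` S) x) \<partial>lborel)"
proof -
  define T where "T = of_copy -` S"
  define G where "G = to_copy \<circ> g \<circ> of_copy"
  define G' where "G' x = to_copy \<circ> g' (of_copy x) \<circ> of_copy" for x
  interpret to: bounded_linear "to_copy :: real ^ 'n \<Rightarrow> _" by (rule bounded_linear_to_copy)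
  interpret of': bounded_linear "of_copy :: _ \<Rightarrow> real ^ 'n" by (rule bounded_linear_of_copy)
  have T: "T = to_copy ` S"
    unfolding T_def by (auto simp: image_iff intro!: bexI[of _ "of_copy _"])
  have GT: "G ` T = of_copy -` (g ` S)"
    by (auto simp: T G_def image_iff) (metis to_copy_of_copy)
  have det: "det (matrix (G' x)) = det (matrix (g' (of_copy x)))" for x
  proof -
    have "of_copy (axis i 1) = axis (Rep_ordered_copy i) 1" for i :: "'n ordered_copy"
      by (auto simp: of_copy_def axis_def vec_eq_iff Rep_ordered_copy_inverse Abs_ordered_copy_inverse)
    then have "matrix (G' x) = (\<chi> i j. matrix (g' (of_copy x)) $ Rep_ordered_copy i $ Rep_ordered_copy j)"
      by (simp add: matrix_def G'_def to_copy_def)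
    then show ?thesis by (simp add: det_reindex_ordered_copy)
  qed
  have Tb: "T \<in> sets borel" using S measurable_sets[OF measurable_of_copy, of S] by (simp add: T_def)
  have h1: "(\<lambda>x. \<bar>det (matrix (G' x))\<bar> * f (of_copy (G x)) * indicator T x)
      = (\<lambda>x. \<bar>det (matrix (g' x))\<bar> * f (g x) * indicator S x) \<circ> of_copy"
    by (auto simp: det G_def T_def fun_eq_iff indicator_def)
  have h2: "(\<lambda>x. f (of_copy x) * indicator (G ` T) x) = (\<lambda>x. f x * indicator (g ` S) x) \<circ> of_copy"
    unfolding GT by (auto simp: fun_eq_iff indicator_def)
  have nn: "(\<integral>\<^sup>+ x. ennreal ((h \<circ> of_copy) x) \<partial>lborel) = (\<integral>\<^sup>+ x. ennreal (h x) \<partial>lborel)"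
    if [measurable]: "h \<in> borel_measurable borel" for h :: "real ^ 'n \<Rightarrow> real"
    by (subst lborel_ordered_copy, subst nn_integral_distr) simp_all
  have "(\<integral>\<^sup>+ x. ennreal (\<bar>det (matrix (G' x))\<bar> * f (of_copy (G x)) * indicator T x) \<partial>lborel)
    = (\<integral>\<^sup>+ x. ennreal (f (of_copy x) * indicator (G ` T) x) \<partial>lborel)"
  proof (rule nn_integral_change_of_variables_wellorder)
    show "T \<in> sets lebesgue" using Tb by simp
    show "inj_on G T"
      using inj unfolding inj_on_def T G_def by simp (metis of_copy_to_copy)
    show "(G has_derivative G' x) (at x within T)" if "x \<in> T" for x
    proof -
      have "(g has_derivative g' (of_copy x)) (at (of_copy x) within of_copy ` T)"
        using der_g[of "of_copy x"] that by (simp add: T image_comp comp_def) auto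
      then have "(g \<circ> of_copy has_derivative g' (of_copy x) \<circ> of_copy) (at x within T)"
        unfolding comp_def by (rule has_derivative_in_compose[rotated]) (intro of'.has_derivative has_derivative_ident)
      then show ?thesis
        unfolding G_def G'_def comp_def by (rule to.has_derivative)
    qed
    show "0 \<le> f (of_copy (G x))" if "x \<in> T" for x
      using that f by (auto simp: T G_def)
    show "(\<lambda>x. \<bar>det (matrix (G' x))\<bar> * f (of_copy (G x)) * indicator T x) \<in> borel_measurable lebesgue"
      unfolding h1 using measurable_comp[OF measurable_of_copy m1]
      by (intro measurable_completion) simp
    show "(\<lambda>x. f (of_copy x) * indicator (G ` T) x) \<in> borel_measurable lebesgue"
      unfolding h2 using measurable_comp[OF measurable_of_copy m2]
      by (intro measurable_completion) simp
  qed
  then have "(\<integral>\<^sup>+ x. ennreal (((\<lambda>x. \<bar>det (matrix (g' x))\<bar> * f (g x) * indicator S x) \<circ> of_copy) x) \<partial>lborel)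
    = (\<integral>\<^sup>+ x. ennreal (((\<lambda>x. f x * indicator (g ` S) x) \<circ> of_copy) x) \<partial>lborel)"
    by (simp only: h1[symmetric] h2[symmetric])
  then show ?thesis
    unfolding nn[OF m1] nn[OF m2] .
qed


section \<open>Integration over coordinate subspaces\<close>

definition coord_embed :: "'n::finite set \<Rightarrow> ('n \<Rightarrow> real) \<Rightarrow> real ^ 'n" where
  "coord_embed I f = (\<chi> i. if i \<in> I then f i else 0)"

lemma coord_lborel_eq: "coord_lborel I = distr (Pi\<^sub>M I (\<lambda>_. lborel)) borel (coord_embed I)"
  by (simp add: coord_lborel_def coord_embed_def[abs_def])

lemma measurable_coord_embed [measurable]:
  fixes I :: "'n::finite set"
  shows "coord_embed I \<in> Pi\<^sub>M I (\<lambda>_. lborel) \<rightarrow>\<^sub>M borel"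
proof (subst borel_measurable_euclidean_space, intro ballI)
  fix b :: "real ^ 'n" assume "b \<in> Basis"
  then obtain i where b: "b = axis i 1" by (auto simp: Basis_real_vec)
  show "(\<lambda>f. coord_embed I f \<bullet> b) \<in> borel_measurable (Pi\<^sub>M I (\<lambda>_. lborel))"
    by (cases "i \<in> I") (simp_all add: b inner_axis coord_embed_def)
qed

lemma sets_coord_lborel [simp, measurable_cong]: "sets (coord_lborel I) = sets borel"
  by (simp add: coord_lborel_def)

lemma space_coord_lborel [simp]: "space (coord_lborel I) = UNIV"
  by (simp add: coord_lborel_def)

lemma nn_integral_coord_lborel:
  assumes [measurable]: "F \<in> borel_measurable borel"
  shows "integral\<^sup>N (coord_lborel I) F = (\<integral>\<^sup>+ f. F (coord_embed I f) \<partial>Pi\<^sub>M I (\<lambda>_. lborel))"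
  unfolding coord_lborel_eq by (rule nn_integral_distr) auto

lemma emeasure_coord_lborel_box:
  assumes "\<And>i. i \<in> I \<Longrightarrow> l i \<le> u i"
  shows "emeasure (coord_lborel I) {x \<in> coord_space I. \<forall>i\<in>I. l i \<le> x $ i \<and> x $ i \<le> u i} = ennreal (\<Prod>i\<in>I. u i - l i)"
    (is "emeasure _ ?Q = _")
proof -
  interpret product_sigma_finite "\<lambda>_::'a. lborel :: real measure" by standard
  have "closed ?Q"
  proof -
    have "?Q = (\<Inter>i\<in>-I. {x. x $ i = 0}) \<inter> (\<Inter>i\<in>I. {x. l i \<le> x $ i} \<inter> {x. x $ i \<le> u i})"
      by (auto simp: coord_space_def)
    then show ?thesis
      by (simp add: closed_INT closed_Int closed_Collect_eq closed_Collect_le continuous_intros)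
  qed
  then have [measurable]: "?Q \<in> sets borel" by simp
  have "coord_embed I -` ?Q \<inter> space (Pi\<^sub>M I (\<lambda>_. lborel)) = (\<Pi>\<^sub>E i\<in>I. {l i..u i})"
    by (auto simp: coord_embed_def coord_space_def space_PiM PiE_def Pi_def)
  then have "emeasure (coord_lborel I) ?Q = emeasure (Pi\<^sub>M I (\<lambda>_. lborel)) (\<Pi>\<^sub>E i\<in>I. {l i..u i})"
    unfolding coord_lborel_eq by (subst emeasure_distr) simp_all
  also have "\<dots> = (\<Prod>i\<in>I. ennreal (u i - l i))"
    by (subst emeasure_PiM) (auto simp: assms)
  also have "\<dots> = ennreal (\<Prod>i\<in>I. u i - l i)"
    by (rule prod_ennreal) (simp add: assms)
  finally show ?thesis .
qed

lemma closed_coord_space: "closed (coord_space I)"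
proof -
  have "coord_space I = (\<Inter>i\<in>-I. {x. x $ i = 0})"
    by (auto simp: coord_space_def)
  then show ?thesis by (simp add: closed_INT closed_Collect_eq continuous_intros)
qed

lemma AE_coord_lborel_coord_space: "AE x in coord_lborel I. x \<in> coord_space I"
proof -
  have "{x \<in> space borel. x \<in> coord_space I} \<in> sets borel"
    using closed_coord_space[of I] by simp
  then show ?thesis
    unfolding coord_lborel_eq by (subst AE_distr_iff) (auto simp: coord_embed_def coord_space_def)
qed

lemma closed_model: "closed (model I)"
proof -
  have "model I = coord_space I \<inter> {x. 0 \<le> x $ bdry_index}"
    by (auto simp: model_def)
  then show ?thesis by (simp add: closed_Int closed_coord_space closed_Collect_le continuous_intros)
qed

lemma emeasure_coord_lborel_bounded:
  assumes "bounded B"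
  shows "emeasure (coord_lborel I) B < \<infinity>"
proof -
  obtain r where r: "r > 0" "\<And>x. x \<in> B \<Longrightarrow> norm x \<le> r"
    using assms bounded_pos by blast
  let ?Q = "{x \<in> coord_space I. \<forall>i\<in>I. - r \<le> x $ i \<and> x $ i \<le> r}"
  show ?thesis
  proof (cases "B \<in> sets borel")
    case True
    have "emeasure (coord_lborel I) B \<le> emeasure (coord_lborel I) ?Q"
    proof (rule emeasure_mono_AE)
      show "AE x in coord_lborel I. x \<in> B \<longrightarrow> x \<in> ?Q"
        using AE_coord_lborel_coord_space
      proof eventually_elim
        case (elim x)
        then show ?case
          using r(2) component_le_norm_cart[of x] by (auto simp: abs_le_iff) (smt (verit))+
      qed
      have "?Q = coord_space I \<inter> (\<Inter>i\<in>I. {x. - r \<le> x $ i} \<inter> {x. x $ i \<le> r})"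
        by auto
      then have "closed ?Q"
        by (simp add: closed_INT closed_Int closed_coord_space closed_Collect_le continuous_intros)
      then show "?Q \<in> sets (coord_lborel I)" by simp
    qed
    also have "\<dots> < \<infinity>" using r(1) by (subst emeasure_coord_lborel_box) simp_all
    finally show ?thesis .
  next
    \<comment> \<open>A non-measurable set has \<open>emeasure\<close> 0 by convention.\<close>
    case False
    then show ?thesis by (simp add: emeasure_notin_sets)
  qed
qed

lemma sigma_finite_coord_lborel: "sigma_finite_measure (coord_lborel I)"
proof
  show "\<exists>A. countable A \<and> A \<subseteq> sets (coord_lborel I) \<and> \<Union> A = space (coord_lborel I) \<and>
      (\<forall>a\<in>A. emeasure (coord_lborel I) a \<noteq> \<infinity>)"
  proof (intro exI[of _ "range (\<lambda>n. cball 0 (real n))"] conjI ballI)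
    show "\<Union> (range (\<lambda>n. cball 0 (real n))) = space (coord_lborel I)"
      using real_arch_simple by auto
    fix a :: "(real ^ 'a) set" assume "a \<in> range (\<lambda>n. cball 0 (real n))"
    then show "emeasure (coord_lborel I) a \<noteq> \<infinity>"
      using emeasure_coord_lborel_bounded[of a I] by auto
  qed auto
qed

text \<open>Fubini for two complementary coordinate subspaces; points are sums \<open>x + y\<close>,
  so both factors remain inside \<open>real ^ 'n\<close>.\<close>

lemma nn_integral_lborel_split:
  fixes F :: "real ^ 'n::finite \<Rightarrow> ennreal"
  assumes [measurable]: "F \<in> borel_measurable borel"
  shows "integral\<^sup>N lborel F = (\<integral>\<^sup>+ x. (\<integral>\<^sup>+ y. F (x + y) \<partial>coord_lborel (- I)) \<partial>coord_lborel I)"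
proof -
  interpret product_sigma_finite "\<lambda>_::'n. lborel :: real measure" by standard
  interpret sigma_finite_measure "coord_lborel (- I)" by (rule sigma_finite_coord_lborel)
  have "integral\<^sup>N lborel F = (\<integral>\<^sup>+ f. F (coord_embed (I \<union> - I) f) \<partial>Pi\<^sub>M (I \<union> - I) (\<lambda>_. lborel))"
    unfolding coord_lborel_UNIV[symmetric] by (simp add: nn_integral_coord_lborel)
  also have "\<dots> = (\<integral>\<^sup>+ f. (\<integral>\<^sup>+ h. F (coord_embed (I \<union> - I) (merge I (- I) (f, h))) \<partial>Pi\<^sub>M (- I) (\<lambda>_. lborel)) \<partial>Pi\<^sub>M I (\<lambda>_. lborel))"
    by (rule product_nn_integral_fold) (auto simp del: Compl_partition)
  also have "\<dots> = (\<integral>\<^sup>+ f. (\<integral>\<^sup>+ h. F (coord_embed I f + coord_embed (- I) h) \<partial>Pi\<^sub>M (- I) (\<lambda>_. lborel)) \<partial>Pi\<^sub>M I (\<lambda>_. lborel))"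
    by (intro nn_integral_cong arg_cong[of _ _ F]) (auto simp: coord_embed_def merge_def vec_eq_iff)
  also have "\<dots> = (\<integral>\<^sup>+ f. (\<integral>\<^sup>+ y. F (coord_embed I f + y) \<partial>coord_lborel (- I)) \<partial>Pi\<^sub>M I (\<lambda>_. lborel))"
    by (intro nn_integral_cong nn_integral_coord_lborel[symmetric]) simp
  also have "\<dots> = (\<integral>\<^sup>+ x. (\<integral>\<^sup>+ y. F (x + y) \<partial>coord_lborel (- I)) \<partial>coord_lborel I)"
    by (rule nn_integral_coord_lborel[symmetric]) measurable
  finally show ?thesis .
qed

lemma coord_lborel_singleton: "coord_lborel {i} = distr lborel borel (\<lambda>t. t *\<^sub>R axis i 1)"
proof -
  interpret product_sigma_finite "\<lambda>_::'a. lborel :: real measure" by standard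
  have E: "coord_embed {i} = (\<lambda>x. x i *\<^sub>R axis i 1)"
    by (auto simp: fun_eq_iff coord_embed_def vec_eq_iff axis_def)
  have "distr lborel borel (\<lambda>t. t *\<^sub>R axis i (1::real)) =
    distr (distr (Pi\<^sub>M {i} (\<lambda>_. lborel)) lborel (\<lambda>x. x i)) borel (\<lambda>t. t *\<^sub>R axis i 1)"
    by (simp only: distr_singleton)
  also have "\<dots> = distr (Pi\<^sub>M {i} (\<lambda>_. lborel)) borel (\<lambda>x. x i *\<^sub>R axis i 1)"
    by (subst distr_distr) (simp_all add: comp_def del: distr_component)
  finally show ?thesis unfolding coord_lborel_eq E by (rule sym)
qed

lemma integral_lborel_split:
  fixes F :: "real ^ 'n::finite \<Rightarrow> real"
  assumes F: "integrable lborel F"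
  shows "integral\<^sup>L lborel F = (\<integral>x. (\<integral>t. F (x + t *\<^sub>R axis i 1) \<partial>lborel) \<partial>coord_lborel (UNIV - {i}))"
proof -
  let ?I = "UNIV - {i}"
  interpret A: sigma_finite_measure "coord_lborel ?I" by (rule sigma_finite_coord_lborel)
  interpret B: sigma_finite_measure "coord_lborel (- ?I)" by (rule sigma_finite_coord_lborel)
  interpret pair_sigma_finite "coord_lborel ?I" "coord_lborel (- ?I)" by standard
  have C: "- ?I = {i}" by auto
  \<comment> \<open>Lebesgue measure as the image of a product measure under addition: this carries
    Fubini from nonnegative to integrable functions.\<close>
  have D: "(lborel :: (real ^ 'n) measure) = distr (coord_lborel ?I \<Otimes>\<^sub>M coord_lborel (- ?I)) borel (\<lambda>(x, y). x + y)"
  proof (rule measure_eqI)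
    fix A :: "(real ^ 'n) set" assume "A \<in> sets lborel"
    then have [measurable]: "A \<in> sets borel" by simp
    have "emeasure lborel A = (\<integral>\<^sup>+ x. (\<integral>\<^sup>+ y. indicator A (x + y) \<partial>coord_lborel (- ?I)) \<partial>coord_lborel ?I)"
      by (subst nn_integral_lborel_split[symmetric]) simp_all
    also have "\<dots> = (\<integral>\<^sup>+ z. indicator A (case z of (x, y) \<Rightarrow> x + y) \<partial>(coord_lborel ?I \<Otimes>\<^sub>M coord_lborel (- ?I)))"
      by (subst B.nn_integral_fst[symmetric]) simp_all
    also have "\<dots> = (\<integral>\<^sup>+ z. indicator A z \<partial>distr (coord_lborel ?I \<Otimes>\<^sub>M coord_lborel (- ?I)) borel (\<lambda>(x, y). x + y))"
      by (subst nn_integral_distr) simp_all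
    finally show "emeasure lborel A = emeasure (distr (coord_lborel ?I \<Otimes>\<^sub>M coord_lborel (- ?I)) borel (\<lambda>(x, y). x + y)) A"
      by simp
  qed simp
  have Fm [measurable]: "F \<in> borel_measurable borel" using F by auto
  have int: "integrable (coord_lborel ?I \<Otimes>\<^sub>M coord_lborel (- ?I)) (\<lambda>(x, y). F (x + y))"
    using F unfolding D by (subst (asm) integrable_distr_eq) (simp_all add: case_prod_beta')
  have "integral\<^sup>L lborel F = (\<integral>z. (case z of (x, y) \<Rightarrow> F (x + y)) \<partial>(coord_lborel ?I \<Otimes>\<^sub>M coord_lborel (- ?I)))"
    by (subst D, subst integral_distr) (simp_all add: case_prod_beta')
  also have "\<dots> = (\<integral>x. (\<integral>y. F (x + y) \<partial>coord_lborel (- ?I)) \<partial>coord_lborel ?I)"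
    using integral_fst'[symmetric, OF int] by simp
  also have "\<dots> = (\<integral>x. (\<integral>t. F (x + t *\<^sub>R axis i 1) \<partial>lborel) \<partial>coord_lborel ?I)"
    unfolding C coord_lborel_singleton by (intro Bochner_Integration.integral_cong refl integral_distr) simp_all
  finally show ?thesis .
qed

section \<open>Thickening of coordinate subspaces\<close>

definition coord_proj :: "'n::finite set \<Rightarrow> real ^ 'n \<Rightarrow> real ^ 'n" where
  "coord_proj I x = (\<chi> i. if i \<in> I then x $ i else 0)"

lemma bounded_linear_coord_proj: "bounded_linear (coord_proj I)"
  by (intro linear_conv_bounded_linear[THEN iffD1] linearI) (simp_all add: coord_proj_def vec_eq_iff)

lemma measurable_coord_proj [measurable]: "coord_proj I \<in> borel \<rightarrow>\<^sub>M borel"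
  by (intro borel_measurable_continuous_onI linear_continuous_on bounded_linear_coord_proj)

lemma coord_proj_in [simp]: "coord_proj I x \<in> coord_space I"
  by (simp add: coord_proj_def coord_space_def)

lemma coord_proj_id: "x \<in> coord_space I \<Longrightarrow> coord_proj I x = x"
  by (auto simp: coord_proj_def coord_space_def vec_eq_iff)

lemma coord_proj_zero: "x \<in> coord_space (- I) \<Longrightarrow> coord_proj I x = 0"
  by (auto simp: coord_proj_def coord_space_def vec_eq_iff)

definition slab :: "'n::finite set \<Rightarrow> (real ^ 'n) set" where
  "slab I = {x. \<forall>i. i \<notin> I \<longrightarrow> 0 \<le> x $ i \<and> x $ i \<le> 1}"

lemma closed_slab: "closed (slab I)"
proof -
  have "slab I = (\<Inter>i\<in>-I. {x. 0 \<le> x $ i} \<inter> {x. x $ i \<le> 1})"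
    by (auto simp: slab_def)
  then show ?thesis
    by (simp add: closed_INT closed_Int closed_Collect_le continuous_intros)
qed

text \<open>Thickening by a unit cube turns integrals over \<open>coord_space I\<close> into integrals over the full space,
  where the change of variables formula is available.\<close>

lemma nn_integral_coord_lborel_slab:
  fixes F :: "real ^ 'n::finite \<Rightarrow> ennreal"
  assumes [measurable]: "F \<in> borel_measurable borel"
  shows "integral\<^sup>N (coord_lborel I) F = (\<integral>\<^sup>+ x. F (coord_proj I x) * indicator (slab I) x \<partial>lborel)"
proof -
  have [measurable]: "slab I \<in> sets borel" for I :: "'n set" by (rule borel_closed[OF closed_slab])
  have *: "(\<integral>\<^sup>+ y. F (coord_proj I (x + y)) * indicator (slab I) (x + y) \<partial>coord_lborel (- I)) = F x"
    if x: "x \<in> coord_space I" for x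
  proof -
    let ?Q = "{y \<in> coord_space (- I). \<forall>i\<in>- I. 0 \<le> y $ i \<and> y $ i \<le> 1}"
    have Q: "emeasure (coord_lborel (- I)) ?Q = 1"
      using emeasure_coord_lborel_box[of "- I" "\<lambda>_. 0" "\<lambda>_. 1"] by simp
    then have Qm: "?Q \<in> sets (coord_lborel (- I))"
      by (intro emeasure_neq_0_sets) simp
    have "(\<integral>\<^sup>+ y. F (coord_proj I (x + y)) * indicator (slab I) (x + y) \<partial>coord_lborel (- I))
        = (\<integral>\<^sup>+ y. F x * indicator ?Q y \<partial>coord_lborel (- I))"
    proof (rule nn_integral_cong_AE)
      show "AE y in coord_lborel (- I). F (coord_proj I (x + y)) * indicator (slab I) (x + y) = F x * indicator ?Q y"
        using AE_coord_lborel_coord_space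
      proof eventually_elim
        case (elim y)
        have "coord_proj I (x + y) = x"
          using x elim by (simp add: bounded_linear.linear[OF bounded_linear_coord_proj, THEN linear_add]
              coord_proj_id coord_proj_zero)
        moreover have "x + y \<in> slab I \<longleftrightarrow> y \<in> ?Q"
          using x elim by (auto simp: slab_def coord_space_def)
        ultimately show ?case by (simp add: indicator_def)
      qed
    qed
    also have "\<dots> = F x" by (simp add: nn_integral_cmult_indicator[OF Qm] Q)
    finally show ?thesis .
  qed
  have "(\<integral>\<^sup>+ x. F (coord_proj I x) * indicator (slab I) x \<partial>lborel)
      = (\<integral>\<^sup>+ x. (\<integral>\<^sup>+ y. F (coord_proj I (x + y)) * indicator (slab I) (x + y) \<partial>coord_lborel (- I)) \<partial>coord_lborel I)"
    by (rule nn_integral_lborel_split) measurable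
  also have "\<dots> = integral\<^sup>N (coord_lborel I) F"
  proof (rule nn_integral_cong_AE)
    show "AE x in coord_lborel I. (\<integral>\<^sup>+ y. F (coord_proj I (x + y)) * indicator (slab I) (x + y) \<partial>coord_lborel (- I)) = F x"
      using AE_coord_lborel_coord_space[of I] by eventually_elim (rule *)
  qed
  finally show ?thesis by simp
qed

text \<open>If \<open>u y > 0\<close>, then \<open>u\<close> exceeds \<open>u y / 2\<close> on a
  small cube of positive measure inside \<open>S\<close>. The cube has \<open>y\<close> as its
  lowest corner and therefore stays in the half-space even when \<open>y\<close> lies on the
  face.\<close>

lemma nn_integral_zero_imp_zero:
  fixes u :: "real ^ 'n::finite \<Rightarrow> real"
  assumes S: "openin (top_of_set (model I)) S" and u: "continuous_on S u"
    and z: "(\<integral>\<^sup>+ x. ennreal (u x) * indicator S x \<partial>coord_lborel I) = 0" and y: "y \<in> S"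
  shows "u y \<le> 0"
proof (rule ccontr)
  assume "\<not> u y \<le> 0"
  then have pos: "u y > 0" by simp
  obtain r where r: "r > 0" "ball y r \<inter> model I \<subseteq> S"
    using S y unfolding openin_contains_ball by blast
  obtain d where d: "d > 0" "\<And>x. x \<in> S \<Longrightarrow> dist x y < d \<Longrightarrow> dist (u x) (u y) < u y / 2"
    using u pos y unfolding continuous_on_iff by (meson half_gt_zero)
  \<comment> \<open>The norm is at most the sum of the coordinates, so a cube of this side lies
    within \<open>min r d / 2\<close> of \<open>y\<close>.\<close>
  define e where "e = min r d / (2 * CARD('n))"
  have e: "e > 0" using r(1) d(1) by (simp add: e_def)
  let ?Q = "{x \<in> coord_space I. \<forall>i\<in>I. y $ i \<le> x $ i \<and> x $ i \<le> y $ i + e}"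
  have ym: "y \<in> model I" using S y openin_imp_subset by blast
  have Q: "x \<in> S \<and> u x \<ge> u y / 2" if x: "x \<in> ?Q" for x
  proof -
    have "norm (x - y) \<le> (\<Sum>i\<in>UNIV. \<bar>(x - y) $ i\<bar>)" by (rule norm_le_l1_cart)
    also have "\<dots> \<le> (\<Sum>i::'n\<in>UNIV. e)"
    proof (rule sum_mono)
      fix i
      show "\<bar>(x - y) $ i\<bar> \<le> e"
        using x ym e by (cases "i \<in> I") (auto simp: coord_space_def model_def abs_le_iff)
    qed
    also have "\<dots> = min r d / 2" by (simp add: e_def)
    also have "\<dots> < min r d" using r(1) d(1) by auto
    finally have near: "dist x y < r" "dist x y < d" by (simp_all add: dist_norm)
    have "x \<in> model I"
      using x ym unfolding model_def by (cases "bdry_index \<in> I") (force simp: coord_space_def)+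
    then have "x \<in> S" using near(1) r(2) by (auto simp: dist_commute)
    moreover have "dist (u x) (u y) < u y / 2" using d(2) \<open>x \<in> S\<close> near by blast
    ultimately show ?thesis by (auto simp: dist_real_def abs_if split: if_splits)
  qed
  have em: "emeasure (coord_lborel I) ?Q = ennreal (e ^ card I)"
    using e by (subst emeasure_coord_lborel_box) auto
  then have Qm: "?Q \<in> sets (coord_lborel I)"
    using e by (intro emeasure_neq_0_sets) simp
  have "ennreal (u y / 2) * emeasure (coord_lborel I) ?Q = (\<integral>\<^sup>+ x. ennreal (u y / 2) * indicator ?Q x \<partial>coord_lborel I)"
    by (simp add: nn_integral_cmult_indicator[OF Qm])
  also have "\<dots> \<le> (\<integral>\<^sup>+ x. ennreal (u x) * indicator S x \<partial>coord_lborel I)"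
    using Q by (intro nn_integral_mono) (auto simp: indicator_def intro: ennreal_leI)
  finally have "ennreal (u y / 2) * ennreal (e ^ card I) = 0" using z em by simp
  then show False using pos zero_less_power[OF e, of "card I"]
    by (simp add: ennreal_mult[symmetric] ennreal_eq_0_iff mult_le_0_iff not_le)
qed


section \<open>Existence and uniqueness of the volume measure\<close>

lemma is_chartD:
  assumes "is_chart I M c"
  shows "openin (top_of_set M) (fst c)" "openin (top_of_set (model I)) (chart_image c)"
    "homeomorphism (fst c) (chart_image c) (snd c) (chart_inv c)"
    "fst c \<subseteq> M" "chart_image c \<subseteq> model I"
  using assms unfolding is_chart_def by (auto dest: openin_imp_subset)

lemma chart_inv_apply: "is_chart I M c \<Longrightarrow> p \<in> fst c \<Longrightarrow> chart_inv c (snd c p) = p"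
  using is_chartD(3) homeomorphism_apply1 by blast

lemma chart_apply_inv: "is_chart I M c \<Longrightarrow> x \<in> chart_image c \<Longrightarrow> snd c (chart_inv c x) = x"
  using is_chartD(3) homeomorphism_apply2 by blast

lemma chart_inv_in: "is_chart I M c \<Longrightarrow> x \<in> chart_image c \<Longrightarrow> chart_inv c x \<in> fst c"
  by (metis chart_image_def chart_inv_def inv_into_into)

lemma chart_inv_in_image_iff:
  assumes "is_chart I M c" "x \<in> chart_image c" "K \<subseteq> chart_image c"
  shows "chart_inv c x \<in> chart_inv c ` K \<longleftrightarrow> x \<in> K"
proof
  assume "chart_inv c x \<in> chart_inv c ` K"
  then obtain y where y: "y \<in> K" "chart_inv c x = chart_inv c y" by auto
  then have "x = y" using chart_apply_inv[OF assms(1)] assms(2,3) by (metis subsetD)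
  then show "x \<in> K" using y by simp
qed simp

lemma chart_in_image: "p \<in> fst c \<Longrightarrow> snd c p \<in> chart_image c"
  by (simp add: chart_image_def)

lemma chart_image_subset_coord_space: "is_chart I M c \<Longrightarrow> chart_image c \<subseteq> coord_space I"
  using is_chartD(5)[of I M c] by (auto simp: model_def)

lemma chart_image_Int_eq:
  assumes "is_chart I M c"
  shows "snd c ` (fst c \<inter> U) = chart_image c \<inter> chart_inv c -` U"
proof (intro equalityI subsetI)
  fix x assume "x \<in> snd c ` (fst c \<inter> U)"
  then show "x \<in> chart_image c \<inter> chart_inv c -` U"
    using chart_inv_apply[OF assms] by (auto simp: chart_image_def)
next
  fix x assume "x \<in> chart_image c \<inter> chart_inv c -` U"
  then show "x \<in> snd c ` (fst c \<inter> U)"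
    using chart_apply_inv[OF assms, of x] chart_inv_in[OF assms, of x] by (metis IntE IntI image_eqI vimageD)
qed

lemma openin_chart_image_Int:
  assumes c: "is_chart I M c" and U: "openin (top_of_set M) U"
  shows "openin (top_of_set (model I)) (snd c ` (fst c \<inter> U))"
proof -
  have "openin (top_of_set (fst c)) (fst c \<inter> U)"
    using U is_chartD(4)[OF c] by (metis inf_commute inf.absorb_iff1 openin_subtopology_Int subtopology_subtopology)
  then have "openin (top_of_set (chart_image c)) (snd c ` (fst c \<inter> U))"
    using homeomorphism_imp_open_map[OF is_chartD(3)[OF c]] by blast
  then show ?thesis using is_chartD(2)[OF c] openin_trans by blast
qed

lemma openin_model_borel: "openin (top_of_set (model I)) S \<Longrightarrow> S \<in> sets borel"
  using closed_model[of I] by (auto simp: openin_open)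

lemma continuous_on_imp_indicator_measurable:
  fixes u :: "real ^ 'n::finite \<Rightarrow> real"
  assumes S: "openin (top_of_set (model I)) S" and u: "continuous_on S u"
  shows "(\<lambda>x. u x * indicator S x) \<in> borel_measurable borel"
proof -
  have "u \<in> borel_measurable (restrict_space borel S)"
    by (rule borel_measurable_continuous_on_restrict[OF u])
  then have "(\<lambda>x. if x \<in> S then u x else 0) \<in> borel_measurable borel"
    using openin_model_borel[OF S] by (subst measurable_If_restrict_space_iff) auto
  moreover have "(\<lambda>x. if x \<in> S then u x else 0) = (\<lambda>x. u x * indicator S x)"
    by (auto simp: indicator_def)
  ultimately show ?thesis by simp
qed

text \<open>The components outside \<open>I\<close> vanish identically on \<open>D\<close>, and in
  the directions of \<open>I\<close> the derivative of a constant is unambiguously 0.\<close>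

lemma has_derivative_axis_in_coord_space:
  fixes T :: "real ^ 'n::finite \<Rightarrow> real ^ 'n"
  assumes D: "openin (top_of_set (model I)) D" "x \<in> D" "i \<in> I"
    and T': "(T has_derivative T') (at x within D)" and T: "T ` D \<subseteq> coord_space I"
  shows "T' (axis i 1) \<in> coord_space I"
  unfolding coord_space_def
proof (intro CollectI allI impI)
  fix k assume k: "k \<notin> I"
  have "((\<lambda>x. T x $ k) has_derivative (\<lambda>v. T' v $ k)) (at x within D)"
    by (rule bounded_linear.has_derivative[OF bounded_linear_vec_nth T'])
  moreover have "((\<lambda>x. T x $ k) has_derivative (\<lambda>v. 0)) (at x within D)"
  proof (rule has_derivative_transform[OF D(2), where f = "\<lambda>_. 0"])
    show "T y $ k = 0" if "y \<in> D" for y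
      using T k that by (auto simp: coord_space_def)
  qed simp
  ultimately show "T' (axis i 1) $ k = 0"
    using has_derivative_within_axis_unique[OF D] by blast
qed

text \<open>The chain rule for \<open>f \<circ> chart_inv c = (f \<circ> chart_inv d) \<circ>
  transition c d\<close> on the overlap. Of \<open>T'\<close> only the values in the directions of
  \<open>I\<close> enter, since nothing else of it is determined.\<close>

lemma overlap_differentiable_chain:
  fixes f :: "'a::topological_space \<Rightarrow> 'w::real_normed_vector"
  assumes c: "is_chart I M c" and d: "is_chart I M d" and p: "p \<in> fst c \<inter> fst d"
    and T': "(transition c d has_derivative T') (at (snd c p) within snd c ` (fst c \<inter> fst d))"
    and fc: "(f \<circ> chart_inv c) differentiable (at (snd c p) within chart_image c)"
    and fd: "(f \<circ> chart_inv d) differentiable (at (snd d p) within chart_image d)"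
    and i: "i \<in> I"
  shows "pderiv_in (chart_image c) i (f \<circ> chart_inv c) (snd c p)
    = (\<Sum>k\<in>I. (T' (axis i 1) $ k) *\<^sub>R pderiv_in (chart_image d) k (f \<circ> chart_inv d) (snd d p))"
    and "T' (axis i 1) \<in> coord_space I"
proof -
  let ?D = "snd c ` (fst c \<inter> fst d)"
  have D: "openin (top_of_set (model I)) ?D" by (rule openin_chart_image_Int[OF c is_chartD(1)[OF d]])
  have x: "snd c p \<in> ?D" using p by blast
  have Tx: "transition c d (snd c q) = snd d q" if "q \<in> fst c" for q
    using chart_inv_apply[OF c that] by (simp add: transition_def)
  have TD: "transition c d ` ?D \<subseteq> chart_image d" using Tx by (auto simp: chart_image_def)
  have Dc: "?D \<subseteq> chart_image c" by (auto simp: chart_image_def)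
  obtain f' where f': "((f \<circ> chart_inv c) has_derivative f') (at (snd c p) within chart_image c)"
    using fc by (auto simp: differentiable_def)
  obtain F' where F': "((f \<circ> chart_inv d) has_derivative F') (at (snd d p) within chart_image d)"
    using fd by (auto simp: differentiable_def)
  have "((f \<circ> chart_inv d) has_derivative F') (at (transition c d (snd c p)) within transition c d ` ?D)"
    using has_derivative_subset[OF F' TD] Tx[of p] p by simp
  then have "((\<lambda>x. (f \<circ> chart_inv d) (transition c d x)) has_derivative (\<lambda>v. F' (T' v))) (at (snd c p) within ?D)"
    by (rule has_derivative_in_compose[OF T'])
  then have "((f \<circ> chart_inv c) has_derivative (\<lambda>v. F' (T' v))) (at (snd c p) within ?D)"
  proof (rule has_derivative_transform[OF x, rotated])
    show "(f \<circ> chart_inv c) y = (f \<circ> chart_inv d) (transition c d y)" if "y \<in> ?D" for y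
      using that Tx chart_inv_apply[OF c] chart_inv_apply[OF d] by auto
  qed
  then have "f' (axis i 1) = F' (T' (axis i 1))"
    using has_derivative_within_axis_unique[OF D x i has_derivative_subset[OF f' Dc]] by simp
  moreover show Tc: "T' (axis i 1) \<in> coord_space I"
    using has_derivative_axis_in_coord_space[OF D x i T'] TD chart_image_subset_coord_space[OF d] by blast
  moreover have "snd c p \<in> chart_image c" "snd d p \<in> chart_image d" using p by (auto simp: chart_image_def)
  ultimately show "pderiv_in (chart_image c) i (f \<circ> chart_inv c) (snd c p)
    = (\<Sum>k\<in>I. (T' (axis i 1) $ k) *\<^sub>R pderiv_in (chart_image d) k (f \<circ> chart_inv d) (snd d p))"
    using pderiv_in_eq[OF is_chartD(2)[OF c] _ i f'] has_derivative_coord_space_eq_sum[OF is_chartD(2)[OF d] _ F' Tc]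
    by simp
qed

section \<open>Principal minors and Gram determinants\<close>

text \<open>Padding a principal submatrix with the identity keeps all index sets \<open>I\<close>
  within one matrix type, so that products and determinants need no change of size.\<close>

definition minor_matrix :: "'n::finite set \<Rightarrow> real ^ 'n ^ 'n \<Rightarrow> real ^ 'n ^ 'n" where
  "minor_matrix I G = (\<chi> i j. if i \<in> I \<and> j \<in> I then G $ i $ j else if i = j then 1 else 0)"

lemma minor_eq_det: "minor I G = det (minor_matrix I G)"
  by (simp add: minor_def minor_matrix_def)

text \<open>The hypotheses make \<open>J\<close> block diagonal: a Jacobian on the indices in
  \<open>I\<close> and the identity on the rest. Padded matrices then multiply blockwise.\<close>

lemma minor_matrix_congruence:
  fixes J Gd :: "real ^ 'n::finite ^ 'n"
  assumes J0: "\<And>i k. i \<in> I \<Longrightarrow> k \<notin> I \<Longrightarrow> J $ k $ i = 0"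
    and J1: "\<And>i k. i \<notin> I \<Longrightarrow> J $ k $ i = (if i = k then 1 else 0)"
    and G: "\<And>i j. i \<in> I \<Longrightarrow> j \<in> I \<Longrightarrow> Gc $ i $ j = (\<Sum>k\<in>I. \<Sum>l\<in>I. J $ k $ i * J $ l $ j * Gd $ k $ l)"
  shows "minor_matrix I Gc = transpose J ** minor_matrix I Gd ** J"
proof -
  have "(transpose J ** minor_matrix I Gd ** J) $ i $ j = minor_matrix I Gc $ i $ j" for i j
  proof -
    have e: "(transpose J ** minor_matrix I Gd ** J) $ i $ j
        = (\<Sum>l\<in>UNIV. (\<Sum>k\<in>UNIV. J $ k $ i * minor_matrix I Gd $ k $ l) * J $ l $ j)"
      by (simp add: matrix_matrix_mult_def transpose_def)
    have delta: "(\<Sum>k\<in>UNIV. J $ k $ a * f k) = f a" "(\<Sum>k\<in>UNIV. f k * J $ k $ a) = f a"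
      if "a \<notin> I" for a and f :: "'n \<Rightarrow> real"
    proof -
      have "(\<Sum>k\<in>UNIV. J $ k $ a * f k) = (\<Sum>k\<in>UNIV. if k = a then f k else 0)"
        using J1[OF that] by (intro sum.cong) auto
      then show "(\<Sum>k\<in>UNIV. J $ k $ a * f k) = f a" by simp
      then show "(\<Sum>k\<in>UNIV. f k * J $ k $ a) = f a" by (simp add: mult.commute)
    qed
    show ?thesis
    proof (cases "j \<in> I")
      case jF: False
      have "(transpose J ** minor_matrix I Gd ** J) $ i $ j = (\<Sum>k\<in>UNIV. J $ k $ i * minor_matrix I Gd $ k $ j)"
        unfolding e by (rule delta(2)[OF jF])
      also have "\<dots> = J $ j $ i" 
      proof -
        have "(\<Sum>k\<in>UNIV. J $ k $ i * minor_matrix I Gd $ k $ j) = (\<Sum>k\<in>UNIV. if k = j then J $ k $ i else 0)"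
          using jF by (intro sum.cong) (auto simp: minor_matrix_def)
        then show ?thesis by simp
      qed
      also have "\<dots> = minor_matrix I Gc $ i $ j"
        using J0[OF _ jF, of i] J1[of i j] jF by (cases "i \<in> I") (auto simp: minor_matrix_def)
      finally show ?thesis .
    next
      case jT: True
      show ?thesis
      proof (cases "i \<in> I")
        case iF: False
        have "(transpose J ** minor_matrix I Gd ** J) $ i $ j = (\<Sum>l\<in>UNIV. minor_matrix I Gd $ i $ l * J $ l $ j)"
          unfolding e delta(1)[OF iF] ..
        also have "\<dots> = (\<Sum>l\<in>UNIV. if l = i then J $ l $ j else 0)"
          using iF by (intro sum.cong) (auto simp: minor_matrix_def)
        also have "\<dots> = J $ i $ j" by simp
        also have "\<dots> = minor_matrix I Gc $ i $ j"
          using J0[OF jT iF] iF jT by (auto simp: minor_matrix_def)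
        finally show ?thesis .
      next
        case iT: True
        have "(transpose J ** minor_matrix I Gd ** J) $ i $ j
          = (\<Sum>l\<in>I. \<Sum>k\<in>UNIV. J $ k $ i * minor_matrix I Gd $ k $ l * J $ l $ j)"
          unfolding e sum_distrib_right by (rule sum.mono_neutral_right) (auto simp: J0 jT)
        also have "\<dots> = (\<Sum>l\<in>I. \<Sum>k\<in>I. J $ k $ i * minor_matrix I Gd $ k $ l * J $ l $ j)"
          by (intro sum.cong refl sum.mono_neutral_right) (auto simp: J0 iT)
        also have "\<dots> = (\<Sum>l\<in>I. \<Sum>k\<in>I. J $ k $ i * J $ l $ j * Gd $ k $ l)"
          by (intro sum.cong refl) (simp add: minor_matrix_def)
        also have "\<dots> = Gc $ i $ j" unfolding G[OF iT jT] by (rule sum.swap)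
        finally show ?thesis using iT jT by (simp add: minor_matrix_def)
      qed
    qed
  qed
  then show ?thesis by (simp add: vec_eq_iff)
qed

text \<open>The determinant cannot vanish on the segment from the identity matrix to \<open>G\<close>.\<close>

lemma det_pos_if_positive_definite:
  fixes G :: "real ^ 'n::finite ^ 'n"
  assumes G: "\<And>v. v \<noteq> 0 \<Longrightarrow> 0 < v \<bullet> (G *v v)"
  shows "det G > 0"
proof (rule ccontr)
  assume neg: "\<not> det G > 0"
  define h where "h t = det (\<chi> i j. (1 - t) * (if i = j then 1 else 0) + t * G $ i $ j)" for t
  have "continuous_on {0..1} h"
    unfolding h_def det_def by (auto intro!: continuous_intros continuous_on_prod')
  moreover have "h 1 \<le> 0" using neg by (simp add: h_def vec_lambda_eta)
  moreover have "h 0 = 1"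
    by (simp add: h_def) (metis det_I mat_def)
  ultimately obtain t where t: "0 \<le> t" "t \<le> 1" "h t = 0"
    using IVT2'[of h 1 0 0] by auto
  define B :: "real ^ 'n ^ 'n" where "B = (\<chi> i j. (1 - t) * (if i = j then 1 else 0) + t * G $ i $ j)"
  have "det B = 0" using t(3) by (simp add: h_def B_def)
  then obtain v where v: "v \<noteq> 0" "B *v v = 0"
    by (metis invertible_det_nz invertible_left_inverse matrix_left_invertible_ker)
  have "B = (1 - t) *\<^sub>R mat 1 + t *\<^sub>R G"
    by (simp add: B_def vec_eq_iff mat_def)
  then have "B *v v = (1 - t) *\<^sub>R v + t *\<^sub>R (G *v v)"
    by (simp add: matrix_vector_mult_add_rdistrib scaleR_matrix_vector_assoc[symmetric])
  then have "v \<bullet> (B *v v) = (1 - t) * (v \<bullet> v) + t * (v \<bullet> (G *v v))"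
    by (simp add: inner_add_right)
  moreover have "0 < (1 - t) * (v \<bullet> v) + t * (v \<bullet> (G *v v))"
  proof (cases "t = 1")
    case False
    then show ?thesis using t G[OF v(1)] v(1)
      by (intro add_pos_nonneg mult_pos_pos mult_nonneg_nonneg) auto
  qed (use G[OF v(1)] in simp)
  ultimately show False using v(2) by simp
qed

text \<open>Adding \<open>t\<close> times the identity makes the matrix positive definite for
  \<open>t > 0\<close>; the determinant is continuous as \<open>t\<close> decreases to 0.\<close>

lemma det_nonneg_if_positive_semidefinite:
  fixes G :: "real ^ 'n::finite ^ 'n"
  assumes G: "\<And>v. 0 \<le> v \<bullet> (G *v v)"
  shows "det G \<ge> 0"
proof -
  define h where "h t = det (\<chi> i j. t * (if i = j then 1 else 0) + G $ i $ j)" for t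
  have pos: "h t > 0" if t: "t > 0" for t
    unfolding h_def
  proof (rule det_pos_if_positive_definite)
    fix v :: "real ^ 'n" assume "v \<noteq> 0"
    have "(\<chi> i j. t * (if i = j then 1 else 0) + G $ i $ j) = t *\<^sub>R mat 1 + G"
      by (simp add: vec_eq_iff mat_def)
    then have "v \<bullet> ((\<chi> i j. t * (if i = j then 1 else 0) + G $ i $ j) *v v) = t * (v \<bullet> v) + v \<bullet> (G *v v)"
      by (simp add: matrix_vector_mult_add_rdistrib scaleR_matrix_vector_assoc[symmetric] inner_add_right)
    then show "0 < v \<bullet> ((\<chi> i j. t * (if i = j then 1 else 0) + G $ i $ j) *v v)"
      using G[of v] t \<open>v \<noteq> 0\<close> by (simp add: add_pos_nonneg)
  qed
  have "continuous_on UNIV h"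
    unfolding h_def det_def by (auto intro!: continuous_intros continuous_on_prod')
  then have "(h \<longlongrightarrow> h 0) (at_right 0)"
    by (simp add: continuous_on_def filterlim_at_split)
  then have "h 0 \<ge> 0"
    by (rule tendsto_lowerbound) (auto intro!: eventually_at_rightI[of 0 1] less_imp_le pos)
  then show ?thesis by (simp add: h_def vec_lambda_eta)
qed

text \<open>The padding contributes the squares of the coordinates outside \<open>I\<close>, which
  is why definiteness depends only on the independence of the \<open>w i\<close> with
  \<open>i \<in> I\<close>.\<close>

lemma minor_gram_quadratic_form:
  fixes w :: "'n::finite \<Rightarrow> 'v::euclidean_space"
  shows "v \<bullet> (minor_matrix I (\<chi> i j. w i \<bullet> w j) *v v) = (norm (\<Sum>i\<in>I. v $ i *\<^sub>R w i))\<^sup>2 + (\<Sum>i\<in>- I. (v $ i)\<^sup>2)"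
proof -
  let ?B = "minor_matrix I (\<chi> i j. w i \<bullet> w j)"
  have "(?B *v v) $ i = (if i \<in> I then (\<Sum>j\<in>I. (w i \<bullet> w j) * v $ j) else v $ i)" for i
  proof (cases "i \<in> I")
    case True
    have "(\<Sum>j\<in>UNIV. ?B $ i $ j * v $ j) = (\<Sum>j\<in>I. ?B $ i $ j * v $ j)"
      using True by (intro sum.mono_neutral_right) (auto simp: minor_matrix_def)
    then show ?thesis using True by (simp add: matrix_vector_mult_def minor_matrix_def)
  next
    case False
    then have "(\<Sum>j\<in>UNIV. ?B $ i $ j * v $ j) = (\<Sum>j\<in>UNIV. if j = i then v $ j else 0)"
      by (intro sum.cong) (auto simp: minor_matrix_def)
    then show ?thesis using False by (simp add: matrix_vector_mult_def)
  qed
  then have "v \<bullet> (?B *v v) = (\<Sum>i\<in>UNIV. if i \<in> I then v $ i * (\<Sum>j\<in>I. (w i \<bullet> w j) * v $ j) else v $ i * v $ i)"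
    unfolding inner_vec_def by (intro sum.cong) simp_all
  also have "\<dots> = (\<Sum>i\<in>I. v $ i * (\<Sum>j\<in>I. (w i \<bullet> w j) * v $ j)) + (\<Sum>i\<in>- I. v $ i * v $ i)"
    by (subst sum.If_cases) simp_all
  also have "(\<Sum>i\<in>I. v $ i * (\<Sum>j\<in>I. (w i \<bullet> w j) * v $ j)) = (norm (\<Sum>i\<in>I. v $ i *\<^sub>R w i))\<^sup>2"
  proof -
    have "w i \<bullet> (\<Sum>j\<in>I. v $ j *\<^sub>R w j) = (\<Sum>j\<in>I. (w i \<bullet> w j) * v $ j)" for i
      by (simp add: inner_sum_right mult.commute)
    then show ?thesis unfolding power2_norm_eq_inner by (subst inner_sum_left) simp
  qed
  finally show ?thesis by (simp add: power2_eq_square)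
qed

lemma minor_gram_nonneg: "minor I (\<chi> i j. w i \<bullet> w j) \<ge> 0"
  for w :: "'n::finite \<Rightarrow> 'v::euclidean_space"
  unfolding minor_eq_det
  by (rule det_nonneg_if_positive_semidefinite) (simp add: minor_gram_quadratic_form sum_nonneg)

lemma minor_gram_pos:
  fixes w :: "'n::finite \<Rightarrow> 'v::euclidean_space"
  assumes ind: "\<And>v. v \<in> coord_space I \<Longrightarrow> (\<Sum>i\<in>I. v $ i *\<^sub>R w i) = 0 \<Longrightarrow> v = 0"
  shows "minor I (\<chi> i j. w i \<bullet> w j) > 0"
  unfolding minor_eq_det
proof (rule det_pos_if_positive_definite)
  fix v :: "real ^ 'n" assume v: "v \<noteq> 0"
  show "0 < v \<bullet> (minor_matrix I (\<chi> i j. w i \<bullet> w j) *v v)"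
  proof (rule ccontr)
    assume "\<not> ?thesis"
    then have "(norm (\<Sum>i\<in>I. v $ i *\<^sub>R w i))\<^sup>2 = 0 \<and> (\<Sum>i\<in>- I. (v $ i)\<^sup>2) = 0"
      unfolding minor_gram_quadratic_form
      by (smt (verit) sum_nonneg zero_le_power2)
    then have "(\<Sum>i\<in>I. v $ i *\<^sub>R w i) = 0" "v \<in> coord_space I"
      by (auto simp: sum_nonneg_eq_0_iff coord_space_def)
    then show False using ind v by blast
  qed
qed

section \<open>Volume densities and coordinate changes\<close>

text \<open>What a compact manifold and its boundary have in common, in first order: finitely many
  charts suffice to cover, and transitions and immersion are differentiable. Both are instances
  later, so the volume measure is constructed once.\<close>

locale chart_cover =
  fixes I :: "'n::finite set" and M :: "'a::topological_space set" and A :: "('a, 'n) chart set"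
    and \<psi> :: "'a \<Rightarrow> 'v::euclidean_space" and C :: "('a, 'n) chart set"
  assumes chart: "c \<in> A \<Longrightarrow> is_chart I M c"
    and finite_C: "finite C" and C_subset: "C \<subseteq> A" and C_cover: "\<Union> (fst ` C) = M"
    and transition_differentiable: "c \<in> A \<Longrightarrow> d \<in> A \<Longrightarrow> x \<in> snd c ` (fst c \<inter> fst d) \<Longrightarrow>
      transition c d differentiable (at x within snd c ` (fst c \<inter> fst d))"
    and immersion_differentiable: "c \<in> A \<Longrightarrow> x \<in> chart_image c \<Longrightarrow>
      (\<psi> \<circ> chart_inv c) differentiable (at x within chart_image c)"
    and pderiv_in_continuous: "c \<in> A \<Longrightarrow> i \<in> I \<Longrightarrow>
      continuous_on (chart_image c) (pderiv_in (chart_image c) i (\<psi> \<circ> chart_inv c))"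
begin

definition vol_density :: "('a, 'n) chart \<Rightarrow> real ^ 'n \<Rightarrow> real" where
  "vol_density c x = sqrt (minor I (metric_matrix c \<psi> x))"

lemma vol_density_nonneg [simp]: "vol_density c x \<ge> 0"
  unfolding vol_density_def metric_matrix_def by (simp add: minor_gram_nonneg)

lemma vol_density_continuous:
  assumes c: "c \<in> A" shows "continuous_on (chart_image c) (vol_density c)"
proof -
  have "continuous_on (chart_image c) (\<lambda>x. minor_matrix I (metric_matrix c \<psi> x) $ i $ j)" for i j
    by (cases "i \<in> I \<and> j \<in> I")
      (auto simp: minor_matrix_def metric_matrix_def intro!: continuous_intros pderiv_in_continuous[OF c])
  then show ?thesis
    unfolding vol_density_def minor_eq_det det_def
    by (intro continuous_on_real_sqrt continuous_on_sum continuous_on_mult continuous_on_const continuous_on_prod)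
qed

abbreviation measurable_sets :: "'a set set" where
  "measurable_sets \<equiv> sets (restrict_space borel M)"

lemma chart_domain_measurable: "c \<in> A \<Longrightarrow> fst c \<in> measurable_sets"
  using is_chartD(1)[OF chart, of c] unfolding openin_open sets_restrict_space by (metis borel_open imageI)

lemma chart_image_borel: "c \<in> A \<Longrightarrow> chart_image c \<in> sets borel"
  using is_chartD(2)[OF chart] openin_model_borel by blast

lemma measurable_chart_inv: "c \<in> A \<Longrightarrow> chart_inv c \<in> restrict_space borel (chart_image c) \<rightarrow>\<^sub>M restrict_space borel M"
proof (rule measurable_restrict_space2)
  assume c: "c \<in> A"
  show "chart_inv c \<in> space (restrict_space borel (chart_image c)) \<rightarrow> M"
    using chart_inv_in[OF chart[OF c]] is_chartD(4)[OF chart[OF c]] by (auto simp: space_restrict_space)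
  show "chart_inv c \<in> restrict_space borel (chart_image c) \<rightarrow>\<^sub>M borel"
    using is_chartD(3)[OF chart[OF c]] by (intro borel_measurable_continuous_on_restrict) (simp add: homeomorphism_def)
qed

lemma chart_image_measurable:
  assumes c: "c \<in> A" and E: "E \<in> measurable_sets"
  shows "snd c ` (fst c \<inter> E) \<in> sets borel"
proof -
  have "chart_inv c -` E \<inter> space (restrict_space borel (chart_image c)) \<in> sets (restrict_space borel (chart_image c))"
    by (rule measurable_sets[OF measurable_chart_inv[OF c] E])
  then show ?thesis
    using chart_image_borel[OF c] unfolding chart_image_Int_eq[OF chart[OF c]]
    by (auto simp: space_restrict_space sets_restrict_space Int_commute)
qed

text \<open>The derivative of the transition is meaningful on \<open>coord_space I\<close> only, so
  it is extended by the identity on the complement. The padded metric matrices are congruent through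
  this Jacobian, and the root of its squared determinant is the absolute value.\<close>

lemma vol_density_transform:
  assumes c: "c \<in> A" and d: "d \<in> A" and p: "p \<in> fst c \<inter> fst d"
    and T': "(transition c d has_derivative T') (at (snd c p) within snd c ` (fst c \<inter> fst d))"
  shows "vol_density c (snd c p) = \<bar>det (matrix (\<lambda>v. T' (coord_proj I v) + (v - coord_proj I v)))\<bar> * vol_density d (snd d p)"
proof -
  let ?J = "matrix (\<lambda>v. T' (coord_proj I v) + (v - coord_proj I v))"
  have chain: "pderiv_in (chart_image c) i (\<psi> \<circ> chart_inv c) (snd c p)
      = (\<Sum>k\<in>I. (T' (axis i 1) $ k) *\<^sub>R pderiv_in (chart_image d) k (\<psi> \<circ> chart_inv d) (snd d p))"
    and Tc: "T' (axis i 1) \<in> coord_space I" if i: "i \<in> I" for i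
    using overlap_differentiable_chain[OF chart[OF c] chart[OF d] p T'
        immersion_differentiable[OF c] immersion_differentiable[OF d] i] p by (auto simp: chart_in_image)
  have P: "coord_proj I (axis i 1) = (if i \<in> I then axis i 1 else 0)" for i
    by (auto simp: coord_proj_def axis_def vec_eq_iff)
  have T0: "T' 0 = 0"
    using has_derivative_bounded_linear[OF T'] by (simp add: linear_simps)
  have J: "?J $ k $ i = (if i \<in> I then T' (axis i 1) $ k else if i = k then 1 else 0)" for i k
    by (simp add: matrix_def P T0) (simp add: axis_def)
  have "minor_matrix I (metric_matrix c \<psi> (snd c p)) = transpose ?J ** minor_matrix I (metric_matrix d \<psi> (snd d p)) ** ?J"
  proof (rule minor_matrix_congruence)
    fix i j assume i: "i \<in> I" and j: "j \<in> I"
    show "metric_matrix c \<psi> (snd c p) $ i $ j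
      = (\<Sum>k\<in>I. \<Sum>l\<in>I. ?J $ k $ i * ?J $ l $ j * metric_matrix d \<psi> (snd d p) $ k $ l)"
      using i j by (simp add: metric_matrix_def chain J inner_sum_left inner_sum_right mult.assoc sum_distrib_left)
  qed (use Tc in \<open>auto simp: J coord_space_def\<close>)
  then have "minor I (metric_matrix c \<psi> (snd c p)) = (det ?J)\<^sup>2 * minor I (metric_matrix d \<psi> (snd d p))"
    by (simp add: minor_eq_det det_mul det_transpose power2_eq_square)
  then show ?thesis by (simp add: vol_density_def real_sqrt_mult)
qed

text \<open>Both integrals are thickened by the unit cube of \<open>slab I\<close>. The map
  \<open>g\<close> applies the transition to the base point and leaves the cube coordinates alone,
  so the full-dimensional change of variables applies with the Jacobian of
  \<open>vol_density_transform\<close>.\<close>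

lemma vol_density_overlap:
  assumes c: "c \<in> A" and d: "d \<in> A" and E: "E \<in> measurable_sets" and Ecd: "E \<subseteq> fst c \<inter> fst d"
  shows "(\<integral>\<^sup>+ x. ennreal (vol_density c x) * indicator (snd c ` E) x \<partial>coord_lborel I)
    = (\<integral>\<^sup>+ x. ennreal (vol_density d x) * indicator (snd d ` E) x \<partial>coord_lborel I)"
proof -
  note cc = chart[OF c] and dd = chart[OF d]
  let ?D = "snd c ` (fst c \<inter> fst d)"
  define T where "T = transition c d"
  define P where "P = coord_proj I"
  define g where "g x = T (P x) + (x - P x)" for x
  define S where "S = {x \<in> slab I. P x \<in> snd c ` E}"
  define S' where "S' = {x \<in> slab I. P x \<in> snd d ` E}"
  obtain T' where T': "\<And>x. x \<in> ?D \<Longrightarrow> (T has_derivative T' x) (at x within ?D)"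
    using transition_differentiable[OF c d] unfolding differentiable_def T_def by metis
  interpret P: bounded_linear P unfolding P_def by (rule bounded_linear_coord_proj)
  have Pm [measurable]: "P \<in> borel_measurable borel" unfolding P_def by simp
  have slab [measurable]: "slab I \<in> sets borel" by (rule borel_closed[OF closed_slab])
  have cE [measurable]: "snd c ` E \<in> sets borel" and dE [measurable]: "snd d ` E \<in> sets borel"
    using chart_image_measurable[OF c E] chart_image_measurable[OF d E] Ecd by (simp_all add: Int_absorb1)
  have S: "S \<in> sets borel" and S': "S' \<in> sets borel" unfolding S_def S'_def by measurable
  have Tx: "T (snd c q) = snd d q" if "q \<in> E" for q
    using chart_inv_apply[OF cc, of q] that Ecd by (auto simp: T_def transition_def)
  have cs: "snd c q \<in> coord_space I" "snd d q \<in> coord_space I" if "q \<in> E" for q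
    using that Ecd chart_in_image[of q c] chart_in_image[of q d]
      chart_image_subset_coord_space[OF cc] chart_image_subset_coord_space[OF dd] by auto
  have Pid: "P x = x" if "x \<in> coord_space I" for x using that by (simp add: P_def coord_proj_id)
  have PP: "P (x - P x) = 0" for x by (simp add: P.diff) (simp add: P_def coord_proj_id)
  have gS: "P (g x) = snd d q \<and> g x - P (g x) = x - P x" if "P x = snd c q" "q \<in> E" for x q
    using that Tx cs PP[of x] by (simp add: g_def P.add Pid)
  have slab_iff: "x \<in> slab I \<longleftrightarrow> x - P x \<in> slab I" for x
    by (auto simp: slab_def P_def coord_proj_def)
  have "g ` S = S'"
  proof (intro equalityI subsetI)
    fix y assume "y \<in> g ` S"
    then obtain x q where "x \<in> slab I" "y = g x" "q \<in> E" "P x = snd c q" by (auto simp: S_def)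
    then show "y \<in> S'" using gS slab_iff by (metis (mono_tags, lifting) S'_def imageI mem_Collect_eq)
  next
    fix y assume "y \<in> S'"
    then obtain q where q: "y \<in> slab I" "q \<in> E" "P y = snd d q" by (auto simp: S'_def)
    define x where "x = snd c q + (y - P y)"
    have Px: "P x = snd c q" using q cs PP[of y] by (simp add: x_def P.add Pid)
    then have "x - P x = y - P y" by (simp add: x_def)
    then have "x \<in> S" using q Px slab_iff unfolding S_def by (metis (mono_tags, lifting) imageI mem_Collect_eq)
    moreover have "g x = y" using Px q Tx by (simp add: g_def) (simp add: x_def)
    ultimately show "y \<in> g ` S" by blast
  qed
  have inj: "inj_on g S"
  proof (rule inj_onI)
    fix x y assume "x \<in> S" "y \<in> S" and gg: "g x = g y"
    then obtain q r where q: "q \<in> E" "P x = snd c q" and r: "r \<in> E" "P y = snd c r" by (auto simp: S_def)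
    have e: "snd d q = snd d r" "x - P x = y - P y" using gS[OF q(2,1)] gS[OF r(2,1)] gg by auto
    have "q \<in> fst d" "r \<in> fst d" using q r Ecd by auto
    then have "q = r" using e(1) chart_inv_apply[OF dd] by metis
    then have "P x = P y" using q r by simp
    then show "x = y" using e(2) by simp
  qed
  let ?g' = "\<lambda>x v. T' (P x) (P v) + (v - P v)"
  have der: "(g has_derivative ?g' x) (at x within S)" if x: "x \<in> S" for x
  proof -
    have "P ` S \<subseteq> ?D" using Ecd by (auto simp: S_def)
    moreover have "P x \<in> ?D" using x Ecd by (auto simp: S_def)
    ultimately have "(T has_derivative T' (P x)) (at (P x) within P ` S)"
      using T' has_derivative_subset by blast
    then have "((\<lambda>x. T (P x)) has_derivative (\<lambda>v. T' (P x) (P v))) (at x within S)"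
      by (rule has_derivative_in_compose[rotated]) (intro P.has_derivative has_derivative_ident)
    then show ?thesis unfolding g_def by (auto intro!: derivative_eq_intros P.has_derivative)
  qed
  have dens: "vol_density c (P x) = \<bar>det (matrix (?g' x))\<bar> * vol_density d (P (g x))" if x: "x \<in> S" for x
  proof -
    obtain q where q: "q \<in> E" "P x = snd c q" using x by (auto simp: S_def)
    have "snd c q \<in> ?D" using q Ecd by auto
    then show ?thesis
      using vol_density_transform[OF c d _ T'[unfolded T_def], of q] q gS[OF q(2,1)] Ecd by (auto simp: P_def)
  qed
  have dens_nn: "vol_density d (P (g x)) \<ge> 0" if "x \<in> S" for x
    by (rule vol_density_nonneg)
  have m: "(\<lambda>x. vol_density e x * indicator (snd e ` E) x) \<in> borel_measurable borel" if e: "e \<in> A" "E \<subseteq> fst e" for e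
  proof -
    have "(\<lambda>x. vol_density e x * indicator (chart_image e) x * indicator (snd e ` E) x) \<in> borel_measurable borel"
      using chart_image_measurable[OF e(1) E] e(2)
      by (intro borel_measurable_times borel_measurable_indicator
          continuous_on_imp_indicator_measurable[OF is_chartD(2)[OF chart[OF e(1)]] vol_density_continuous[OF e(1)]])
        (simp add: Int_absorb1)
    moreover have "(\<lambda>x. vol_density e x * indicator (chart_image e) x * indicator (snd e ` E) x)
        = (\<lambda>x. vol_density e x * indicator (snd e ` E) x)"
      using e(2) chart_in_image[of _ e] by (intro ext) (auto simp: indicator_def)
    ultimately show ?thesis by simp
  qed
  have slabI: "(\<integral>\<^sup>+ x. ennreal (vol_density e x) * indicator (snd e ` E) x \<partial>coord_lborel I)
    = (\<integral>\<^sup>+ x. ennreal (vol_density e (P x) * indicator {x \<in> slab I. P x \<in> snd e ` E} x) \<partial>lborel)"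
    if e: "e \<in> A" "E \<subseteq> fst e" for e
  proof -
    have "(\<integral>\<^sup>+ x. ennreal (vol_density e x) * indicator (snd e ` E) x \<partial>coord_lborel I)
        = (\<integral>\<^sup>+ x. ennreal (vol_density e x * indicator (snd e ` E) x) \<partial>coord_lborel I)"
      by (intro nn_integral_cong) (auto simp: indicator_def)
    also have "\<dots> = (\<integral>\<^sup>+ x. ennreal (vol_density e (P x) * indicator (snd e ` E) (P x)) * indicator (slab I) x \<partial>lborel)"
      unfolding P_def by (intro nn_integral_coord_lborel_slab measurable_compose[OF m[OF e] measurable_ennreal])
    also have "\<dots> = (\<integral>\<^sup>+ x. ennreal (vol_density e (P x) * indicator {x \<in> slab I. P x \<in> snd e ` E} x) \<partial>lborel)"
      by (intro nn_integral_cong) (auto simp: indicator_def)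
    finally show ?thesis .
  qed
  have mP: "(\<lambda>x. vol_density e (P x) * indicator {x \<in> slab I. P x \<in> snd e ` E} x) \<in> borel_measurable borel"
    if e: "e \<in> A" "E \<subseteq> fst e" for e
  proof -
    have [measurable]: "(\<lambda>x. vol_density e x * indicator (snd e ` E) x) \<in> borel_measurable borel" by (rule m[OF e])
    have "(\<lambda>x. (vol_density e (P x) * indicator (snd e ` E) (P x)) * indicator (slab I) x) \<in> borel_measurable borel"
      by measurable
    moreover have "(\<lambda>x. (vol_density e (P x) * indicator (snd e ` E) (P x)) * indicator (slab I) x)
        = (\<lambda>x. vol_density e (P x) * indicator {x \<in> slab I. P x \<in> snd e ` E} x)"
      by (intro ext) (auto simp: indicator_def)
    ultimately show ?thesis by simp
  qed
  have "(\<integral>\<^sup>+ x. ennreal (\<bar>det (matrix (?g' x))\<bar> * vol_density d (P (g x)) * indicator S x) \<partial>lborel)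
    = (\<integral>\<^sup>+ x. ennreal (vol_density d (P x) * indicator (g ` S) x) \<partial>lborel)"
  proof (rule nn_integral_change_of_variables[where f = "\<lambda>x. vol_density d (P x)" and g' = ?g', OF S _ der inj dens_nn])
    have "(\<lambda>x. \<bar>det (matrix (?g' x))\<bar> * vol_density d (P (g x)) * indicator S x) = (\<lambda>x. vol_density c (P x) * indicator S x)"
      using dens by (intro ext) (auto simp: indicator_def)
    then show "(\<lambda>x. \<bar>det (matrix (?g' x))\<bar> * vol_density d (P (g x)) * indicator S x) \<in> borel_measurable borel"
      using mP[OF c] Ecd by (simp add: S_def)
    show "(\<lambda>x. vol_density d (P x) * indicator (g ` S) x) \<in> borel_measurable borel"
      using mP[OF d] Ecd unfolding \<open>g ` S = S'\<close> by (simp add: S'_def)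
  qed (use S' \<open>g ` S = S'\<close> in auto)
  moreover have "(\<integral>\<^sup>+ x. ennreal (\<bar>det (matrix (?g' x))\<bar> * vol_density d (P (g x)) * indicator S x) \<partial>lborel)
    = (\<integral>\<^sup>+ x. ennreal (vol_density c (P x) * indicator S x) \<partial>lborel)"
    using dens by (intro nn_integral_cong) (auto simp: indicator_def)
  ultimately show ?thesis
    using slabI[OF c] slabI[OF d] Ecd \<open>g ` S = S'\<close> by (simp add: S_def S'_def)
qed


section \<open>Gluing of the chart measures\<close>

definition chart_measure :: "('a, 'n) chart \<Rightarrow> 'a measure" where
  "chart_measure c = distr (density (restrict_space (coord_lborel I) (chart_image c)) (\<lambda>x. ennreal (vol_density c x)))
     (restrict_space borel M) (chart_inv c)"

lemma sets_chart_measure [simp, measurable_cong]: "sets (chart_measure c) = measurable_sets"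
  by (simp add: chart_measure_def)

lemma vol_density_measurable:
  "c \<in> A \<Longrightarrow> (\<lambda>x. ennreal (vol_density c x)) \<in> borel_measurable (restrict_space borel (chart_image c))"
  using borel_measurable_continuous_on_restrict[OF vol_density_continuous] by measurable

lemma sets_restrict_coord_lborel:
  "sets (restrict_space (coord_lborel I) S) = sets (restrict_space borel S)"
  by (rule sets_restrict_space_cong) simp

lemma nn_integral_chart_measure:
  assumes c: "c \<in> A" and f: "f \<in> borel_measurable (restrict_space borel M)"
  shows "integral\<^sup>N (chart_measure c) f
    = (\<integral>\<^sup>+ x. ennreal (vol_density c x) * f (chart_inv c x) * indicator (chart_image c) x \<partial>coord_lborel I)"
proof -
  let ?R = "restrict_space (coord_lborel I) (chart_image c)"
  have inv [measurable]: "chart_inv c \<in> ?R \<rightarrow>\<^sub>M restrict_space borel M"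
    using measurable_chart_inv[OF c] by (subst measurable_cong_sets[OF sets_restrict_coord_lborel refl])
  have [measurable]: "(\<lambda>x. ennreal (vol_density c x)) \<in> borel_measurable ?R"
    using vol_density_measurable[OF c] by (subst measurable_cong_sets[OF sets_restrict_coord_lborel refl])
  note f [measurable]
  have [measurable]: "(\<lambda>x. f (chart_inv c x)) \<in> borel_measurable ?R"
    using measurable_comp[OF inv f] by (simp add: comp_def)
  have "integral\<^sup>N (chart_measure c) f = (\<integral>\<^sup>+ x. f (chart_inv c x) \<partial>density ?R (\<lambda>x. ennreal (vol_density c x)))"
    unfolding chart_measure_def by (rule nn_integral_distr) (simp_all add: f)
  also have "\<dots> = (\<integral>\<^sup>+ x. ennreal (vol_density c x) * f (chart_inv c x) \<partial>?R)"
    by (rule nn_integral_density) measurable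
  also have "\<dots> = (\<integral>\<^sup>+ x. ennreal (vol_density c x) * f (chart_inv c x) * indicator (chart_image c) x \<partial>coord_lborel I)"
    using chart_image_borel[OF c] by (subst nn_integral_restrict_space) simp_all
  finally show ?thesis .
qed

lemma emeasure_chart_measure:
  assumes c: "c \<in> A" and E: "E \<in> measurable_sets"
  shows "emeasure (chart_measure c) E
    = (\<integral>\<^sup>+ x. ennreal (vol_density c x) * indicator (snd c ` (fst c \<inter> E)) x \<partial>coord_lborel I)"
proof -
  have "emeasure (chart_measure c) E = integral\<^sup>N (chart_measure c) (indicator E)"
    using E by simp
  also have "\<dots> = (\<integral>\<^sup>+ x. ennreal (vol_density c x) * indicator E (chart_inv c x) * indicator (chart_image c) x \<partial>coord_lborel I)"
    using E by (intro nn_integral_chart_measure[OF c]) simp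
  also have "\<dots> = (\<integral>\<^sup>+ x. ennreal (vol_density c x) * indicator (snd c ` (fst c \<inter> E)) x \<partial>coord_lborel I)"
    unfolding chart_image_Int_eq[OF chart[OF c]] by (intro nn_integral_cong) (auto simp: indicator_def)
  finally show ?thesis .
qed

definition is_volume :: "'a measure \<Rightarrow> bool" where
  "is_volume \<mu> \<longleftrightarrow> sets \<mu> = measurable_sets \<and>
     (\<forall>c\<in>A. \<forall>E\<in>sets \<mu>. E \<subseteq> fst c \<longrightarrow>
        emeasure \<mu> E = (\<integral>\<^sup>+ x. ennreal (sqrt (minor I (metric_matrix c \<psi> x))) * indicator (snd c ` E) x \<partial>coord_lborel I))"

text \<open>Enumerate the finite cover and remove from each chart domain the earlier ones; a point
  lands in the piece of the first chart that contains it.\<close>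

lemma measurable_partition:
  obtains D where "\<And>c. c \<in> C \<Longrightarrow> D c \<in> measurable_sets" "\<And>c. c \<in> C \<Longrightarrow> D c \<subseteq> fst c"
    "disjoint_family_on D C" "\<Union> (D ` C) = M"
proof -
  obtain cs where cs: "set cs = C" "distinct cs" using finite_distinct_list[OF finite_C] by blast
  define idx where "idx c = (THE k. k < length cs \<and> cs ! k = c)" for c
  have idx: "idx (cs ! k) = k" if "k < length cs" for k
    unfolding idx_def using that cs(2) nth_eq_iff_index_eq by (intro the_equality) auto
  have ex: "\<exists>k<length cs. c = cs ! k" if "c \<in> C" for c using that cs(1) by (metis in_set_conv_nth)
  define D where "D c = fst c - (\<Union>d\<in>{d \<in> C. idx d < idx c}. fst d)" for c
  show ?thesis
  proof (rule that[of D])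
    show "D c \<in> measurable_sets" if "c \<in> C" for c
      unfolding D_def using that C_subset finite_C
      by (intro sets.Diff sets.finite_UN) (auto intro: chart_domain_measurable)
    show "disjoint_family_on D C"
      unfolding disjoint_family_on_def
    proof (intro ballI impI)
      fix c d assume cd: "c \<in> C" "d \<in> C" "c \<noteq> d"
      then have "idx c \<noteq> idx d" using ex idx by metis
      then show "D c \<inter> D d = {}" using cd by (auto simp: D_def neq_iff)
    qed
    show "\<Union> (D ` C) = M"
    proof (intro equalityI subsetI)
      fix p assume "p \<in> M"
      then have "\<exists>k c. c \<in> C \<and> p \<in> fst c \<and> idx c = k" using C_cover by auto
      then obtain k where k: "\<exists>c. c \<in> C \<and> p \<in> fst c \<and> idx c = k"
        "\<And>j. j < k \<Longrightarrow> \<not> (\<exists>c. c \<in> C \<and> p \<in> fst c \<and> idx c = j)"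
        unfolding exists_least_iff[of "\<lambda>k. \<exists>c. c \<in> C \<and> p \<in> fst c \<and> idx c = k"] by blast
      then obtain c where c: "c \<in> C" "p \<in> fst c" "idx c = k" by blast
      have "p \<in> D c" unfolding D_def using c k(2) by blast
      then show "p \<in> \<Union> (D ` C)" using c(1) by blast
    qed (use C_cover in \<open>auto simp: D_def\<close>)
  qed (auto simp: D_def)
qed

text \<open>The partition cuts a Borel set into finitely many pieces inside single charts, where the
  defining property prescribes the measure.\<close>

lemma is_volume_unique:
  assumes "is_volume \<mu>" "is_volume \<nu>"
  shows "\<mu> = \<nu>"
proof (rule measure_eqI)
  show "sets \<mu> = sets \<nu>" using assms by (simp add: is_volume_def)
  fix E assume "E \<in> sets \<mu>"
  then have E: "E \<in> measurable_sets" using assms by (simp add: is_volume_def)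
  obtain D where D: "\<And>c. c \<in> C \<Longrightarrow> D c \<in> measurable_sets" "\<And>c. c \<in> C \<Longrightarrow> D c \<subseteq> fst c"
    "disjoint_family_on D C" "\<Union> (D ` C) = M" using measurable_partition by metis
  have "E \<subseteq> M" using E by (auto simp: sets_restrict_space)
  then have un: "E = (\<Union>c\<in>C. E \<inter> D c)" using D(4) by auto
  have dis: "disjoint_family_on (\<lambda>c. E \<inter> D c) C" using D(3) unfolding disjoint_family_on_def by blast
  have *: "emeasure \<kappa> E = (\<Sum>c\<in>C. emeasure \<kappa> (E \<inter> D c))" if "is_volume \<kappa>" for \<kappa>
    using that E D(1) un
    by (subst sum_emeasure[OF _ dis finite_C]) (auto simp: is_volume_def)
  have "emeasure \<mu> (E \<inter> D c) = emeasure \<nu> (E \<inter> D c)" if c: "c \<in> C" for c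
  proof -
    have "c \<in> A" "E \<inter> D c \<in> measurable_sets" "E \<inter> D c \<subseteq> fst c"
      using c C_subset E D(1)[OF c] D(2)[OF c] by auto
    then show ?thesis using assms unfolding is_volume_def by simp
  qed
  then show "emeasure \<mu> E = emeasure \<nu> E" using *[OF assms(1)] *[OF assms(2)] by simp
qed

text \<open>Each piece of the partition is measured in its own chart. By
  \<open>vol_density_overlap\<close> any other chart would measure it equally, so the result has the
  right density in all charts of \<open>A\<close> and not just in those of \<open>C\<close>.\<close>

lemma is_volume_exists: "\<exists>\<mu>. is_volume \<mu>"
proof -
  obtain D where D: "\<And>c. c \<in> C \<Longrightarrow> D c \<in> measurable_sets" "\<And>c. c \<in> C \<Longrightarrow> D c \<subseteq> fst c"
    "disjoint_family_on D C" "\<Union> (D ` C) = M" using measurable_partition by metis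
  define F where "F E = (\<Sum>c\<in>C. emeasure (chart_measure c) (E \<inter> D c))" for E
  define \<mu> where "\<mu> = measure_of M measurable_sets F"
  have sp: "space (restrict_space borel M) = M" by (simp add: space_restrict_space)
  have sig: "sigma_algebra M measurable_sets" using sets.sigma_algebra_axioms[of "restrict_space borel M"] sp by simp
  have sets: "sets \<mu> = measurable_sets"
    unfolding \<mu>_def using sigma_algebra.sets_measure_of_eq[OF sig] by simp
  have em: "emeasure \<mu> E = F E" if "E \<in> measurable_sets" for E
  proof (rule emeasure_measure_of_sigma[OF sig _ _ that, where \<mu> = F, folded \<mu>_def])
    show "positive measurable_sets F" by (simp add: positive_def F_def)
    show "countably_additive measurable_sets F"
    proof (rule countably_additiveI)
      fix B :: "nat \<Rightarrow> 'a set"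
      assume B: "range B \<subseteq> measurable_sets" "disjoint_family B"
      have "(\<Sum>k. F (B k)) = (\<Sum>c\<in>C. \<Sum>k. emeasure (chart_measure c) (B k \<inter> D c))"
        unfolding F_def by (rule suminf_sum) simp
      also have "\<dots> = F (\<Union>k. B k)"
        unfolding F_def
      proof (intro sum.cong refl)
        fix c assume c: "c \<in> C"
        have "(\<Sum>k. emeasure (chart_measure c) (B k \<inter> D c)) = emeasure (chart_measure c) (\<Union>k. B k \<inter> D c)"
          using B D(1)[OF c] by (intro suminf_emeasure) (auto simp: disjoint_family_on_def)
        then show "(\<Sum>k. emeasure (chart_measure c) (B k \<inter> D c)) = emeasure (chart_measure c) ((\<Union>k. B k) \<inter> D c)"
          by simp
      qed
      finally show "(\<Sum>k. F (B k)) = F (\<Union>k. B k)" .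
    qed
  qed
  have "is_volume \<mu>"
    unfolding is_volume_def
  proof (intro conjI ballI impI)
    show "sets \<mu> = measurable_sets" by (rule sets)
    fix c E assume c: "c \<in> A" and "E \<in> sets \<mu>" and Ec: "E \<subseteq> fst c"
    then have E: "E \<in> measurable_sets" by (simp add: sets)
    have "emeasure \<mu> E = (\<Sum>d\<in>C. emeasure (chart_measure d) (E \<inter> D d))" using em[OF E] by (simp add: F_def)
    also have "\<dots> = (\<Sum>d\<in>C. emeasure (chart_measure c) (E \<inter> D d))"
    proof (rule sum.cong[OF refl])
      fix d assume d: "d \<in> C"
      have dA: "d \<in> A" and ED: "E \<inter> D d \<in> measurable_sets" and sub: "E \<inter> D d \<subseteq> fst c \<inter> fst d"
        using d C_subset E D(1)[OF d] D(2)[OF d] Ec by auto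
      have i: "fst d \<inter> (E \<inter> D d) = E \<inter> D d" "fst c \<inter> (E \<inter> D d) = E \<inter> D d" using sub by auto
      show "emeasure (chart_measure d) (E \<inter> D d) = emeasure (chart_measure c) (E \<inter> D d)"
        unfolding emeasure_chart_measure[OF dA ED] emeasure_chart_measure[OF c ED] i
        by (rule vol_density_overlap[OF c dA ED sub, symmetric])
    qed
    also have "\<dots> = emeasure (chart_measure c) (\<Union>d\<in>C. E \<inter> D d)"
    proof (intro sum_emeasure finite_C)
      show "(\<lambda>d. E \<inter> D d) ` C \<subseteq> sets (chart_measure c)" using D(1) E by auto
      show "disjoint_family_on (\<lambda>d. E \<inter> D d) C" using D(3) unfolding disjoint_family_on_def by blast
    qed
    also have "(\<Union>d\<in>C. E \<inter> D d) = E"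
      using D(4) E by (auto simp: sets_restrict_space)
    also have "emeasure (chart_measure c) E = (\<integral>\<^sup>+ x. ennreal (vol_density c x) * indicator (snd c ` E) x \<partial>coord_lborel I)"
      using emeasure_chart_measure[OF c E] Ec by (simp add: Int_absorb1)
    finally show "emeasure \<mu> E = (\<integral>\<^sup>+ x. ennreal (sqrt (minor I (metric_matrix c \<psi> x))) * indicator (snd c ` E) x \<partial>coord_lborel I)"
      by (simp add: vol_density_def)
  qed
  then show ?thesis by blast
qed

section \<open>Integration in a chart against the volume measure\<close>

abbreviation volume :: "'a measure" where
  "volume \<equiv> volume_measure I M A \<psi>"

text \<open>Existence and uniqueness give meaning to the definite description in
  \<open>volume_measure\<close>; every later fact about volumes goes through this.\<close>

lemma is_volume_volume: "is_volume volume"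
proof -
  have "volume = (THE \<mu>. is_volume \<mu>)" by (simp add: volume_measure_def is_volume_def)
  then show ?thesis using is_volume_exists is_volume_unique by (metis theI)
qed

lemma sets_volume [measurable_cong, simp]: "sets volume = measurable_sets"
  using is_volume_volume by (simp add: is_volume_def)

lemma space_volume [simp]: "space volume = M"
  using sets_eq_imp_space_eq[OF sets_volume] by (simp add: space_restrict_space)

lemma density_volume_eq_chart_measure:
  assumes c: "c \<in> A"
  shows "density volume (indicator (fst c)) = chart_measure c"
proof (rule measure_eqI)
  fix E assume "E \<in> sets (density volume (indicator (fst c)))"
  then have E: "E \<in> measurable_sets" by simp
  have E': "fst c \<inter> E \<in> measurable_sets" using E chart_domain_measurable[OF c] by blast
  have "emeasure (density volume (indicator (fst c))) E = (\<integral>\<^sup>+ x. indicator (fst c) x * indicator E x \<partial>volume)"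
    using E chart_domain_measurable[OF c] by (intro emeasure_density) auto
  also have "\<dots> = (\<integral>\<^sup>+ x. indicator (fst c \<inter> E) x \<partial>volume)"
    by (simp add: indicator_inter_arith)
  also have "\<dots> = emeasure volume (fst c \<inter> E)" using E' by simp
  also have "\<dots> = (\<integral>\<^sup>+ x. ennreal (vol_density c x) * indicator (snd c ` (fst c \<inter> E)) x \<partial>coord_lborel I)"
    using is_volume_volume c E' by (simp add: is_volume_def vol_density_def)
  finally show "emeasure (density volume (indicator (fst c))) E = emeasure (chart_measure c) E"
    by (simp add: emeasure_chart_measure[OF c E])
qed simp

lemma nn_integral_volume_chart:
  assumes c: "c \<in> A" and f: "f \<in> borel_measurable (restrict_space borel M)"
    and f0: "\<And>p. p \<in> M \<Longrightarrow> p \<notin> fst c \<Longrightarrow> f p = 0"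
  shows "integral\<^sup>N volume f
    = (\<integral>\<^sup>+ x. ennreal (vol_density c x) * f (chart_inv c x) * indicator (chart_image c) x \<partial>coord_lborel I)"
proof -
  have fm: "f \<in> borel_measurable volume" using f by measurable
  have "integral\<^sup>N volume f = (\<integral>\<^sup>+ p. indicator (fst c) p * f p \<partial>volume)"
    using f0 by (intro nn_integral_cong) (auto simp: indicator_def)
  also have "\<dots> = integral\<^sup>N (density volume (indicator (fst c))) f"
    using chart_domain_measurable[OF c] by (intro nn_integral_density[symmetric] fm) simp
  finally show ?thesis
    unfolding density_volume_eq_chart_measure[OF c] nn_integral_chart_measure[OF c f] .
qed

text \<open>Measurability is enough: the rules for densities and image measures also cover
  non-integrable functions, where both sides are 0.\<close>

lemma integral_volume_chart:
  fixes f :: "'a \<Rightarrow> real"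
  assumes c: "c \<in> A" and f: "f \<in> borel_measurable (restrict_space borel M)"
    and f0: "\<And>p. p \<in> M \<Longrightarrow> p \<notin> fst c \<Longrightarrow> f p = 0"
  shows "integral\<^sup>L volume f
    = (\<integral>x. vol_density c x * f (chart_inv c x) * indicator (chart_image c) x \<partial>coord_lborel I)"
proof -
  let ?R = "restrict_space (coord_lborel I) (chart_image c)"
  have inv: "chart_inv c \<in> ?R \<rightarrow>\<^sub>M restrict_space borel M"
    using measurable_chart_inv[OF c] by (subst measurable_cong_sets[OF sets_restrict_coord_lborel refl])
  have [measurable]: "vol_density c \<in> borel_measurable ?R"
    using borel_measurable_continuous_on_restrict[OF vol_density_continuous[OF c]]
    by (subst measurable_cong_sets[OF sets_restrict_coord_lborel refl])
  have fi [measurable]: "(\<lambda>x. f (chart_inv c x)) \<in> borel_measurable ?R"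
    using measurable_comp[OF inv f] by (simp add: comp_def)
  have fm: "f \<in> borel_measurable volume" using f by measurable
  have dm: "fst c \<in> sets volume" using chart_domain_measurable[OF c] by simp
  have "integral\<^sup>L volume f = (\<integral>p. indicator (fst c) p *\<^sub>R f p \<partial>volume)"
    using f0 by (intro Bochner_Integration.integral_cong refl) (auto simp: indicator_def)
  also have "\<dots> = integral\<^sup>L (density volume (\<lambda>p. ennreal (indicator (fst c) p))) f"
    using dm by (intro integral_density[symmetric] fm) auto
  also have "\<dots> = integral\<^sup>L (chart_measure c) f"
    by (simp add: ennreal_indicator density_volume_eq_chart_measure[OF c])
  also have "\<dots> = (\<integral>x. f (chart_inv c x) \<partial>density ?R (\<lambda>x. ennreal (vol_density c x)))"
    unfolding chart_measure_def by (rule integral_distr) (simp_all add: inv f)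
  also have "\<dots> = (\<integral>x. vol_density c x *\<^sub>R f (chart_inv c x) \<partial>?R)"
    by (rule integral_density) (auto intro: fi)
  also have "\<dots> = (\<integral>x. indicator (chart_image c) x *\<^sub>R (vol_density c x *\<^sub>R f (chart_inv c x)) \<partial>coord_lborel I)"
    using chart_image_borel[OF c] by (intro integral_restrict_space) simp
  finally show ?thesis by (simp add: mult_ac)
qed

end


section \<open>Hypersurface frames and integration over the half-space\<close>

lemma has_derivative_det:
  fixes A :: "'v::euclidean_space \<Rightarrow> real ^ 'n::finite ^ 'n"
  assumes A: "\<And>i j. ((\<lambda>x. A x $ i $ j) has_derivative (\<lambda>v. A' v $ i $ j)) (at x within S)"
  shows "((\<lambda>x. det (A x)) has_derivative (\<lambda>v. \<Sum>k\<in>UNIV. det (\<chi> i. if i = k then A' v $ i else A x $ i))) (at x within S)"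
proof -
  have "((\<lambda>x. det (A x)) has_derivative
      (\<lambda>v. \<Sum>p | p permutes UNIV. of_int (sign p) * (\<Sum>k\<in>UNIV. A' v $ k $ p k * (\<Prod>i\<in>UNIV - {k}. A x $ i $ p i)))) (at x within S)"
    unfolding det_def
    by (intro has_derivative_sum has_derivative_mult_right has_derivative_prod A)
  moreover have "(\<Sum>p | p permutes UNIV. of_int (sign p) * (\<Sum>k\<in>UNIV. A' v $ k $ p k * (\<Prod>i\<in>UNIV - {k}. A x $ i $ p i)))
      = (\<Sum>k\<in>UNIV. det (\<chi> i. if i = k then A' v $ i else A x $ i))" for v
  proof -
    have "(\<Prod>i\<in>UNIV. (if i = k then A' v $ i else A x $ i) $ p i) = A' v $ k $ p k * (\<Prod>i\<in>UNIV - {k}. A x $ i $ p i)" for k p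
      by (subst prod.remove[of _ k]) (auto intro!: prod.cong)
    then show ?thesis
      unfolding det_def by (subst sum.swap) (simp add: sum_distrib_left)
  qed
  ultimately show ?thesis by simp
qed

text \<open>Row \<open>k\<close> of \<open>B\<close> is a combination of the rows of
  \<open>A\<close> with coefficients from \<open>B ** G\<close>, and only the multiple of row
  \<open>k\<close> itself survives in the determinant. Combined with
  \<open>has_derivative_det\<close> this is Jacobi's formula.\<close>

lemma sum_det_replace_row:
  fixes A B :: "real ^ 'n::finite ^ 'n"
  assumes "G ** A = mat 1"
  shows "(\<Sum>k\<in>UNIV. det (\<chi> i. if i = k then B $ i else A $ i)) = det A * (\<Sum>k\<in>UNIV. \<Sum>l\<in>UNIV. B $ k $ l * G $ l $ k)"
proof -
  have "det (\<chi> i. if i = k then B $ i else A $ i) = (B ** G) $ k $ k * det A" for k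
  proof -
    have "(\<Sum>i\<in>UNIV. (B ** G) $ k $ i *s row i A) = ((B ** G) ** A) $ k"
      by (simp add: matrix_matrix_mult_def vec_eq_iff row_def)
    also have "\<dots> = B $ k"
      by (simp add: matrix_mul_assoc[symmetric] assms)
    finally have "(\<chi> i. if i = k then B $ i else A $ i) = (\<chi> i. if i = k then \<Sum>i\<in>UNIV. (B ** G) $ k $ i *s row i A else row i A)"
      by (simp add: vec_eq_iff row_def)
    then show ?thesis by (simp add: cramer_lemma_transpose)
  qed
  then show ?thesis
    by (simp add: sum_distrib_left matrix_matrix_mult_def mult.commute)
qed

text \<open>Cramer's rule for column \<open>b\<close> of the inverse, whose diagonal entry is a
  cofactor divided by the determinant. Applied to a metric, it links the density of a coordinate
  face to the density of the whole.\<close>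

lemma minor_complement_eq:
  fixes A G :: "real ^ 'n::finite ^ 'n"
  assumes AG: "A ** G = mat 1" and det: "det A \<noteq> 0"
  shows "minor (UNIV - {b}) A = det A * G $ b $ b"
proof -
  define D where "D = (\<chi> i j. if j = b then axis b 1 $ i else A $ i $ j)"
  have "A *v column b G = axis b 1"
    using AG by (simp add: matrix_vector_mult_def matrix_matrix_mult_def column_def vec_eq_iff mat_def axis_def)
  then have "column b G $ b = det D / det A"
    using cramer[OF det, of "column b G" "axis b 1"] by (simp add: D_def)
  then have "det A * G $ b $ b = det D" using det by (simp add: column_def)
  \<comment> \<open>Row \<open>b\<close> of \<open>D\<close> is the unit row plus \<open>r\<close>.
    The unit row yields the padded minor; with \<open>r\<close> in its place, column
    \<open>b\<close> is zero.\<close>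
  define r where "r = D $ b - axis b 1"
  have "D = (\<chi> i. if i = b then axis b 1 + r else D $ i)"
    by (simp add: r_def vec_eq_iff)
  then have "det D = det (\<chi> i. if i = b then axis b 1 else D $ i) + det (\<chi> i. if i = b then r else D $ i)"
    using det_row_add[of b "\<lambda>_. axis b 1" "\<lambda>_. r" "\<lambda>i. D $ i"] by simp
  also have "det (\<chi> i. if i = b then r else D $ i) = 0"
    by (rule det_zero_column[of b]) (auto simp: column_def vec_eq_iff D_def r_def axis_def)
  also have "(\<chi> i. if i = b then axis b 1 else D $ i) = minor_matrix (UNIV - {b}) A"
    by (auto simp: minor_matrix_def vec_eq_iff D_def axis_def)
  finally show ?thesis
    using \<open>det A * G $ b $ b = det D\<close> by (simp add: minor_eq_det)
qed

section \<open>Linear algebra at a point of a hypersurface\<close>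

locale hypersurface_frame =
  fixes e :: "'n::finite \<Rightarrow> real ^ 'm::finite" and N :: "real ^ 'm"
  assumes card: "CARD('m) = CARD('n) + 1"
    and independent_frame: "\<And>v::real ^ 'n. (\<Sum>i\<in>UNIV. v $ i *\<^sub>R e i) = 0 \<Longrightarrow> v = 0"
    and norm_N: "norm N = 1" and normal: "\<And>i. e i \<bullet> N = 0"
begin

definition gram :: "real ^ 'n ^ 'n" where "gram = (\<chi> i j. e i \<bullet> e j)"
definition G :: "real ^ 'n ^ 'n" where "G = matrix_inv gram"

lemma det_gram_pos: "det gram > 0"
  using minor_gram_pos[of UNIV e] independent_frame by (simp add: minor_UNIV gram_def)

lemma gram_G: "gram ** G = mat 1" and G_gram: "G ** gram = mat 1"
proof -
  have "invertible gram" using det_gram_pos invertible_det_nz[of gram] by auto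
  then have "\<exists>A'. gram ** A' = mat 1 \<and> A' ** gram = mat 1" by (simp add: invertible_def)
  from someI_ex[OF this] show "gram ** G = mat 1" "G ** gram = mat 1"
    by (simp_all add: G_def matrix_inv_def)
qed

lemma G_sym: "G $ i $ j = G $ j $ i"
proof -
  have g: "transpose gram = gram" by (simp add: gram_def transpose_def vec_eq_iff inner_commute)
  have inv: "transpose G ** gram = mat 1"
    using arg_cong[OF gram_G, of transpose] by (simp add: matrix_transpose_mul g transpose_mat)
  have "transpose G = transpose G ** (gram ** G)" by (simp add: gram_G)
  also have "\<dots> = G" by (simp add: matrix_mul_assoc inv)
  finally have "transpose G $ i $ j = G $ i $ j" by simp
  then show ?thesis by (simp add: transpose_def)
qed

lemma sum_G_gram: "(\<Sum>j\<in>UNIV. G $ i $ j * (e j \<bullet> e k)) = (if i = k then 1 else 0)"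
  using arg_cong[OF G_gram, of "\<lambda>B. B $ i $ k"] by (simp add: matrix_matrix_mult_def gram_def mat_def)

definition coords :: "real ^ 'm \<Rightarrow> real ^ 'n" where
  "coords v = (\<chi> i. \<Sum>j\<in>UNIV. G $ i $ j * (e j \<bullet> v))"

text \<open>Otherwise \<open>u\<close>, \<open>N\<close> and the frame would be
  \<open>CARD('n) + 2\<close> independent vectors in dimension \<open>CARD('n) + 1\<close>. This is
  where codimension one enters.\<close>

lemma orthogonal_to_frame_eq_0:
  assumes u: "\<And>i. e i \<bullet> u = 0" "N \<bullet> u = 0"
  shows "u = 0"
proof (rule ccontr)
  assume u0: "u \<noteq> 0"
  have inj: "inj e"
  proof (rule injI)
    fix i j assume ij: "e i = e j"
    have "(\<Sum>k\<in>UNIV. (axis i 1 - axis j 1 :: real ^ 'n) $ k *\<^sub>R e k) = e i - e j"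
    proof -
      have "(\<Sum>k\<in>UNIV. (axis i 1 :: real ^ 'n) $ k *\<^sub>R e k) = e i" for i
        by (simp add: axis_def if_distrib if_distribR cong: if_cong)
      then show ?thesis by (simp add: scaleR_diff_left sum_subtractf)
    qed
    then have "axis i 1 - axis j 1 = (0 :: real ^ 'n)" unfolding ij by (intro independent_frame) simp
    then show "i = j" by (simp add: axis_eq_axis)
  qed
  have ind: "independent (range e)"
  proof
    assume "dependent (range e)"
    then obtain w where w: "\<exists>v\<in>range e. w v \<noteq> 0" "(\<Sum>v\<in>range e. w v *\<^sub>R v) = 0"
      by (auto simp: dependent_finite)
    have "(\<Sum>i\<in>UNIV. (\<chi> i. w (e i)) $ i *\<^sub>R e i) = 0"
      using w(2) by (simp add: sum.reindex[OF inj])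
    then have "(\<chi> i. w (e i)) = (0 :: real ^ 'n)" by (rule independent_frame)
    then show False using w(1) by (auto simp: vec_eq_iff)
  qed
  have orth: "y \<bullet> v = 0" if "v \<in> span B" "\<And>x. x \<in> B \<Longrightarrow> y \<bullet> x = 0" for y v :: "real ^ 'm" and B
    using that orthogonal_to_span[of v B y] by (auto simp: orthogonal_def)
  have N: "N \<notin> span (range e)"
  proof
    assume "N \<in> span (range e)"
    moreover have "N \<bullet> x = 0" if "x \<in> range e" for x using that normal by (auto simp: inner_commute[of N])
    ultimately have "N \<bullet> N = 0" by (rule orth)
    then show False using norm_N by simp
  qed
  have U: "u \<notin> span (insert N (range e))"
  proof
    assume "u \<in> span (insert N (range e))"
    moreover have "u \<bullet> x = 0" if "x \<in> insert N (range e)" for x using that u by (auto simp: inner_commute[of u])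
    ultimately have "u \<bullet> u = 0" by (rule orth)
    then show False using u0 by simp
  qed
  have "independent (insert u (insert N (range e)))"
    using ind N U by (simp add: independent_insertI)
  then have "card (insert u (insert N (range e))) \<le> CARD('m)"
    using independent_bound[of "insert u (insert N (range e))"] by simp
  moreover have "card (insert u (insert N (range e))) = CARD('n) + 2"
  proof -
    have "N \<notin> range e" "u \<notin> insert N (range e)" using N U span_base by metis+
    then show ?thesis by (simp add: card_image[OF inj])
  qed
  ultimately show False using card by simp
qed

lemma decomposition: "v = (\<Sum>j\<in>UNIV. coords v $ j *\<^sub>R e j) + (v \<bullet> N) *\<^sub>R N"
proof -
  define u where "u = v - (\<Sum>j\<in>UNIV. coords v $ j *\<^sub>R e j) - (v \<bullet> N) *\<^sub>R N"
  have "u = 0"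
  proof (rule orthogonal_to_frame_eq_0)
    fix i
    have "gram *v coords v = (\<chi> i. e i \<bullet> v)"
    proof -
      have "coords v = G *v (\<chi> i. e i \<bullet> v)" by (simp add: coords_def matrix_vector_mult_def)
      then show ?thesis by (simp add: matrix_vector_mul_assoc gram_G)
    qed
    then have "e i \<bullet> (\<Sum>j\<in>UNIV. coords v $ j *\<^sub>R e j) = e i \<bullet> v"
      by (simp add: inner_sum_right matrix_vector_mult_def gram_def vec_eq_iff mult.commute)
    then show "e i \<bullet> u = 0" by (simp add: u_def inner_diff_right normal)
  next
    have "N \<bullet> (\<Sum>j\<in>UNIV. coords v $ j *\<^sub>R e j) = 0"
      using normal by (simp add: inner_sum_right inner_commute[of N])
    moreover have "N \<bullet> N = 1" using norm_N by (simp add: norm_eq_1)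
    ultimately show "N \<bullet> u = 0" by (simp add: u_def inner_diff_right inner_commute)
  qed
  then show ?thesis by (simp add: u_def algebra_simps)
qed

text \<open>The dual frame vector, that is, the gradient of the \<open>b\<close>-th coordinate. It
  is tangent to the hypersurface and normal to the face on which this coordinate is constant; for
  \<open>b = bdry_index\<close> it points inwards.\<close>

definition conormal :: "'n \<Rightarrow> real ^ 'm" where
  "conormal b = (\<Sum>j\<in>UNIV. G $ b $ j *\<^sub>R e j)"

lemma conormal_inner_frame: "conormal b \<bullet> e k = (if b = k then 1 else 0)"
  by (simp add: conormal_def inner_sum_left sum_G_gram)

lemma conormal_inner: "conormal b \<bullet> v = coords v $ b"
  by (simp add: conormal_def inner_sum_left coords_def)

lemma norm_conormal: "(norm (conormal b))\<^sup>2 = G $ b $ b"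
proof -
  have "conormal b \<bullet> conormal b = (\<Sum>j\<in>UNIV. G $ b $ j * (conormal b \<bullet> e j))"
  proof -
    have "c \<bullet> conormal b = (\<Sum>j\<in>UNIV. G $ b $ j * (c \<bullet> e j))" for c
      by (simp add: conormal_def inner_sum_right)
    then show ?thesis .
  qed
  also have "\<dots> = G $ b $ b" by (simp add: conormal_inner_frame if_distrib cong: if_cong)
  finally show ?thesis by (simp add: power2_norm_eq_inner)
qed

lemma conormal_normal: "conormal b \<bullet> N = 0"
  by (simp add: conormal_def inner_sum_left normal)

lemma conormal_nonzero: "conormal b \<noteq> 0"
  using conormal_inner_frame[of b b] by auto

text \<open>Converts a flux computed in coordinates into a flux through the unit conormal: the
  length of the gradient is the ratio of the face density to the full density.\<close>

lemma sqrt_minor_complement: "sqrt (minor (UNIV - {b}) gram) = norm (conormal b) * sqrt (det gram)"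
  using minor_complement_eq[OF gram_G, of b] det_gram_pos norm_conormal[of b]
  by (simp add: real_sqrt_mult mult.commute real_sqrt_unique)

text \<open>Cauchy-Schwarz for the conormal component of \<open>v\<close>. The minus sign turns the
  inward \<open>conormal b\<close> into the outward direction.\<close>

lemma flux_le: "- (coords v $ b) * sqrt (det gram) \<le> norm v * sqrt (minor (UNIV - {b}) gram)"
proof -
  have "- (coords v $ b) \<le> norm (conormal b) * norm v"
    unfolding conormal_inner[symmetric] using Cauchy_Schwarz_ineq2[of "conormal b" v] by linarith
  then have "- (coords v $ b) * sqrt (det gram) \<le> norm (conormal b) * norm v * sqrt (det gram)"
    using det_gram_pos by (intro mult_right_mono) auto
  then show ?thesis by (simp add: sqrt_minor_complement mult_ac)
qed

lemma flux_eq_imp_tangent: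
  assumes "- (coords v $ b) * sqrt (det gram) = norm v * sqrt (minor (UNIV - {b}) gram)"
  shows "N \<bullet> v = 0"
proof -
  have "- (coords v $ b) * sqrt (det gram) = (norm (conormal b) * norm v) * sqrt (det gram)"
    using assms by (simp add: sqrt_minor_complement mult_ac)
  then have "- (coords v $ b) = norm (conormal b) * norm v"
    using det_gram_pos by (metis mult_right_cancel real_sqrt_gt_zero less_irrefl)
  then have "conormal b \<bullet> (- v) = norm (conormal b) * norm (- v)"
    by (simp add: conormal_inner[symmetric])
  then have "norm (conormal b) *\<^sub>R (- v) = norm (- v) *\<^sub>R conormal b"
    using norm_cauchy_schwarz_eq by blast
  then have "N \<bullet> (norm (conormal b) *\<^sub>R (- v)) = 0"
    using conormal_normal[of b] by (simp add: inner_commute)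
  then show ?thesis using conormal_nonzero by simp
qed

text \<open>A tangent vector orthogonal to all \<open>e i\<close> with \<open>i \<noteq> b\<close>
  is \<open>e b \<bullet> v\<close> times \<open>conormal b\<close>. The sign hypothesis says that
  it points outwards; with the other sign the flux would be the negative of the right-hand
  side.\<close>

lemma tangent_imp_flux_eq:
  assumes tangent: "N \<bullet> v = 0" and orth: "\<And>i. i \<noteq> b \<Longrightarrow> e i \<bullet> v = 0" and sign: "e b \<bullet> v \<le> 0"
  shows "- (coords v $ b) * sqrt (det gram) = norm v * sqrt (minor (UNIV - {b}) gram)"
proof -
  have co: "coords v $ j = G $ b $ j * (e b \<bullet> v)" for j
  proof -
    have "coords v $ j = (\<Sum>i\<in>UNIV. if i = b then G $ j $ i * (e i \<bullet> v) else 0)"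
      unfolding coords_def vec_lambda_beta by (rule sum.cong) (use orth in auto)
    then show ?thesis by (simp add: G_sym[of j b])
  qed
  have "v = (e b \<bullet> v) *\<^sub>R conormal b"
    using decomposition[of v] tangent co
    by (simp add: conormal_def scaleR_sum_right inner_commute mult.commute)
  then have "norm v = - (e b \<bullet> v) * norm (conormal b)"
    using sign by (metis abs_of_nonpos norm_scaleR)
  moreover have "coords v $ b = (e b \<bullet> v) * (norm (conormal b))\<^sup>2"
    by (simp add: co norm_conormal)
  ultimately show ?thesis
    by (simp add: sqrt_minor_complement power2_eq_square)
qed

end

section \<open>Integrating partial derivatives over the half-space\<close>

lemma at_within_model_eq:
  assumes "openin (top_of_set H) S" "x \<in> S"
  shows "at x within S = at x within H"
proof -
  obtain W where W: "open W" "S = H \<inter> W" using assms(1) by (auto simp: openin_open)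
  show ?thesis
    using W assms(2) by (intro at_within_nhd[where S = W]) auto
qed

text \<open>\<open>S\<close> and \<open>H - K\<close> are relatively open, cover \<open>H\<close>,
  and on their overlap the two definitions agree.\<close>

lemma zero_extension_continuous_on:
  fixes u :: "'v::euclidean_space \<Rightarrow> 'w::real_normed_vector"
  assumes S: "openin (top_of_set H) S" and K: "compact K" "K \<subseteq> S"
    and u: "continuous_on S u" and u0: "\<And>x. x \<in> S - K \<Longrightarrow> u x = 0"
  shows "continuous_on H (\<lambda>x. if x \<in> S then u x else 0)"
proof -
  have un: "S \<union> (H - K) = H" using K(2) openin_imp_subset[OF S] by blast
  have o: "openin (top_of_set H) (H - K)"
    using openin_open_Int[of "- K" H] K(1) by (simp add: compact_imp_closed Diff_eq open_Compl)
  show ?thesis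
    using continuous_on_cases_local_open[of S "H - K" u "\<lambda>_. 0" "\<lambda>x. x \<in> S"] S o u u0
    unfolding un by auto
qed

lemma zero_extension_has_derivative:
  fixes u :: "'v::euclidean_space \<Rightarrow> 'w::real_normed_vector"
  assumes S: "openin (top_of_set H) S" and K: "compact K" "K \<subseteq> S"
    and u: "\<And>x. x \<in> S \<Longrightarrow> (u has_derivative u' x) (at x within S)" and u0: "\<And>x. x \<in> S - K \<Longrightarrow> u x = 0"
    and x: "x \<in> H"
  shows "((\<lambda>x. if x \<in> S then u x else 0) has_derivative (if x \<in> S then u' x else (\<lambda>_. 0))) (at x within H)"
proof (cases "x \<in> S")
  case True
  obtain W where W: "open W" "S = H \<inter> W" using S by (auto simp: openin_open)
  have "(u has_derivative u' x) (at x within H)" using u[OF True] at_within_model_eq[OF S True] by simp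
  then have "((\<lambda>x. if x \<in> S then u x else 0) has_derivative u' x) (at x within H)"
    by (rule has_derivative_transform_within_openin[OF _ W(1)]) (use W True in auto)
  then show ?thesis using True by simp
next
  case False
  have "((\<lambda>_. 0) has_derivative (\<lambda>_. 0)) (at x within H)" by simp
  then have "((\<lambda>x. if x \<in> S then u x else 0) has_derivative (\<lambda>_. 0)) (at x within H)"
    by (rule has_derivative_transform_within_openin[where W = "- K"])
      (use K u0 x False in \<open>auto simp: compact_imp_closed\<close>)
  then show ?thesis using False by simp
qed

lemma pderiv_in_zero_outside_support:
  fixes u :: "real ^ 'n::finite \<Rightarrow> 'w::real_normed_vector"
  assumes S: "openin (top_of_set (model I)) S" and K: "compact K"
    and u0: "\<And>x. x \<in> S - K \<Longrightarrow> u x = 0" and x: "x \<in> S - K" and i: "i \<in> I"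
  shows "pderiv_in S i u x = 0"
proof -
  have "((\<lambda>_. 0) has_derivative (\<lambda>_. 0)) (at x within S)" by simp
  then have "(u has_derivative (\<lambda>_. 0)) (at x within S)"
    by (rule has_derivative_transform_within_openin[where W = "- K"])
      (use K u0 x in \<open>auto simp: compact_imp_closed\<close>)
  then show ?thesis using pderiv_in_eq[OF S _ i] x by blast
qed

lemma integral_FTC_line:
  fixes F :: "real \<Rightarrow> real"
  assumes "a \<le> b" and F: "\<And>t. t \<in> {a..b} \<Longrightarrow> (F has_vector_derivative f t) (at t within {a..b})"
    and c: "continuous_on {a..b} f" and f0: "\<And>t. t \<notin> {a..b} \<Longrightarrow> f t = 0"
  shows "(\<integral>t. f t \<partial>lborel) = F b - F a"
proof -
  have "(\<integral>t. f t \<partial>lborel) = (\<integral>t. indicator {a..b} t *\<^sub>R f t \<partial>lborel)"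
    using f0 by (intro Bochner_Integration.integral_cong) (auto simp: indicator_def)
  then show ?thesis using integral_FTC_Icc[OF assms(1) _ c] F by simp
qed

text \<open>Fubini along the lines in direction \<open>i\<close>, and the fundamental theorem of
  calculus on each. For \<open>i \<noteq> bdry_index\<close> a line lies in the half-space entirely
  or not at all, and both ends are off the support. For \<open>i = bdry_index\<close> it starts on
  the face and leaves minus the value there.\<close>

lemma integral_pderiv_half_space:
  fixes u :: "real ^ 'n::finite \<Rightarrow> real"
  assumes S: "openin (top_of_set (model UNIV)) S" and K: "compact K" "K \<subseteq> S"
    and u: "C1_on S u" and u0: "\<And>x. x \<in> S - K \<Longrightarrow> u x = 0"
  shows "(\<integral>x. pderiv_in S i u x * indicator S x \<partial>lborel) =
    (if i = bdry_index then - (\<integral>y. u y * indicator S y \<partial>coord_lborel (UNIV - {bdry_index})) else 0)"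
    and "integrable lborel (\<lambda>x. pderiv_in S i u x * indicator S x)"
proof -
  define H where "H = model (UNIV :: 'n set)"
  have H: "H = {x. 0 \<le> x $ bdry_index}" by (auto simp: H_def model_def)
  define U where "U x = (if x \<in> S then u x else 0)" for x
  define D where "D x = (if x \<in> S then pderiv_in S i u x else 0)" for x
  have SH: "S \<subseteq> H" using openin_imp_subset[OF S] by (simp add: H_def)
  obtain u' where u': "\<And>x. x \<in> S \<Longrightarrow> (u has_derivative u' x) (at x within S)"
    using C1_onE[OF u] by metis
  have D0: "pderiv_in S i u x = 0" if "x \<in> S - K" for x
    using pderiv_in_zero_outside_support[OF S K(1) u0 that] by simp
  have cD: "continuous_on H D"
    unfolding D_def H_def
    by (rule zero_extension_continuous_on[OF S K C1_on_pderiv_in_continuous[OF S _ u] D0]) simp_all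
  have DK: "D x = 0" "U x = 0" if "x \<notin> K" for x using that D0 u0 by (auto simp: D_def U_def)
  have eqD: "(\<lambda>x. pderiv_in S i u x * indicator S x) = D" by (auto simp: D_def)
  have int: "integrable lborel D"
  proof -
    have "integrable lborel (\<lambda>x. indicator K x *\<^sub>R D x)"
      using K SH by (intro borel_integrable_compact continuous_on_subset[OF cD]) auto
    moreover have "(\<lambda>x. indicator K x *\<^sub>R D x) = D" using DK by (intro ext) (auto simp: indicator_def)
    ultimately show ?thesis by simp
  qed
  then show "integrable lborel (\<lambda>x. pderiv_in S i u x * indicator S x)" by (simp add: eqD)
  \<comment> \<open>A line through a point of \<open>coord_space (UNIV - {i})\<close> in direction
    \<open>i\<close> has left \<open>K\<close> once its parameter reaches \<open>R\<close> in
    absolute value.\<close>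
  obtain R where R: "R > 0" "\<And>x. x \<in> K \<Longrightarrow> norm x < R"
    using compact_imp_bounded[OF K(1)] bounded_pos_less by blast
  have line: "((\<lambda>t. U (y + t *\<^sub>R axis i 1)) has_vector_derivative D (y + t *\<^sub>R axis i 1)) (at t within T)"
    if T: "\<And>t. t \<in> T \<Longrightarrow> y + t *\<^sub>R axis i 1 \<in> H" and t: "t \<in> T" for y t T
  proof -
    let ?x = "y + t *\<^sub>R axis i 1"
    have "(U has_derivative (if ?x \<in> S then u' ?x else (\<lambda>_. 0))) (at ?x within H)"
      unfolding U_def H_def
      by (rule zero_extension_has_derivative[OF S K u' u0]) (use T t in \<open>auto simp: H_def\<close>)
    then have "(U has_derivative (if ?x \<in> S then u' ?x else (\<lambda>_. 0))) (at ?x within (\<lambda>t. y + t *\<^sub>R axis i 1) ` T)"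
      by (rule has_derivative_subset) (use T in auto)
    then have "((\<lambda>t. U (y + t *\<^sub>R axis i 1)) has_derivative (\<lambda>s. (if ?x \<in> S then u' ?x else (\<lambda>_. 0)) (s *\<^sub>R axis i 1))) (at t within T)"
      by (rule has_derivative_in_compose[rotated]) (auto intro!: derivative_eq_intros)
    moreover have "(if ?x \<in> S then u' ?x else (\<lambda>_. 0)) (s *\<^sub>R axis i 1) = s *\<^sub>R D ?x" for s
    proof (cases "?x \<in> S")
      case True
      have "u' ?x (s *\<^sub>R axis i 1) = s * u' ?x (axis i 1)"
        using has_derivative_bounded_linear[OF u'[OF True]] by (simp add: linear_simps)
      then show ?thesis using True pderiv_in_eq[OF S True _ u'[OF True], of i] by (simp add: D_def)
    qed (simp add: D_def)
    ultimately show ?thesis by (simp add: has_vector_derivative_def)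
  qed
  have contl: "continuous_on T (\<lambda>t. D (y + t *\<^sub>R axis i 1))"
    if T: "\<And>t. t \<in> T \<Longrightarrow> y + t *\<^sub>R axis i 1 \<in> H" for y T
    by (rule continuous_on_compose2[OF cD]) (use T in \<open>auto intro!: continuous_intros\<close>)
  have far: "y + t *\<^sub>R axis i 1 \<notin> K" if "\<bar>t\<bar> \<ge> R" "y \<in> coord_space (UNIV - {i})" for y t
  proof
    assume "y + t *\<^sub>R axis i 1 \<in> K"
    then have "norm (y + t *\<^sub>R axis i 1) < R" by (rule R(2))
    moreover have "\<bar>(y + t *\<^sub>R axis i 1) $ i\<bar> \<le> norm (y + t *\<^sub>R axis i 1)" by (rule component_le_norm_cart)
    moreover have "(y + t *\<^sub>R axis i 1) $ i = t" using that(2) by (simp add: coord_space_def)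
    ultimately show False using that(1) by simp
  qed
  have inner: "(\<integral>t. D (y + t *\<^sub>R axis i 1) \<partial>lborel) = (if i = bdry_index then - U y else 0)"
    if y: "y \<in> coord_space (UNIV - {i})" for y
  proof (cases "i = bdry_index")
    case True
    have yH: "y + t *\<^sub>R axis i 1 \<in> H \<longleftrightarrow> t \<ge> 0" for t
      using y by (simp add: H True coord_space_def)
    have "(\<integral>t. D (y + t *\<^sub>R axis i 1) \<partial>lborel) = U (y + R *\<^sub>R axis i 1) - U (y + 0 *\<^sub>R axis i 1)"
    proof (rule integral_FTC_line[where F = "\<lambda>t. U (y + t *\<^sub>R axis i 1)"])
      show "D (y + t *\<^sub>R axis i 1) = 0" if "t \<notin> {0..R}" for t
      proof (cases "t < 0")
        case True
        then have "y + t *\<^sub>R axis i 1 \<notin> S" using yH SH by (meson not_less subsetD)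
        then show ?thesis by (simp add: D_def)
      next
        case False
        then show ?thesis using that by (intro DK(1)[OF far[OF _ y]]) simp
      qed
      show "((\<lambda>t. U (y + t *\<^sub>R axis i 1)) has_vector_derivative D (y + t *\<^sub>R axis i 1)) (at t within {0..R})"
        if "t \<in> {0..R}" for t by (rule line) (use yH that in auto)
      show "continuous_on {0..R} (\<lambda>t. D (y + t *\<^sub>R axis i 1))" by (rule contl) (use yH in auto)
    qed (use R(1) in simp)
    also have "U (y + R *\<^sub>R axis i 1) = 0" using R(1) by (intro DK far y) simp
    finally show ?thesis using True by simp
  next
    case False
    have yH: "y + t *\<^sub>R axis i 1 \<in> H \<longleftrightarrow> y $ bdry_index \<ge> 0" for t
      using False by (simp add: H axis_def)
    have "(\<integral>t. D (y + t *\<^sub>R axis i 1) \<partial>lborel) = 0"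
    proof (cases "y $ bdry_index \<ge> 0")
      case True
      have "(\<integral>t. D (y + t *\<^sub>R axis i 1) \<partial>lborel) = U (y + R *\<^sub>R axis i 1) - U (y + (- R) *\<^sub>R axis i 1)"
      proof (rule integral_FTC_line[where F = "\<lambda>t. U (y + t *\<^sub>R axis i 1)"])
        show "((\<lambda>t. U (y + t *\<^sub>R axis i 1)) has_vector_derivative D (y + t *\<^sub>R axis i 1)) (at t within {- R..R})"
          if "t \<in> {- R..R}" for t by (rule line) (use yH True that in auto)
        show "continuous_on {- R..R} (\<lambda>t. D (y + t *\<^sub>R axis i 1))" by (rule contl) (use yH True in auto)
        show "D (y + t *\<^sub>R axis i 1) = 0" if "t \<notin> {- R..R}" for t
          using that by (intro DK(1)[OF far[OF _ y]]) auto
      qed (use R(1) in simp)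
      also have "\<dots> = 0" using R(1) DK(2)[OF far[OF _ y, of R]] DK(2)[OF far[OF _ y, of "- R"]] by simp
      finally show ?thesis .
    next
      case False
      then have "D (y + t *\<^sub>R axis i 1) = 0" for t
        using yH[of t] SH by (auto simp: D_def)
      then show ?thesis by simp
    qed
    then show ?thesis using False by simp
  qed
  have "(\<integral>x. D x \<partial>lborel) = (\<integral>y. (\<integral>t. D (y + t *\<^sub>R axis i 1) \<partial>lborel) \<partial>coord_lborel (UNIV - {i}))"
    by (rule integral_lborel_split[OF int])
  also have "\<dots> = (\<integral>y. (if i = bdry_index then - U y else 0) \<partial>coord_lborel (UNIV - {i}))"
  proof (rule Bochner_Integration.integral_cong_AE)
    show "AE y in coord_lborel (UNIV - {i}). (\<integral>t. D (y + t *\<^sub>R axis i 1) \<partial>lborel) = (if i = bdry_index then - U y else 0)"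
      using AE_coord_lborel_coord_space by eventually_elim (rule inner)
    have [measurable]: "D \<in> borel_measurable borel" using int by auto
    show "(\<lambda>y. \<integral>t. D (y + t *\<^sub>R axis i 1) \<partial>lborel) \<in> borel_measurable (coord_lborel (UNIV - {i}))"
      by measurable
    have "(\<lambda>x. u x * indicator S x) \<in> borel_measurable borel"
      by (rule continuous_on_imp_indicator_measurable[OF S C1_on_continuous_on[OF u]])
    moreover have "(\<lambda>x. u x * indicator S x) = U" by (auto simp: U_def)
    ultimately have [measurable]: "U \<in> borel_measurable borel" by simp
    show "(\<lambda>y. if i = bdry_index then - U y else 0) \<in> borel_measurable (coord_lborel (UNIV - {i}))"
      by measurable
  qed
  finally show "(\<integral>x. pderiv_in S i u x * indicator S x \<partial>lborel) =
    (if i = bdry_index then - (\<integral>y. u y * indicator S y \<partial>coord_lborel (UNIV - {bdry_index})) else 0)"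
  proof -
    assume "integral\<^sup>L lborel D = (\<integral>y. (if i = bdry_index then - U y else 0) \<partial>coord_lborel (UNIV - {i}))"
    moreover have "(\<lambda>y. u y * indicator S y) = U" by (auto simp: U_def)
    ultimately show ?thesis unfolding eqD by simp
  qed
qed


section \<open>The divergence of the tangential position field in a chart\<close>

lemma differentiable_pderiv_in:
  fixes f :: "real ^ 'n::finite \<Rightarrow> 'w::real_normed_vector"
  assumes "openin (top_of_set (model I)) S" "x \<in> S" "f differentiable (at x within S)"
  obtains f' where "(f has_derivative f') (at x within S)" "\<And>i. i \<in> I \<Longrightarrow> f' (axis i 1) = pderiv_in S i f x"
  using assms pderiv_in_eq[OF assms(1,2)] unfolding differentiable_def by metis

lemma pderiv_in_bilinear:
  fixes f :: "real ^ 'n::finite \<Rightarrow> 'w::real_normed_vector"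
  assumes B: "bounded_bilinear B" and S: "openin (top_of_set (model I)) S" "x \<in> S" and i: "i \<in> I"
    and f: "f differentiable (at x within S)" and g: "g differentiable (at x within S)"
  shows "pderiv_in S i (\<lambda>x. B (f x) (g x)) x = B (f x) (pderiv_in S i g x) + B (pderiv_in S i f x) (g x)"
proof -
  obtain f' where f': "(f has_derivative f') (at x within S)" "f' (axis i 1) = pderiv_in S i f x"
    using differentiable_pderiv_in[OF S f] i by metis
  obtain g' where g': "(g has_derivative g') (at x within S)" "g' (axis i 1) = pderiv_in S i g x"
    using differentiable_pderiv_in[OF S g] i by metis
  show ?thesis
    using pderiv_in_eq[OF S i bounded_bilinear.FDERIV[OF B f'(1) g'(1)]] f'(2) g'(2) by simp
qed

lemmas pderiv_in_mult = pderiv_in_bilinear[OF bounded_bilinear_mult]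
lemmas pderiv_in_inner = pderiv_in_bilinear[OF bounded_bilinear_inner]

lemma pderiv_in_const:
  assumes "openin (top_of_set (model I)) S" "x \<in> S" "i \<in> I"
  shows "pderiv_in S i (\<lambda>x. c) x = 0"
  using pderiv_in_eq[OF assms has_derivative_const] .

lemma pderiv_in_sum:
  fixes f :: "'k \<Rightarrow> real ^ 'n::finite \<Rightarrow> 'w::real_normed_vector"
  assumes S: "openin (top_of_set (model I)) S" "x \<in> S" and i: "i \<in> I"
    and f: "\<And>k. k \<in> K \<Longrightarrow> f k differentiable (at x within S)"
  shows "pderiv_in S i (\<lambda>x. \<Sum>k\<in>K. f k x) x = (\<Sum>k\<in>K. pderiv_in S i (f k) x)"
proof -
  have "\<exists>f'. \<forall>k\<in>K. (f k has_derivative f' k) (at x within S)"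
    using f unfolding differentiable_def by metis
  then obtain f' where f': "\<And>k. k \<in> K \<Longrightarrow> (f k has_derivative f' k) (at x within S)" by blast
  show ?thesis
    using pderiv_in_eq[OF S i has_derivative_sum[OF f']] pderiv_in_eq[OF S i f'] by simp
qed

lemma pderiv_in_diff_const:
  fixes f :: "real ^ 'n::finite \<Rightarrow> 'w::real_normed_vector"
  assumes S: "openin (top_of_set (model I)) S" "x \<in> S" and i: "i \<in> I" and f: "f differentiable (at x within S)"
  shows "pderiv_in S i (\<lambda>x. f x - c) x = pderiv_in S i f x"
proof -
  obtain f' where f': "(f has_derivative f') (at x within S)" "f' (axis i 1) = pderiv_in S i f x"
    using differentiable_pderiv_in[OF S f] i by metis
  have "((\<lambda>x. f x - c) has_derivative f') (at x within S)"
    using has_derivative_diff[OF f'(1) has_derivative_const] by simp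
  then show ?thesis using pderiv_in_eq[OF S i] f'(2) by metis
qed

lemma pderiv_in_compose_real:
  fixes f :: "real ^ 'n::finite \<Rightarrow> real"
  assumes S: "openin (top_of_set (model I)) S" "x \<in> S" and i: "i \<in> I" and f: "f differentiable (at x within S)"
    and \<phi>: "(\<phi> has_real_derivative d) (at (f x))"
  shows "pderiv_in S i (\<lambda>x. \<phi> (f x)) x = d * pderiv_in S i f x"
proof -
  obtain f' where f': "(f has_derivative f') (at x within S)" "f' (axis i 1) = pderiv_in S i f x"
    using differentiable_pderiv_in[OF S f] i by metis
  have "((\<lambda>x. \<phi> (f x)) has_derivative (\<lambda>v. d * f' v)) (at x within S)"
    using has_derivative_compose[OF f'(1)] \<phi> by (auto simp: has_field_derivative_def)
  then show ?thesis using pderiv_in_eq[OF S i] f'(2) by metis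
qed

lemma pderiv_in_cong:
  fixes f :: "real ^ 'n::finite \<Rightarrow> 'w::real_normed_vector"
  assumes S: "openin (top_of_set (model I)) S" "x \<in> S" and i: "i \<in> I" and f: "f differentiable (at x within S)"
    and eq: "\<And>y. y \<in> S \<Longrightarrow> f y = g y"
  shows "pderiv_in S i f x = pderiv_in S i g x"
proof -
  obtain f' where f': "(f has_derivative f') (at x within S)" "f' (axis i 1) = pderiv_in S i f x"
    using differentiable_pderiv_in[OF S f] i by metis
  have "(g has_derivative f') (at x within S)"
    by (rule has_derivative_transform[OF S(2) _ f'(1)]) (simp add: eq)
  then show ?thesis using pderiv_in_eq[OF S i] f'(2) by metis
qed

lemma pderiv_in_det:
  fixes A :: "real ^ 'n::finite \<Rightarrow> real ^ 'k::finite ^ 'k"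
  assumes S: "openin (top_of_set (model I)) S" "x \<in> S" and i: "i \<in> I"
    and A: "\<And>k l. (\<lambda>x. A x $ k $ l) differentiable (at x within S)" and G: "G ** A x = mat 1"
  shows "pderiv_in S i (\<lambda>x. det (A x)) x
    = det (A x) * (\<Sum>k\<in>UNIV. \<Sum>l\<in>UNIV. pderiv_in S i (\<lambda>x. A x $ k $ l) x * G $ l $ k)"
proof -
  have "\<exists>A'. \<forall>k l. ((\<lambda>x. A x $ k $ l) has_derivative A' k l) (at x within S)"
    using A unfolding differentiable_def by metis
  then obtain A' where A': "\<And>k l. ((\<lambda>x. A x $ k $ l) has_derivative A' k l) (at x within S)" by blast
  define B where "B v = (\<chi> k l. A' k l v)" for v
  have "((\<lambda>x. A x $ k $ l) has_derivative (\<lambda>v. B v $ k $ l)) (at x within S)" for k l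
    using A' by (simp add: B_def)
  from pderiv_in_eq[OF S i has_derivative_det[OF this]]
  have "pderiv_in S i (\<lambda>x. det (A x)) x = (\<Sum>k\<in>UNIV. det (\<chi> j. if j = k then B (axis i 1) $ j else A x $ j))" .
  also have "\<dots> = det (A x) * (\<Sum>k\<in>UNIV. \<Sum>l\<in>UNIV. B (axis i 1) $ k $ l * G $ l $ k)"
    by (rule sum_det_replace_row[OF G])
  finally show ?thesis
    using pderiv_in_eq[OF S i A'] by (simp add: B_def)
qed

lemma C1_on_det:
  fixes A :: "'v::euclidean_space \<Rightarrow> real ^ 'k::finite ^ 'k"
  assumes "\<And>i j. C1_on S (\<lambda>x. A x $ i $ j)"
  shows "C1_on S (\<lambda>x. det (A x))"
  unfolding det_def by (intro C1_on_sum C1_on_mult C1_on_const C1_on_prod assms)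

section \<open>Minimal hypersurfaces in one chart\<close>

locale minimal_patch =
  fixes S :: "(real ^ 'n::finite) set" and f N :: "real ^ 'n \<Rightarrow> real ^ 'm::finite" and z :: "real ^ 'm"
  assumes S: "openin (top_of_set (model UNIV)) S" and f: "smooth_on S f"
    and card: "CARD('m) = CARD('n) + 1"
    and independent_partials: "x \<in> S \<Longrightarrow> (\<Sum>i\<in>UNIV. v $ i *\<^sub>R pderiv_in S i f x) = 0 \<Longrightarrow> v = 0"
    and norm_N: "x \<in> S \<Longrightarrow> norm (N x) = 1"
    and normal: "x \<in> S \<Longrightarrow> pderiv_in S i f x \<bullet> N x = 0"
    and minimal: "x \<in> S \<Longrightarrow> trace (matrix_inv (\<chi> i j. pderiv_in S i f x \<bullet> pderiv_in S j f x) **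
      (\<chi> i j. pderiv_in S i (pderiv_in S j f) x \<bullet> N x)) = 0"
begin

definition partial :: "real ^ 'n \<Rightarrow> 'n \<Rightarrow> real ^ 'm" where "partial x i = pderiv_in S i f x"

lemma frame: "x \<in> S \<Longrightarrow> hypersurface_frame (partial x) (N x)"
  using card independent_partials norm_N normal by unfold_locales (auto simp: partial_def)

abbreviation fform :: "real ^ 'n \<Rightarrow> real ^ 'n ^ 'n" where
  "fform x \<equiv> hypersurface_frame.gram (partial x)"

text \<open>\<open>vf\<close> holds the coordinates of the tangential part of \<open>f - z\<close>, and \<open>w\<close> is the volume density.\<close>

definition vf :: "real ^ 'n \<Rightarrow> real ^ 'n" where
  "vf x = hypersurface_frame.coords (partial x) (f x - z)"

definition w :: "real ^ 'n \<Rightarrow> real" where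
  "w x = sqrt (det (fform x))"

lemma gram_entry: "x \<in> S \<Longrightarrow> fform x $ i $ j = partial x i \<bullet> partial x j"
  by (simp add: hypersurface_frame.gram_def[OF frame])

lemma gram_vf: "x \<in> S \<Longrightarrow> (\<Sum>j\<in>UNIV. (partial x i \<bullet> partial x j) * vf x $ j) = partial x i \<bullet> (f x - z)"
proof -
  assume x: "x \<in> S"
  interpret hypersurface_frame "partial x" "N x" by (rule frame[OF x])
  have "(\<Sum>j\<in>UNIV. (partial x i \<bullet> partial x j) * vf x $ j) = partial x i \<bullet> (\<Sum>j\<in>UNIV. vf x $ j *\<^sub>R partial x j)"
    by (simp add: inner_sum_right mult.commute)
  also have "\<dots> = partial x i \<bullet> ((\<Sum>j\<in>UNIV. vf x $ j *\<^sub>R partial x j) + ((f x - z) \<bullet> N x) *\<^sub>R N x)"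
    by (simp add: inner_add_right normal)
  finally show ?thesis using decomposition[of "f x - z"] by (simp add: vf_def)
qed

lemma det_gram_pos: "x \<in> S \<Longrightarrow> det (fform x) > 0"
  using hypersurface_frame.det_gram_pos[OF frame] .

lemma C1_partial: "C1_on S (\<lambda>x. partial x i)"
  unfolding partial_def by (rule smooth_on_C1_on[OF S smooth_on_pderiv_in[OF S _ f]]) simp

lemma C1_f: "C1_on S f" by (rule smooth_on_C1_on[OF S f])

lemma C1_pos: "C1_on S (\<lambda>x. f x - z)"
  using C1_on_add[OF C1_f C1_on_const[of S "- z"]] by simp

lemma C1_gram: "C1_on S (\<lambda>x. fform x $ i $ j)"
  using C1_on_inner[OF C1_partial C1_partial] by (rule C1_on_cong) (simp add: gram_entry)

lemma C1_w: "C1_on S w"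
  unfolding w_def
  by (rule C1_on_compose_real[where \<phi>' = "\<lambda>t. inverse (sqrt t) / 2", OF C1_on_det[OF C1_gram]])
    (auto intro!: DERIV_real_sqrt continuous_intros dest!: det_gram_pos)

text \<open>Instead of differentiating an inverse matrix, Cramer's rule presents the coordinates as
  quotients of determinants with C1 entries.\<close>

lemma C1_vf: "C1_on S (\<lambda>x. vf x $ k)"
proof -
  define D where "D x = (\<chi> i j. if j = k then partial x i \<bullet> (f x - z) else fform x $ i $ j)" for x
  have "C1_on S (\<lambda>x. D x $ i $ j)" for i j
    by (cases "j = k") (auto simp: D_def intro!: C1_gram C1_on_inner C1_partial C1_pos)
  then have "C1_on S (\<lambda>x. det (D x) * inverse (det (fform x)))"
    by (intro C1_on_mult C1_on_det C1_on_compose_real[where \<phi> = inverse and \<phi>' = "\<lambda>t. - (inverse t ^ Suc (Suc 0))"]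
        DERIV_inverse C1_gram continuous_intros)
      (auto dest!: det_gram_pos)
  then show ?thesis
  proof (rule C1_on_cong)
    fix x assume x: "x \<in> S"
    have "fform x *v vf x = (\<chi> i. partial x i \<bullet> (f x - z))"
      using gram_vf[OF x] by (simp add: matrix_vector_mult_def gram_entry[OF x])
    moreover have "det (fform x) \<noteq> 0" using det_gram_pos[OF x] by simp
    ultimately have "vf x = (\<chi> k. det (\<chi> i j. if j = k then (\<chi> i. partial x i \<bullet> (f x - z)) $ i else fform x $ i $ j) / det (fform x))"
      using cramer by blast
    then have "vf x $ k = (\<chi> k. det (\<chi> i j. if j = k then (\<chi> i. partial x i \<bullet> (f x - z)) $ i else fform x $ i $ j) / det (fform x)) $ k"
      by (rule arg_cong)
    then show "det (D x) * inverse (det (fform x)) = vf x $ k"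
      by (simp add: D_def divide_inverse cong: if_cong)
  qed
qed

text \<open>The tangential part of \<open>f - z\<close> has divergence \<open>n\<close>. In coordinates the derivative of the density cancels
  the terms in which the second derivatives of \<open>f\<close> are tangential, and minimality cancels the normal ones.\<close>

lemma divergence_vf:
  assumes x: "x \<in> S"
  shows "(\<Sum>i\<in>UNIV. pderiv_in S i (\<lambda>x. vf x $ i) x) * w x + (\<Sum>i\<in>UNIV. vf x $ i * pderiv_in S i w x) = CARD('n) * w x"
proof -
  interpret hypersurface_frame "partial x" "N x" by (rule frame[OF x])
  note pd = S x UNIV_I
  note diff = C1_on_differentiable[OF _ x]
  define \<Psi> where "\<Psi> = f x - z"
  define e where "e = partial x"
  define d where "d i j = pderiv_in S i (\<lambda>x. partial x j) x" for i j
  define Y where "Y = vf x"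
  define DY where "DY i j = pderiv_in S i (\<lambda>x. vf x $ j) x" for i j
  have d: "d i j = pderiv_in S i (pderiv_in S j f) x" for i j
    by (simp add: d_def partial_def)
  have dsym: "d i j = d j i" for i j
    unfolding d by (rule pderiv_in_commute[OF S _ _ f x]) simp_all
  have Dg: "pderiv_in S i (\<lambda>x. partial x k \<bullet> partial x l) x = e k \<bullet> d i l + d i k \<bullet> e l" for i k l
    unfolding e_def d_def by (rule pderiv_in_inner[OF pd diff[OF C1_partial] diff[OF C1_partial]])
  have Da: "pderiv_in S i (\<lambda>x. partial x k \<bullet> (f x - z)) x = e k \<bullet> e i + d i k \<bullet> \<Psi>" for i k
    unfolding pderiv_in_inner[OF pd diff[OF C1_partial] diff[OF C1_pos]] pderiv_in_diff_const[OF pd diff[OF C1_f]]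
    by (simp add: e_def d_def \<Psi>_def partial_def)
  have X: "(\<Sum>j\<in>UNIV. Y $ j *\<^sub>R e j) = \<Psi> - (\<Psi> \<bullet> N x) *\<^sub>R N x"
    using decomposition[of \<Psi>] by (simp add: Y_def vf_def e_def \<Psi>_def algebra_simps)
  \<comment> \<open>Comes from differentiating the linear system \<open>gram_vf\<close> and
    inserting \<open>X\<close> for the tangential part, so no derivative of the inverse metric
    appears.\<close>
  have GDY: "(\<Sum>j\<in>UNIV. (e k \<bullet> e j) * DY i j) = e k \<bullet> e i + (\<Psi> \<bullet> N x) * (d i k \<bullet> N x) - (\<Sum>j\<in>UNIV. Y $ j * (e k \<bullet> d i j))" for i k
  proof -
    have "pderiv_in S i (\<lambda>x. \<Sum>j\<in>UNIV. (partial x k \<bullet> partial x j) * vf x $ j) x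
        = (\<Sum>j\<in>UNIV. pderiv_in S i (\<lambda>x. (partial x k \<bullet> partial x j) * vf x $ j) x)"
      by (intro pderiv_in_sum[OF pd] diff C1_on_mult C1_on_inner C1_partial C1_vf)
    also have "\<dots> = (\<Sum>j\<in>UNIV. (e k \<bullet> e j) * DY i j + (e k \<bullet> d i j + d i k \<bullet> e j) * Y $ j)"
      unfolding pderiv_in_mult[OF pd diff[OF C1_on_inner[OF C1_partial C1_partial]] diff[OF C1_vf]] Dg
      by (simp add: e_def DY_def Y_def)
    also have "\<dots> = (\<Sum>j\<in>UNIV. (e k \<bullet> e j) * DY i j) + (\<Sum>j\<in>UNIV. Y $ j * (e k \<bullet> d i j)) + d i k \<bullet> (\<Sum>j\<in>UNIV. Y $ j *\<^sub>R e j)"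
      by (simp add: sum.distrib inner_sum_right algebra_simps)
    finally have "pderiv_in S i (\<lambda>x. partial x k \<bullet> (f x - z)) x
      = (\<Sum>j\<in>UNIV. (e k \<bullet> e j) * DY i j) + (\<Sum>j\<in>UNIV. Y $ j * (e k \<bullet> d i j)) + d i k \<bullet> (\<Sum>j\<in>UNIV. Y $ j *\<^sub>R e j)"
      using pderiv_in_cong[OF pd diff[OF C1_on_inner[OF C1_partial C1_pos]], of k "\<lambda>x. \<Sum>j\<in>UNIV. (partial x k \<bullet> partial x j) * vf x $ j" i]
        gram_vf by simp
    then show ?thesis unfolding Da X by (simp add: inner_diff_right algebra_simps)
  qed
  \<comment> \<open>The contracted Christoffel term. It occurs with a minus sign in the coordinate
    divergence of \<open>Y\<close> and with a plus sign in the derivative of the density.\<close>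
  define T where "T = (\<Sum>i\<in>UNIV. \<Sum>k\<in>UNIV. G $ i $ k * (\<Sum>j\<in>UNIV. Y $ j * (e k \<bullet> d i j)))"
  have "DY i i = (\<Sum>k\<in>UNIV. G $ i $ k * (\<Sum>j\<in>UNIV. (e k \<bullet> e j) * DY i j))" for i
  proof -
    have "(\<Sum>k\<in>UNIV. G $ i $ k * (\<Sum>j\<in>UNIV. (e k \<bullet> e j) * DY i j)) = (\<Sum>j\<in>UNIV. (\<Sum>k\<in>UNIV. G $ i $ k * (e k \<bullet> e j)) * DY i j)"
      by (simp add: sum_distrib_left sum_distrib_right mult.assoc) (rule sum.swap)
    also have "\<dots> = (\<Sum>j\<in>UNIV. if i = j then DY i j else 0)"
      unfolding e_def sum_G_gram by (intro sum.cong) auto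
    also have "\<dots> = DY i i" by simp
    finally show ?thesis by simp
  qed
  then have "(\<Sum>i\<in>UNIV. DY i i) = (\<Sum>i\<in>UNIV. \<Sum>k\<in>UNIV. G $ i $ k * (e k \<bullet> e i + (\<Psi> \<bullet> N x) * (d i k \<bullet> N x) - (\<Sum>j\<in>UNIV. Y $ j * (e k \<bullet> d i j))))"
    unfolding GDY by simp
  also have "\<dots> = (\<Sum>i\<in>UNIV. \<Sum>k\<in>UNIV. G $ i $ k * (e k \<bullet> e i)) + (\<Psi> \<bullet> N x) * (\<Sum>i\<in>UNIV. \<Sum>k\<in>UNIV. G $ i $ k * (d i k \<bullet> N x)) - T"
    by (simp add: T_def sum.distrib sum_subtractf algebra_simps sum_distrib_left)
  also have "(\<Sum>i\<in>UNIV. \<Sum>k\<in>UNIV. G $ i $ k * (e k \<bullet> e i)) = CARD('n)"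
    unfolding e_def sum_G_gram by simp
  also have "(\<Sum>i\<in>UNIV. \<Sum>k\<in>UNIV. G $ i $ k * (d i k \<bullet> N x)) = 0"
    using minimal[OF x] by (simp add: trace_def matrix_matrix_mult_def G_def gram_def partial_def[symmetric] d[symmetric] dsym)
  finally have divY: "(\<Sum>i\<in>UNIV. DY i i) = CARD('n) - T" by simp
  \<comment> \<open>Jacobi's formula: the two terms of the differentiated metric contribute equally
    by symmetry of \<open>G\<close>, and this factor 2 cancels against the one from the square
    root.\<close>
  have Dw: "pderiv_in S i w x = w x * (\<Sum>k\<in>UNIV. \<Sum>l\<in>UNIV. G $ l $ k * (e k \<bullet> d i l))" for i
  proof -
    let ?s = "\<Sum>k\<in>UNIV. \<Sum>l\<in>UNIV. G $ l $ k * (e k \<bullet> d i l)"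
    have "pderiv_in S i (\<lambda>x. fform x $ k $ l) x = e k \<bullet> d i l + d i k \<bullet> e l" for k l
      using pderiv_in_cong[OF pd diff[OF C1_on_inner[OF C1_partial C1_partial]], of k l "\<lambda>x. fform x $ k $ l" i]
      unfolding Dg by (simp add: gram_entry)
    then have "pderiv_in S i (\<lambda>x. det (fform x)) x
        = det gram * (\<Sum>k\<in>UNIV. \<Sum>l\<in>UNIV. (e k \<bullet> d i l + d i k \<bullet> e l) * G $ l $ k)"
      using pderiv_in_det[OF pd diff[OF C1_gram] G_gram, of i] by simp
    also have "(\<Sum>k\<in>UNIV. \<Sum>l\<in>UNIV. (e k \<bullet> d i l + d i k \<bullet> e l) * G $ l $ k)
        = ?s + (\<Sum>k\<in>UNIV. \<Sum>l\<in>UNIV. G $ l $ k * (d i k \<bullet> e l))"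
      by (simp add: algebra_simps sum.distrib)
    also have "(\<Sum>k\<in>UNIV. \<Sum>l\<in>UNIV. G $ l $ k * (d i k \<bullet> e l)) = ?s"
      by (subst sum.swap) (simp add: inner_commute G_sym)
    finally have "pderiv_in S i (\<lambda>x. det (fform x)) x = 2 * det gram * ?s" by simp
    moreover have "pderiv_in S i w x = inverse (sqrt (det gram)) / 2 * pderiv_in S i (\<lambda>x. det (fform x)) x"
      unfolding w_def[abs_def]
      by (rule pderiv_in_compose_real[OF pd diff[OF C1_on_det[OF C1_gram]]]) (rule DERIV_real_sqrt[OF det_gram_pos])
    moreover have "inverse (sqrt (det gram)) * det gram = w x"
      using det_gram_pos by (simp add: w_def real_div_sqrt divide_inverse[symmetric] mult.commute)
    ultimately show ?thesis by simp
  qed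
  have "(\<Sum>i\<in>UNIV. Y $ i * pderiv_in S i w x) = w x * (\<Sum>i\<in>UNIV. \<Sum>k\<in>UNIV. \<Sum>l\<in>UNIV. G $ l $ k * (Y $ i * (e k \<bullet> d i l)))"
    unfolding Dw by (simp add: sum_distrib_left mult_ac)
  also have "(\<Sum>i\<in>UNIV. \<Sum>k\<in>UNIV. \<Sum>l\<in>UNIV. G $ l $ k * (Y $ i * (e k \<bullet> d i l))) = T"
  proof -
    have "(\<Sum>i\<in>UNIV. \<Sum>k\<in>UNIV. \<Sum>l\<in>UNIV. G $ l $ k * (Y $ i * (e k \<bullet> d i l)))
        = (\<Sum>l\<in>UNIV. \<Sum>k\<in>UNIV. \<Sum>i\<in>UNIV. G $ l $ k * (Y $ i * (e k \<bullet> d i l)))"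
      by (subst (2) sum.swap, subst sum.swap, subst (2) sum.swap) simp
    then show ?thesis by (simp add: T_def sum_distrib_left dsym)
  qed
  finally have "(\<Sum>i\<in>UNIV. Y $ i * pderiv_in S i w x) = w x * T" .
  then have "(\<Sum>i\<in>UNIV. DY i i) * w x + (\<Sum>i\<in>UNIV. Y $ i * pderiv_in S i w x) = (CARD('n) - T) * w x + w x * T"
    using divY by simp
  then show ?thesis by (simp add: Y_def DY_def algebra_simps)
qed

lemma divergence_flux:
  fixes \<eta> :: "real ^ 'n \<Rightarrow> real"
  assumes x: "x \<in> S" and \<eta>: "C1_on S \<eta>"
  shows "(\<Sum>i\<in>UNIV. pderiv_in S i (\<lambda>x. \<eta> x * (vf x $ i * w x)) x)
    = w x * ((\<Sum>i\<in>UNIV. vf x $ i * pderiv_in S i \<eta> x) + CARD('n) * \<eta> x)"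
proof -
  note pd = S x UNIV_I
  note diff = C1_on_differentiable[OF _ x]
  have "(\<Sum>i\<in>UNIV. pderiv_in S i (\<lambda>x. \<eta> x * (vf x $ i * w x)) x)
    = (\<Sum>i\<in>UNIV. \<eta> x * (vf x $ i * pderiv_in S i w x + pderiv_in S i (\<lambda>x. vf x $ i) x * w x) + pderiv_in S i \<eta> x * (vf x $ i * w x))"
    unfolding pderiv_in_mult[OF pd diff[OF \<eta>] diff[OF C1_on_mult[OF C1_vf C1_w]]]
      pderiv_in_mult[OF pd diff[OF C1_vf] diff[OF C1_w]] ..
  also have "\<dots> = \<eta> x * ((\<Sum>i\<in>UNIV. pderiv_in S i (\<lambda>x. vf x $ i) x) * w x + (\<Sum>i\<in>UNIV. vf x $ i * pderiv_in S i w x))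
      + w x * (\<Sum>i\<in>UNIV. vf x $ i * pderiv_in S i \<eta> x)"
    by (simp add: sum.distrib algebra_simps sum_distrib_left sum_distrib_right)
  finally show ?thesis unfolding divergence_vf[OF x] by (simp add: algebra_simps)
qed

text \<open>Summed over the directions, \<open>integral_pderiv_half_space\<close> leaves only the
  component across the face. The minus sign is there because that coordinate grows inwards.\<close>

lemma local_divergence_theorem:
  fixes \<eta> :: "real ^ 'n \<Rightarrow> real"
  assumes \<eta>: "C1_on S \<eta>" and K: "compact K" "K \<subseteq> S" and \<eta>0: "\<And>x. x \<in> S - K \<Longrightarrow> \<eta> x = 0"
  shows "(\<integral>x. w x * ((\<Sum>i\<in>UNIV. vf x $ i * pderiv_in S i \<eta> x) + CARD('n) * \<eta> x) * indicator S x \<partial>lborel)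
    = - (\<integral>y. \<eta> y * (vf y $ bdry_index * w y) * indicator S y \<partial>coord_lborel (UNIV - {bdry_index}))"
proof -
  define F where "F i x = \<eta> x * (vf x $ i * w x)" for i x
  have F: "C1_on S (F i)" "\<And>x. x \<in> S - K \<Longrightarrow> F i x = 0" for i
    unfolding F_def using \<eta>0 by (auto intro!: C1_on_mult \<eta> C1_vf C1_w)
  have "(\<integral>x. w x * ((\<Sum>i\<in>UNIV. vf x $ i * pderiv_in S i \<eta> x) + CARD('n) * \<eta> x) * indicator S x \<partial>lborel)
    = (\<integral>x. (\<Sum>i\<in>UNIV. pderiv_in S i (F i) x * indicator S x) \<partial>lborel)"
    by (intro Bochner_Integration.integral_cong refl)
      (simp add: sum_distrib_right[symmetric] F_def[abs_def] indicator_def divergence_flux[OF _ \<eta>])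
  also have "\<dots> = (\<Sum>i\<in>UNIV. \<integral>x. pderiv_in S i (F i) x * indicator S x \<partial>lborel)"
    by (intro Bochner_Integration.integral_sum integral_pderiv_half_space(2)[OF S K F])
  also have "\<dots> = (\<Sum>i\<in>UNIV. if i = bdry_index then - (\<integral>y. F i y * indicator S y \<partial>coord_lborel (UNIV - {bdry_index})) else 0)"
    by (intro sum.cong refl integral_pderiv_half_space(1)[OF S K F])
  finally show ?thesis by (simp add: F_def)
qed

end


section \<open>The tangential position field on the manifold and partitions of unity\<close>

text \<open>Squaring removes the corner of the positive part at 0. The result is of class C1, and it
  serves both the bump functions and the truncation in the maximum principle.\<close>

lemma has_real_derivative_pos_part_squared:
  "((\<lambda>s. (max 0 s)\<^sup>2) has_real_derivative 2 * max 0 s) (at s)" for s :: real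
proof (cases "s = 0")
  case True
  have "((\<lambda>h. ((max 0 (0 + h))\<^sup>2 - (max 0 0)\<^sup>2) / h) \<longlongrightarrow> (0::real)) (at 0)"
  proof (rule Lim_null_comparison[where g = "\<lambda>h::real. \<bar>h\<bar>"])
    show "\<forall>\<^sub>F h in at 0. norm (((max 0 (0 + h))\<^sup>2 - (max 0 0)\<^sup>2) / h) \<le> \<bar>h::real\<bar>"
      by (rule always_eventually) (auto simp: max_def power2_eq_square)
    show "((\<lambda>h::real. \<bar>h\<bar>) \<longlongrightarrow> 0) (at 0)"
      by (intro tendsto_eq_intros) auto
  qed
  then show ?thesis using True by (simp add: DERIV_def)
next
  case False
  then consider "s > 0" | "s < 0" by linarith
  then show ?thesis
  proof cases
    case 1
    have "((\<lambda>s. s\<^sup>2) has_real_derivative 2 * max 0 s) (at s)"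
      using 1 by (auto intro!: derivative_eq_intros)
    then show ?thesis
      by (rule has_field_derivative_transform_within_open[where S = "{0<..}"]) (use 1 in auto)
  next
    case 2
    have "((\<lambda>s. 0) has_real_derivative 2 * max 0 s) (at s)"
      using 2 by (auto intro!: derivative_eq_intros)
    then show ?thesis
      by (rule has_field_derivative_transform_within_open[where S = "{..<0}"]) (use 2 in auto)
  qed
qed

lemma pderiv_in_openin_subset:
  assumes "openin (top_of_set S) U" "x \<in> U"
  shows "pderiv_in U i f x = pderiv_in S i f x"
  unfolding pderiv_in_def at_within_model_eq[OF assms] ..

lemma C1_on_local:
  fixes f :: "real ^ 'n::finite \<Rightarrow> 'w::real_normed_vector"
  assumes S: "openin (top_of_set (model UNIV)) S"
    and U: "\<And>x. x \<in> S \<Longrightarrow> \<exists>U. openin (top_of_set (model UNIV)) U \<and> x \<in> U \<and> U \<subseteq> S \<and> C1_on U f"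
  shows "C1_on S f"
proof (rule C1_onI_pderiv_in[OF S])
  fix x assume "x \<in> S"
  then obtain U where U: "openin (top_of_set (model UNIV)) U" "x \<in> U" "U \<subseteq> S" "C1_on U f" using U by blast
  have US: "openin (top_of_set S) U" using U S by (meson openin_imp_subset openin_subset_trans)
  show "f differentiable (at x within S)"
    using C1_on_differentiable[OF U(4,2)] at_within_model_eq[OF US U(2)] by simp
next
  fix i
  show "continuous_on S (pderiv_in S i f)"
    unfolding continuous_on_eq_continuous_within
  proof
    fix x assume "x \<in> S"
    then obtain U where U: "openin (top_of_set (model UNIV)) U" "x \<in> U" "U \<subseteq> S" "C1_on U f" using U by blast
    have US: "openin (top_of_set S) U" using U S by (meson openin_imp_subset openin_subset_trans)
    have "continuous_on U (pderiv_in U i f)" by (rule C1_on_pderiv_in_continuous[OF U(1) _ U(4)]) simp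
    then have "continuous_on U (pderiv_in S i f)"
      by (rule continuous_on_eq) (rule pderiv_in_openin_subset[OF US])
    then show "continuous (at x within S) (pderiv_in S i f)"
      unfolding at_within_model_eq[OF US U(2), symmetric] continuous_on_eq_continuous_within using U(2) by blast
  qed
qed

lemma openin_Diff_compact:
  fixes M :: "'a::t2_space set"
  shows "compact Z \<Longrightarrow> openin (top_of_set M) (M - Z)"
  using openin_open_Int[of "- Z" M] by (simp add: compact_imp_closed Diff_eq open_Compl)

section \<open>The tangential position field as a derivation\<close>

locale minimal_hypersurface =
  fixes M :: "'a::{t2_space,second_countable_topology} set" and A :: "('a, 'n::finite) chart set"
    and \<psi> N :: "'a \<Rightarrow> real ^ 'm::finite" and z :: "real ^ 'm" and \<rho> :: real
  assumes card: "CARD('m) = CARD('n) + 1"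
    and \<rho>_pos: "\<rho> > 0"
    and manifold: "smooth_manifold UNIV M A"
    and compact_M: "compact M"
    and immersed: "immersion UNIV A \<psi>"
    and unit_normal: "unit_normal_field A \<psi> N"
    and minimal: "minimal A \<psi> N"
    and boundary_in_sphere: "p \<in> mfd_boundary A \<Longrightarrow> norm (\<psi> p - z) = \<rho>"
begin

lemma chart: "c \<in> A \<Longrightarrow> is_chart UNIV M c"
  and cover: "\<Union> (fst ` A) = M"
  and transition_smooth: "c \<in> A \<Longrightarrow> d \<in> A \<Longrightarrow> smooth_on (snd c ` (fst c \<inter> fst d)) (transition c d)"
  using manifold by (auto simp: smooth_manifold_def)

lemma openin_chart_image: "c \<in> A \<Longrightarrow> openin (top_of_set (model UNIV)) (chart_image c)"
  using is_chartD(2)[OF chart] .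

lemma openin_overlap: "c \<in> A \<Longrightarrow> d \<in> A \<Longrightarrow> openin (top_of_set (model UNIV)) (snd c ` (fst c \<inter> fst d))"
  using openin_chart_image_Int[OF chart is_chartD(1)[OF chart]] .

lemma smooth_immersion: "c \<in> A \<Longrightarrow> smooth_on (chart_image c) (\<psi> \<circ> chart_inv c)"
  using immersed by (simp add: immersion_def smooth_fun_def)

lemma patch: "c \<in> A \<Longrightarrow> minimal_patch (chart_image c) (\<psi> \<circ> chart_inv c) (N \<circ> chart_inv c)"
proof
  assume c: "c \<in> A"
  let ?S = "chart_image c" and ?f = "\<psi> \<circ> chart_inv c"
  show "openin (top_of_set (model UNIV)) ?S" by (rule openin_chart_image[OF c])
  show sm: "smooth_on ?S ?f" by (rule smooth_immersion[OF c])
  show "CARD('m) = CARD('n) + 1" by (rule card)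
  fix x assume x: "x \<in> ?S"
  note p = chart_inv_in[OF chart[OF c] x] chart_apply_inv[OF chart[OF c] x]
  show "norm ((N \<circ> chart_inv c) x) = 1"
    using unit_normal c p unfolding unit_normal_field_def by auto
  show "pderiv_in ?S i ?f x \<bullet> (N \<circ> chart_inv c) x = 0" for i
    using unit_normal c p unfolding unit_normal_field_def by (metis comp_apply)
  have "mean_curvature c \<psi> N (chart_inv c x) = 0"
    using minimal c p by (simp add: minimal_def)
  then show "trace (matrix_inv (\<chi> i j. pderiv_in ?S i ?f x \<bullet> pderiv_in ?S j ?f x) **
      (\<chi> i j. pderiv_in ?S i (pderiv_in ?S j ?f) x \<bullet> (N \<circ> chart_inv c) x)) = 0"
    using p by (simp add: mean_curvature_def metric_matrix_def second_fundamental_matrix_def)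
  show "v = 0" if v: "(\<Sum>i\<in>UNIV. v $ i *\<^sub>R pderiv_in ?S i ?f x) = 0" for v
  proof -
    let ?D = "frechet_derivative ?f (at x within ?S)"
    have D: "(?f has_derivative ?D) (at x within ?S)"
      using smooth_on_differentiable[OF sm x] frechet_derivative_works by blast
    have "?D v = 0"
      using has_derivative_coord_space_eq_sum[OF openin_chart_image[OF c] x D, of v] v by simp
    moreover have "?D 0 = 0" using has_derivative_bounded_linear[OF D] by (simp add: linear_simps)
    moreover have "inj ?D" using immersed c x by (simp add: immersion_def)
    ultimately show "v = 0" by (metis injD)
  qed
qed

abbreviation partial :: "('a, 'n) chart \<Rightarrow> real ^ 'n \<Rightarrow> 'n \<Rightarrow> real ^ 'm" where
  "partial c \<equiv> minimal_patch.partial (chart_image c) (\<psi> \<circ> chart_inv c)"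

abbreviation vf :: "('a, 'n) chart \<Rightarrow> real ^ 'n \<Rightarrow> real ^ 'n" where
  "vf c \<equiv> minimal_patch.vf (chart_image c) (\<psi> \<circ> chart_inv c) z"

abbreviation w :: "('a, 'n) chart \<Rightarrow> real ^ 'n \<Rightarrow> real" where
  "w c \<equiv> minimal_patch.w (chart_image c) (\<psi> \<circ> chart_inv c)"

lemma partial_eq: "c \<in> A \<Longrightarrow> partial c x i = pderiv_in (chart_image c) i (\<psi> \<circ> chart_inv c) x"
  using minimal_patch.partial_def[OF patch] .

definition C1_fun :: "('a \<Rightarrow> real) \<Rightarrow> bool" where
  "C1_fun u \<longleftrightarrow> (\<forall>c\<in>A. C1_on (chart_image c) (u \<circ> chart_inv c))"

lemma C1_funD: "C1_fun u \<Longrightarrow> c \<in> A \<Longrightarrow> C1_on (chart_image c) (u \<circ> chart_inv c)"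
  by (simp add: C1_fun_def)

lemma C1_fun_mult: "C1_fun u \<Longrightarrow> C1_fun v \<Longrightarrow> C1_fun (\<lambda>p. u p * v p)"
  using C1_on_mult unfolding C1_fun_def comp_def by blast

lemma C1_fun_sum: "(\<And>k. k \<in> K \<Longrightarrow> C1_fun (u k)) \<Longrightarrow> C1_fun (\<lambda>p. \<Sum>k\<in>K. u k p)"
  unfolding C1_fun_def comp_def by (intro ballI C1_on_sum) blast

lemma C1_fun_const: "C1_fun (\<lambda>_. a)"
  by (simp add: C1_fun_def comp_def C1_on_const)

lemma chart_image_in_M: "c \<in> A \<Longrightarrow> x \<in> chart_image c \<Longrightarrow> chart_inv c x \<in> M"
  using chart_inv_in[OF chart] is_chartD(4)[OF chart] by blast

lemma continuous_on_M:
  assumes "\<And>c. c \<in> A \<Longrightarrow> continuous_on (chart_image c) (u \<circ> chart_inv c)"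
  shows "continuous_on M u"
  unfolding continuous_on_eq_continuous_within
proof
  fix p assume "p \<in> M"
  then obtain c where c: "c \<in> A" "p \<in> fst c" using cover by auto
  have "continuous_on (fst c) (snd c)" "snd c ` fst c \<subseteq> chart_image c"
    using is_chartD(3)[OF chart[OF c(1)]] by (auto simp: homeomorphism_def)
  then have "continuous_on (fst c) (\<lambda>q. (u \<circ> chart_inv c) (snd c q))"
    by (intro continuous_on_compose2[OF assms[OF c(1)]])
  then have "continuous_on (fst c) u"
    by (rule continuous_on_eq) (simp add: chart_inv_apply[OF chart[OF c(1)]])
  then show "continuous (at p within M) u"
    unfolding at_within_model_eq[OF is_chartD(1)[OF chart[OF c(1)]] c(2), symmetric]
      continuous_on_eq_continuous_within using c(2) by blast
qed

lemma C1_fun_continuous: "C1_fun u \<Longrightarrow> continuous_on M u"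
  by (rule continuous_on_M) (rule C1_on_continuous_on[OF C1_funD])

text \<open>The derivative of \<open>u\<close> along the tangential part of
  \<open>\<psi> - z\<close>. The field is handled only through this action on functions, which
  spares tangent vectors of the abstract manifold.\<close>

definition chart_deriv :: "('a, 'n) chart \<Rightarrow> ('a \<Rightarrow> real) \<Rightarrow> 'a \<Rightarrow> real" where
  "chart_deriv c u p = (\<Sum>i\<in>UNIV. vf c (snd c p) $ i * pderiv_in (chart_image c) i (u \<circ> chart_inv c) (snd c p))"

text \<open>The right-hand side mentions no chart, so it allows the coordinates of the field in two
  charts to be compared in the surrounding space.\<close>

lemma tangential_part:
  assumes c: "c \<in> A" and p: "p \<in> fst c"
  shows "(\<Sum>i\<in>UNIV. vf c (snd c p) $ i *\<^sub>R partial c (snd c p) i) = (\<psi> p - z) - ((\<psi> p - z) \<bullet> N p) *\<^sub>R N p"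
proof -
  interpret P: minimal_patch "chart_image c" "\<psi> \<circ> chart_inv c" "N \<circ> chart_inv c" z by (rule patch[OF c])
  have x: "snd c p \<in> chart_image c" "chart_inv c (snd c p) = p"
    using p chart_inv_apply[OF chart[OF c] p] by (auto simp: chart_image_def)
  show ?thesis
    using hypersurface_frame.decomposition[OF P.frame[OF x(1)], of "\<psi> p - z"] x
    by (simp add: P.vf_def algebra_simps)
qed

text \<open>By \<open>tangential_part\<close> the coordinates in both charts describe the same
  vector, and the partials of the immersion are independent. Hence \<open>v\<close>, the discrepancy
  after transport by the Jacobian, is 0, and the chain rule for \<open>u\<close> does the
  rest.\<close>

lemma chart_deriv_indep:
  assumes c: "c \<in> A" and d: "d \<in> A" and p: "p \<in> fst c" "p \<in> fst d" and u: "C1_fun u"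
  shows "chart_deriv c u p = chart_deriv d u p"
proof -
  let ?x = "snd c p" and ?y = "snd d p"
  have p': "p \<in> fst c \<inter> fst d" using p by simp
  have x: "?x \<in> snd c ` (fst c \<inter> fst d)" "?x \<in> chart_image c" "?y \<in> chart_image d" using p by (auto simp: chart_image_def)
  obtain T' where T': "(transition c d has_derivative T') (at ?x within snd c ` (fst c \<inter> fst d))"
    using smooth_on_differentiable[OF transition_smooth[OF c d] x(1)] by (auto simp: differentiable_def)
  have e: "partial c ?x i = (\<Sum>k\<in>UNIV. T' (axis i 1) $ k *\<^sub>R partial d ?y k)" for i
    unfolding partial_eq[OF c] partial_eq[OF d]
    by (rule overlap_differentiable_chain(1)[OF chart[OF c] chart[OF d] p' T'])
      (auto intro: smooth_on_differentiable[OF smooth_immersion] c d x)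
  have du: "pderiv_in (chart_image c) i (u \<circ> chart_inv c) ?x = (\<Sum>k\<in>UNIV. T' (axis i 1) $ k * pderiv_in (chart_image d) k (u \<circ> chart_inv d) ?y)" for i
    by (subst overlap_differentiable_chain(1)[OF chart[OF c] chart[OF d] p' T'])
      (auto intro: C1_on_differentiable[OF C1_funD[OF u]] c d x)
  define v :: "real ^ 'n" where "v = (\<chi> k. (\<Sum>i\<in>UNIV. vf c ?x $ i * T' (axis i 1) $ k) - vf d ?y $ k)"
  have "(\<Sum>i\<in>UNIV. vf c ?x $ i *\<^sub>R partial c ?x i) = (\<Sum>k\<in>UNIV. (\<Sum>i\<in>UNIV. vf c ?x $ i * T' (axis i 1) $ k) *\<^sub>R partial d ?y k)"
    unfolding e by (simp add: scaleR_sum_right scaleR_sum_left) (rule sum.swap)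
  then have "(\<Sum>k\<in>UNIV. v $ k *\<^sub>R partial d ?y k) = 0"
    using tangential_part[OF c p(1)] tangential_part[OF d p(2)]
    by (simp add: v_def scaleR_diff_left sum_subtractf)
  then have "v = 0"
    using minimal_patch.independent_partials[OF patch[OF d] x(3)] partial_eq[OF d] by simp
  then have vd: "vf d ?y $ k = (\<Sum>i\<in>UNIV. vf c ?x $ i * T' (axis i 1) $ k)" for k
    by (simp add: v_def vec_eq_iff)
  have "chart_deriv c u p = (\<Sum>k\<in>UNIV. (\<Sum>i\<in>UNIV. vf c ?x $ i * T' (axis i 1) $ k) * pderiv_in (chart_image d) k (u \<circ> chart_inv d) ?y)"
    unfolding chart_deriv_def du by (simp add: sum_distrib_left sum_distrib_right mult.assoc) (rule sum.swap)
  then show ?thesis by (simp add: chart_deriv_def vd)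
qed

definition chart_at :: "'a \<Rightarrow> ('a, 'n) chart" where
  "chart_at p = (SOME c. c \<in> A \<and> p \<in> fst c)"

lemma chart_at:
  assumes "p \<in> M" shows "chart_at p \<in> A \<and> p \<in> fst (chart_at p)"
proof -
  have "\<exists>c. c \<in> A \<and> p \<in> fst c" using assms cover by auto
  then show ?thesis unfolding chart_at_def by (rule someI_ex)
qed

definition X :: "('a \<Rightarrow> real) \<Rightarrow> 'a \<Rightarrow> real" where
  "X u p = chart_deriv (chart_at p) u p"

lemma X_eq: "c \<in> A \<Longrightarrow> p \<in> fst c \<Longrightarrow> C1_fun u \<Longrightarrow> X u p = chart_deriv c u p"
  unfolding X_def using chart_at[of p] is_chartD(4)[OF chart, of c] by (intro chart_deriv_indep) auto

lemma X_chart_inv: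
  "c \<in> A \<Longrightarrow> x \<in> chart_image c \<Longrightarrow> C1_fun u \<Longrightarrow>
    X u (chart_inv c x) = (\<Sum>i\<in>UNIV. vf c x $ i * pderiv_in (chart_image c) i (u \<circ> chart_inv c) x)"
  using X_eq[of c "chart_inv c x" u] chart_inv_in[OF chart] chart_apply_inv[OF chart]
  by (simp add: chart_deriv_def)

lemma X_continuous: 
  assumes u: "C1_fun u" shows "continuous_on M (X u)"
proof (rule continuous_on_M)
  fix c assume c: "c \<in> A"
  have "continuous_on (chart_image c) (\<lambda>x. \<Sum>i\<in>UNIV. vf c x $ i * pderiv_in (chart_image c) i (u \<circ> chart_inv c) x)"
    by (intro continuous_on_sum continuous_on_mult C1_on_continuous_on[OF minimal_patch.C1_vf[OF patch[OF c]]]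
        C1_on_pderiv_in_continuous[OF openin_chart_image[OF c] _ C1_funD[OF u c]]) simp
  then show "continuous_on (chart_image c) (X u \<circ> chart_inv c)"
    by (rule continuous_on_eq) (simp add: X_chart_inv[OF c _ u])
qed

lemma X_zero_off_support:
  assumes u: "C1_fun u" and Z: "compact Z" and u0: "\<And>q. q \<in> M \<Longrightarrow> q \<notin> Z \<Longrightarrow> u q = 0"
    and p: "p \<in> M" "p \<notin> Z"
  shows "X u p = 0"
proof -
  define c where "c = chart_at p"
  have c: "c \<in> A" "p \<in> fst c" using chart_at[OF p(1)] by (auto simp: c_def)
  note o = openin_Diff_compact[OF Z, of M]
  let ?U = "snd c ` (fst c \<inter> (M - Z))"
  have U: "openin (top_of_set (model UNIV)) ?U" by (rule openin_chart_image_Int[OF chart[OF c(1)] o])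
  have xU: "snd c p \<in> ?U" using c p by auto
  have USc: "?U \<subseteq> chart_image c" by (auto simp: chart_image_def)
  have US: "openin (top_of_set (chart_image c)) ?U"
    using U openin_chart_image[OF c(1)] USc by (meson openin_imp_subset openin_subset_trans)
  have "(u \<circ> chart_inv c) y = 0" if "y \<in> ?U" for y
    using that u0 chart_inv_apply[OF chart[OF c(1)]] by auto
  then have D: "((u \<circ> chart_inv c) has_derivative (\<lambda>_. 0)) (at (snd c p) within ?U)"
    by (intro has_derivative_transform[OF xU _ has_derivative_const[of 0]]) simp
  have "pderiv_in (chart_image c) i (u \<circ> chart_inv c) (snd c p) = 0" for i
    using pderiv_in_eq[OF U xU UNIV_I D, of i] unfolding pderiv_in_openin_subset[OF US xU] .
  then show ?thesis using X_eq[OF c u] by (simp add: chart_deriv_def)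
qed

lemma X_sum:
  assumes u: "\<And>k. k \<in> K \<Longrightarrow> C1_fun (u k)" and v: "\<And>q. q \<in> M \<Longrightarrow> v q = (\<Sum>k\<in>K. u k q)" and p: "p \<in> M"
  shows "X v p = (\<Sum>k\<in>K. X (u k) p)"
proof -
  define c where "c = chart_at p"
  have c: "c \<in> A" "p \<in> fst c" using chart_at[OF p(1)] by (auto simp: c_def)
  have x: "snd c p \<in> chart_image c" using c by (simp add: chart_image_def)
  note pd = openin_chart_image[OF c(1)] x UNIV_I
  have "pderiv_in (chart_image c) i (v \<circ> chart_inv c) (snd c p)
    = pderiv_in (chart_image c) i (\<lambda>y. \<Sum>k\<in>K. (u k \<circ> chart_inv c) y) (snd c p)" for i
  proof (rule pderiv_in_cong[OF pd, symmetric])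
    show "(\<lambda>y. \<Sum>k\<in>K. (u k \<circ> chart_inv c) y) differentiable (at (snd c p) within chart_image c)"
      by (intro C1_on_differentiable[OF C1_on_sum x] C1_funD[OF u c(1)])
  qed (simp add: v chart_image_in_M[OF c(1)])
  also have "\<dots> i = (\<Sum>k\<in>K. pderiv_in (chart_image c) i (u k \<circ> chart_inv c) (snd c p))" for i
    by (intro pderiv_in_sum[OF pd] C1_on_differentiable[OF C1_funD[OF u c(1)] x])
  finally have "X v p = (\<Sum>i\<in>UNIV. vf c (snd c p) $ i * (\<Sum>k\<in>K. pderiv_in (chart_image c) i (u k \<circ> chart_inv c) (snd c p)))"
    by (simp add: X_def c_def chart_deriv_def)
  also have "\<dots> = (\<Sum>k\<in>K. X (u k) p)"
    by (simp add: X_def c_def chart_deriv_def sum_distrib_left) (rule sum.swap)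
  finally show ?thesis .
qed

section \<open>Partitions of unity\<close>

text \<open>The squared positive part of \<open>r\<^sup>2\<close> minus the squared distance in a
  chart, extended by 0. In another chart it is C1 on the overlap through the transition. Elsewhere
  it vanishes near the point, because the compact set \<open>Z\<close> carrying it is closed in a
  Hausdorff space.\<close>

lemma bump_exists:
  assumes p: "p \<in> M"
  shows "\<exists>c K \<phi> U. c \<in> A \<and> compact K \<and> K \<subseteq> chart_image c \<and> C1_fun \<phi> \<and> (\<forall>q\<in>M. 0 \<le> \<phi> q) \<and>
    (\<forall>q\<in>M. q \<notin> chart_inv c ` K \<longrightarrow> \<phi> q = 0) \<and> openin (top_of_set M) U \<and> p \<in> U \<and> (\<forall>q\<in>U. \<phi> q > 0)"
proof -
  obtain c where c: "c \<in> A" "p \<in> fst c" using cover p by auto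
  note ch = chart[OF c(1)]
  define y where "y = snd c p"
  have y: "y \<in> chart_image c" using c by (simp add: y_def chart_image_def)
  obtain r where r: "r > 0" "cball y r \<inter> model UNIV \<subseteq> chart_image c"
    using openin_chart_image[OF c(1)] y unfolding openin_contains_cball by blast
  define K where "K = cball y r \<inter> model UNIV"
  have K: "compact K" "K \<subseteq> chart_image c" using r by (auto simp: K_def closed_model compact_Int_closed)
  define h where "h x = (max 0 (r\<^sup>2 - (x - y) \<bullet> (x - y)))\<^sup>2" for x
  define \<phi> where "\<phi> q = (if q \<in> fst c then h (snd c q) else 0)" for q
  define U where "U = fst c \<inter> snd c -` ball y r"
  define Z where "Z = chart_inv c ` K"
  have Z: "compact Z" unfolding Z_def
    using is_chartD(3)[OF ch] K by (intro compact_continuous_image) (auto simp: homeomorphism_def intro: continuous_on_subset)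
  have Zc: "Z \<subseteq> fst c" using K(2) chart_inv_in[OF ch] by (auto simp: Z_def)
  have h0: "h x = 0" if "x \<in> model UNIV" "x \<notin> K" for x
  proof -
    have "dist y x > r" using that by (auto simp: K_def)
    then have "r\<^sup>2 \<le> (dist y x)\<^sup>2" using r(1) by (intro power_mono) auto
    then show ?thesis by (simp add: h_def power2_norm_eq_inner[symmetric] dist_norm norm_minus_commute)
  qed
  have off: "\<phi> q = 0" if "q \<notin> Z" for q
  proof (cases "q \<in> fst c")
    case True
    have "snd c q \<notin> K" using that chart_inv_apply[OF ch True] by (auto simp: Z_def image_iff)
    moreover have "snd c q \<in> model UNIV" using True is_chartD(5)[OF ch] by (auto simp: chart_image_def)
    ultimately show ?thesis using h0 by (simp add: \<phi>_def)
  qed (simp add: \<phi>_def)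
  have "C1_fun \<phi>"
    unfolding C1_fun_def
  proof
    fix d assume d: "d \<in> A"
    note dh = chart[OF d]
    show "C1_on (chart_image d) (\<phi> \<circ> chart_inv d)"
    proof (rule C1_on_local[OF openin_chart_image[OF d]])
      fix x assume x: "x \<in> chart_image d"
      show "\<exists>U. openin (top_of_set (model UNIV)) U \<and> x \<in> U \<and> U \<subseteq> chart_image d \<and> C1_on U (\<phi> \<circ> chart_inv d)"
      proof (cases "chart_inv d x \<in> fst c")
        case True
        let ?V = "snd d ` (fst d \<inter> fst c)"
        have T: "C1_on ?V (transition d c)"
          by (rule smooth_on_C1_on[OF openin_overlap[OF d c(1)] transition_smooth[OF d c(1)]])
        have "C1_on ?V (\<lambda>x. transition d c x + - y)" by (intro C1_on_add T C1_on_const)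
        then have Ty: "C1_on ?V (\<lambda>x. transition d c x - y)" by simp
        have "C1_on ?V (\<lambda>x. r\<^sup>2 + (- 1) * ((transition d c x - y) \<bullet> (transition d c x - y)))"
          by (intro C1_on_add C1_on_mult C1_on_const C1_on_inner Ty)
        then have "C1_on ?V (\<lambda>x. r\<^sup>2 - (transition d c x - y) \<bullet> (transition d c x - y))" by simp
        then have "C1_on ?V (\<lambda>x. h (transition d c x))"
          unfolding h_def
          by (rule C1_on_compose_real[where \<phi>' = "\<lambda>s. 2 * max 0 s"])
            (intro has_real_derivative_pos_part_squared continuous_intros)+
        then have "C1_on ?V (\<phi> \<circ> chart_inv d)"
        proof (rule C1_on_cong)
          fix x assume "x \<in> ?V"
          then obtain q where "q \<in> fst d" "q \<in> fst c" "x = snd d q" by auto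
          then show "h (transition d c x) = (\<phi> \<circ> chart_inv d) x"
            by (simp add: \<phi>_def transition_def chart_inv_apply[OF dh])
        qed
        moreover have "x \<in> ?V" using True x chart_inv_in[OF dh x] chart_apply_inv[OF dh x] by (metis IntI image_eqI)
        moreover have "?V \<subseteq> chart_image d" by (auto simp: chart_image_def)
        ultimately show ?thesis using openin_overlap[OF d c(1)] by blast
      next
        case False
        let ?V = "snd d ` (fst d \<inter> (M - Z))"
        note o = openin_Diff_compact[OF Z, of M]
        have "C1_on ?V (\<phi> \<circ> chart_inv d)"
          by (rule C1_on_cong[OF C1_on_const[of _ 0]]) (auto simp: chart_inv_apply[OF dh] off)
        moreover have "chart_inv d x \<in> fst d \<inter> (M - Z)"
          using False Zc chart_inv_in[OF dh x] is_chartD(4)[OF dh] by blast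
        then have "x \<in> ?V" using chart_apply_inv[OF dh x] by (metis image_eqI)
        moreover have "?V \<subseteq> chart_image d" by (auto simp: chart_image_def)
        ultimately show ?thesis using openin_chart_image_Int[OF dh o] by blast
      qed
    qed
  qed
  moreover have "openin (top_of_set M) U"
  proof -
    have "continuous_on (fst c) (snd c)" using is_chartD(3)[OF ch] by (simp add: homeomorphism_def)
    then have "openin (top_of_set (fst c)) U" unfolding U_def by (rule continuous_openin_preimage_gen) simp
    then show ?thesis using is_chartD(1)[OF ch] openin_trans by blast
  qed
  moreover have "p \<in> U" using c r(1) by (simp add: U_def y_def)
  moreover have "\<phi> q > 0" if "q \<in> U" for q
  proof -
    have "dist y (snd c q) < r" "q \<in> fst c" using that by (auto simp: U_def)
    then have "(dist y (snd c q))\<^sup>2 < r\<^sup>2" by (intro power_strict_mono) auto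
    then show ?thesis using \<open>q \<in> fst c\<close>
      by (simp add: \<phi>_def h_def power2_norm_eq_inner[symmetric] dist_norm norm_minus_commute)
  qed
  moreover have "0 \<le> \<phi> q" for q by (simp add: \<phi>_def h_def)
  ultimately show ?thesis using c(1) K off unfolding Z_def by blast
qed

text \<open>Finitely many bumps are positive somewhere at each point of the compact
  \<open>M\<close>, so they may be divided by their sum. The charts and compact sets stay part of
  the data because integrals are later evaluated there.\<close>

lemma partition_of_unity:
  obtains P :: "'a set" and c K \<theta> where "finite P" "\<And>p. p \<in> P \<Longrightarrow> c p \<in> A" "\<And>p. p \<in> P \<Longrightarrow> compact (K p)"
    "\<And>p. p \<in> P \<Longrightarrow> K p \<subseteq> chart_image (c p)" "\<And>p. p \<in> P \<Longrightarrow> C1_fun (\<theta> p)"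
    "\<And>p q. p \<in> P \<Longrightarrow> q \<in> M \<Longrightarrow> 0 \<le> \<theta> p q"
    "\<And>p q. p \<in> P \<Longrightarrow> q \<in> M \<Longrightarrow> q \<notin> chart_inv (c p) ` K p \<Longrightarrow> \<theta> p q = 0"
    "\<And>q. q \<in> M \<Longrightarrow> (\<Sum>p\<in>P. \<theta> p q) = 1"
proof -
  obtain c K \<phi> U where b: "\<And>p. p \<in> M \<Longrightarrow> c p \<in> A \<and> compact (K p) \<and> K p \<subseteq> chart_image (c p) \<and> C1_fun (\<phi> p) \<and> (\<forall>q\<in>M. 0 \<le> \<phi> p q) \<and>
    (\<forall>q\<in>M. q \<notin> chart_inv (c p) ` K p \<longrightarrow> \<phi> p q = 0) \<and> openin (top_of_set M) (U p) \<and> p \<in> U p \<and> (\<forall>q\<in>U p. \<phi> p q > 0)"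
    using bump_exists by metis
  have "\<forall>V\<in>U ` M. openin (top_of_set M) V" "M \<subseteq> \<Union> (U ` M)" using b by auto
  then obtain D where D: "D \<subseteq> U ` M" "finite D" "M \<subseteq> \<Union> D"
    using compact_M unfolding compact_eq_openin_cover by meson
  obtain P where P: "P \<subseteq> M" "finite P" "D = U ` P" using finite_subset_image[OF D(2,1)] by auto
  define F where "F q = (\<Sum>p\<in>P. \<phi> p q)" for q
  have F: "F q > 0" if "q \<in> M" for q
  proof -
    have "q \<in> \<Union> (U ` P)" using D(3) P(3) that by blast
    then obtain p where p: "p \<in> P" "q \<in> U p" by blast
    then have "0 < \<phi> p q" using b P(1) by auto
    also have "\<dots> \<le> F q" unfolding F_def using p P b that by (intro member_le_sum) auto
    finally show ?thesis .
  qed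
  define \<theta> where "\<theta> p q = \<phi> p q * inverse (F q)" for p q
  have "C1_fun F" unfolding F_def using P b by (intro C1_fun_sum) auto
  have "C1_fun (\<lambda>q. inverse (F q))"
    unfolding C1_fun_def comp_def
  proof
    fix d assume d: "d \<in> A"
    have Fd: "F (chart_inv d x) \<noteq> 0" if "x \<in> chart_image d" for x
      using F[OF chart_image_in_M[OF d that]] by simp
    show "C1_on (chart_image d) (\<lambda>x. inverse (F (chart_inv d x)))"
      by (rule C1_on_compose_real[where \<phi>' = "\<lambda>t. - (inverse t ^ Suc (Suc 0))", OF C1_funD[OF \<open>C1_fun F\<close> d, unfolded comp_def] DERIV_inverse])
        (use Fd in \<open>auto intro!: continuous_intros\<close>)
  qed
  then have "C1_fun (\<theta> p)" if "p \<in> P" for p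
    unfolding \<theta>_def using that P b by (intro C1_fun_mult) auto
  moreover have "(\<Sum>p\<in>P. \<theta> p q) = 1" if "q \<in> M" for q
    using F[OF that] by (simp add: \<theta>_def sum_distrib_right[symmetric] F_def[symmetric])
  moreover have "0 \<le> \<theta> p q" if "p \<in> P" "q \<in> M" for p q
    using F[OF that(2)] that b P by (auto simp: \<theta>_def)
  moreover have "\<theta> p q = 0" if "p \<in> P" "q \<in> M" "q \<notin> chart_inv (c p) ` K p" for p q
    using that b P by (auto simp: \<theta>_def)
  ultimately show ?thesis using that[of P c K \<theta>] P b by blast
qed

end


section \<open>The boundary atlas and the divergence theorem\<close>

lemma integrable_coord_lborel_compact_support:
  fixes h :: "real ^ 'n::finite \<Rightarrow> real"
  assumes S: "openin (top_of_set (model I)) S" and h: "continuous_on S h"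
    and K: "compact K" "K \<subseteq> S" and h0: "\<And>y. y \<in> S - K \<Longrightarrow> h y = 0"
  shows "integrable (coord_lborel I) (\<lambda>y. h y * indicator S y)"
proof -
  have "compact (h ` K)" using compact_continuous_image[OF continuous_on_subset[OF h K(2)] K(1)] .
  then obtain B where B: "\<And>y. y \<in> K \<Longrightarrow> norm (h y) \<le> B"
    using compact_imp_bounded[of "h ` K"] by (auto simp: bounded_iff)
  show ?thesis
  proof (rule integrableI_bounded_set[where A = K and B = B])
    show "K \<in> sets (coord_lborel I)" using compact_imp_closed[OF K(1)] by simp
    show "(\<lambda>y. h y * indicator S y) \<in> borel_measurable (coord_lborel I)"
      using continuous_on_imp_indicator_measurable[OF S h] by measurable
    show "emeasure (coord_lborel I) K < \<infinity>" by (rule emeasure_coord_lborel_bounded[OF compact_imp_bounded[OF K(1)]])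
    show "AE x\<in>K in coord_lborel I. norm (h x * indicator S x) \<le> B"
      using B K(2) by (intro AE_I2) (auto simp: indicator_def)
    show "AE x in coord_lborel I. x \<notin> K \<longrightarrow> h x * indicator S x = 0"
      using h0 by (intro AE_I2) (auto simp: indicator_def)
  qed
qed

text \<open>Each function of the partition has a finite integral, being continuous with compact
  support in one chart. Finiteness matters because \<open>vol\<close> is defined by
  \<open>measure\<close>, which would turn an infinite volume into 0.\<close>

lemma (in chart_cover) finite_volume:
  fixes \<theta> :: "'k \<Rightarrow> 'a \<Rightarrow> real" and cf :: "'k \<Rightarrow> ('a, 'n) chart"
  assumes P: "finite P" and cf: "\<And>p. p \<in> P \<Longrightarrow> cf p \<in> A"
    and K: "\<And>p. p \<in> P \<Longrightarrow> compact (K p)" "\<And>p. p \<in> P \<Longrightarrow> K p \<subseteq> chart_image (cf p)"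
    and \<theta>: "\<And>p. p \<in> P \<Longrightarrow> continuous_on M (\<theta> p)" "\<And>p q. p \<in> P \<Longrightarrow> q \<in> M \<Longrightarrow> 0 \<le> \<theta> p q"
    and supp: "\<And>p q. p \<in> P \<Longrightarrow> q \<in> M \<Longrightarrow> q \<notin> chart_inv (cf p) ` K p \<Longrightarrow> \<theta> p q = 0"
    and sum1: "\<And>q. q \<in> M \<Longrightarrow> (\<Sum>p\<in>P. \<theta> p q) = 1"
  shows "emeasure volume M < \<infinity>"
proof -
  have m: "\<theta> p \<in> borel_measurable (restrict_space borel M)" if "p \<in> P" for p
    by (rule borel_measurable_continuous_on_restrict[OF \<theta>(1)[OF that]])
  have fin: "(\<integral>\<^sup>+ q. ennreal (\<theta> p q) \<partial>volume) < \<infinity>" if p: "p \<in> P" for p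
  proof -
    let ?S = "chart_image (cf p)"
    note ch = chart[OF cf[OF p]]
    have Kf: "chart_inv (cf p) ` K p \<subseteq> fst (cf p)" using K(2)[OF p] chart_inv_in[OF ch] by auto
    have cont: "continuous_on ?S (\<lambda>x. \<theta> p (chart_inv (cf p) x))"
      using is_chartD(3,4)[OF ch] by (intro continuous_on_compose2[OF \<theta>(1)[OF p]]) (auto simp: homeomorphism_def)
    have supp': "\<theta> p (chart_inv (cf p) x) = 0" if "x \<in> ?S - K p" for x
    proof (rule supp[OF p])
      show "chart_inv (cf p) x \<in> M" using that chart_inv_in[OF ch] is_chartD(4)[OF ch] by blast
      show "chart_inv (cf p) x \<notin> chart_inv (cf p) ` K p"
        using chart_inv_in_image_iff[OF ch _ K(2)[OF p]] that by blast
    qed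
    have int: "integrable (coord_lborel I) (\<lambda>x. (vol_density (cf p) x * \<theta> p (chart_inv (cf p) x)) * indicator ?S x)"
      by (rule integrable_coord_lborel_compact_support[OF is_chartD(2)[OF ch] _ K(1)[OF p] K(2)[OF p]])
        (auto intro!: continuous_intros vol_density_continuous cf p cont simp: supp')
    have "(\<integral>\<^sup>+ q. ennreal (\<theta> p q) \<partial>volume)
      = (\<integral>\<^sup>+ x. ennreal (vol_density (cf p) x) * ennreal (\<theta> p (chart_inv (cf p) x)) * indicator ?S x \<partial>coord_lborel I)"
    proof (rule nn_integral_volume_chart[OF cf[OF p]])
      show "(\<lambda>q. ennreal (\<theta> p q)) \<in> borel_measurable (restrict_space borel M)" using m[OF p] by measurable
      show "ennreal (\<theta> p q) = 0" if "q \<in> M" "q \<notin> fst (cf p)" for q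
      proof -
        have "q \<notin> chart_inv (cf p) ` K p" using Kf that(2) by blast
        then show ?thesis using supp[OF p that(1)] by simp
      qed
    qed
    also have "\<dots> \<le> (\<integral>\<^sup>+ x. ennreal (norm ((vol_density (cf p) x * \<theta> p (chart_inv (cf p) x)) * indicator ?S x)) \<partial>coord_lborel I)"
      by (intro nn_integral_mono) (auto simp: indicator_def ennreal_mult'[symmetric] intro!: ennreal_leI)
    also have "\<dots> < \<infinity>" using int by (simp add: integrable_iff_bounded)
    finally show ?thesis .
  qed
  have "emeasure volume M = (\<integral>\<^sup>+ q. 1 \<partial>volume)" by simp
  also have "\<dots> = (\<integral>\<^sup>+ q. (\<Sum>p\<in>P. ennreal (\<theta> p q)) \<partial>volume)"
    using sum1 \<theta>(2) by (intro nn_integral_cong) (simp add: sum_ennreal)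
  also have "\<dots> = (\<Sum>p\<in>P. \<integral>\<^sup>+ q. ennreal (\<theta> p q) \<partial>volume)"
    using m by (intro nn_integral_sum) (simp add: measurable_cong_sets[OF sets_volume refl])
  also have "\<dots> < \<infinity>" using fin P by (simp add: ennreal_sum_less_top)
  finally show ?thesis .
qed

section \<open>Charts of the boundary\<close>

context minimal_hypersurface
begin

abbreviation bdry :: "'a set" where "bdry \<equiv> mfd_boundary A"

definition bchart :: "('a, 'n) chart \<Rightarrow> ('a, 'n) chart" where
  "bchart c = (fst c \<inter> bdry, snd c)"

lemma boundary_atlas_eq: "boundary_atlas A = bchart ` A"
  by (simp add: boundary_atlas_def bchart_def)

lemma bdry_subset: "bdry \<subseteq> M"
  using is_chartD(4)[OF chart] by (auto simp: mfd_boundary_def)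

text \<open>A transition that maps an interior point into the boundary has a component with a local minimum there,
  so its Jacobian matrix would be singular.\<close>

lemma boundary_iff:
  assumes c: "c \<in> A" and p: "p \<in> fst c"
  shows "p \<in> bdry \<longleftrightarrow> snd c p $ bdry_index = 0"
proof
  assume "p \<in> bdry"
  then obtain d where d: "d \<in> A" "p \<in> fst d" "snd d p $ bdry_index = 0"
    by (auto simp: mfd_boundary_def)
  show "snd c p $ bdry_index = 0"
  proof (rule ccontr)
    assume ne: "snd c p $ bdry_index \<noteq> 0"
    let ?D = "snd c ` (fst c \<inter> fst d)" and ?E = "snd d ` (fst d \<inter> fst c)"
    define T where "T = transition c d"
    define R where "R = transition d c"
    have y: "snd c p \<in> ?D" "snd d p \<in> ?E" using p d by auto
    have Tq: "T (snd c q) = snd d q" if "q \<in> fst c" for q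
      using chart_inv_apply[OF chart[OF c] that] by (simp add: T_def transition_def)
    have Rq: "R (snd d q) = snd c q" if "q \<in> fst d" for q
      using chart_inv_apply[OF chart[OF d(1)] that] by (simp add: R_def transition_def)
    obtain W where W: "open W" "?D = model UNIV \<inter> W"
      using openin_overlap[OF c d(1)] by (auto simp: openin_open)
    \<comment> \<open>Open in the whole space, so that the derivative of \<open>T\<close> at the
      interior point is an ordinary one and has to vanish at a minimum.\<close>
    define O' where "O' = W \<inter> {x. 0 < x $ bdry_index}"
    have O': "open O'" unfolding O'_def using W(1)
      by (intro open_Int open_Collect_less continuous_intros)
    have OD: "O' \<subseteq> ?D" using W(2) by (auto simp: O'_def model_def)
    have "0 \<le> snd c p $ bdry_index" using y(1) W(2) by (auto simp: model_def)
    then have yO: "snd c p \<in> O'" using ne y(1) W(2) by (auto simp: O'_def)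
    obtain T' where T': "(T has_derivative T') (at (snd c p) within ?D)"
      using smooth_on_differentiable[OF transition_smooth[OF c d(1)] y(1)] by (auto simp: differentiable_def T_def)
    have "(T has_derivative T') (at (snd c p))"
      using has_derivative_subset[OF T' OD] at_within_open[OF yO O'] by simp
    then have "((\<lambda>x. T x $ bdry_index) has_derivative (\<lambda>v. T' v $ bdry_index)) (at (snd c p))"
      by (rule bounded_linear.has_derivative[OF bounded_linear_vec_nth])
    then have zero: "(\<lambda>v. T' v $ bdry_index) = (\<lambda>v. 0)"
    proof (rule differential_zero_maxmin[OF yO O'])
      have "T (snd c p) $ bdry_index \<le> T x $ bdry_index" if xO: "x \<in> O'" for x
      proof -
        obtain q where q: "q \<in> fst c" "q \<in> fst d" "x = snd c q" using OD xO by blast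
        have "snd d q \<in> model UNIV" using chart_in_image[OF q(2)] is_chartD(5)[OF chart[OF d(1)]] by blast
        then show ?thesis using q Tq p d(3) by (simp add: model_def)
      qed
      then show "(\<forall>y\<in>O'. T y $ bdry_index \<le> T (snd c p) $ bdry_index) \<or> (\<forall>y\<in>O'. T (snd c p) $ bdry_index \<le> T y $ bdry_index)"
        by blast
    qed
    obtain R' where R': "(R has_derivative R') (at (snd d p) within ?E)"
      using smooth_on_differentiable[OF transition_smooth[OF d(1) c] y(2)] by (auto simp: differentiable_def R_def)
    have RE: "R ` ?E \<subseteq> ?D" using Rq by auto
    have "(T has_derivative T') (at (R (snd d p)) within R ` ?E)"
      using has_derivative_subset[OF T' RE] Rq[OF d(2)] by simp
    then have "((\<lambda>x. T (R x)) has_derivative (\<lambda>v. T' (R' v))) (at (snd d p) within ?E)"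
      by (rule has_derivative_in_compose[OF R'])
    then have "((\<lambda>x. x) has_derivative (\<lambda>v. T' (R' v))) (at (snd d p) within ?E)"
      by (rule has_derivative_transform[OF y(2), rotated]) (auto simp: Rq Tq)
    \<comment> \<open>\<open>R\<close> inverts \<open>T\<close>, so the range of \<open>T'\<close>
      contains the normal axis, whereas \<open>zero\<close> says that its normal component
      vanishes.\<close>
    then have "T' (R' (axis bdry_index 1)) = axis bdry_index 1"
      using has_derivative_within_axis_unique[OF openin_overlap[OF d(1) c] y(2) UNIV_I _ has_derivative_ident, of _ bdry_index] by simp
    then have "T' (R' (axis bdry_index 1)) $ bdry_index = 1" by simp
    then show False using fun_cong[OF zero, of "R' (axis bdry_index 1)"] by simp
  qed
qed (use c p in \<open>auto simp: mfd_boundary_def\<close>)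

lemma chart_image_bchart: "c \<in> A \<Longrightarrow> chart_image (bchart c) = chart_image c \<inter> {x. x $ bdry_index = 0}"
  using boundary_iff[of c] by (auto simp: chart_image_def bchart_def)

lemma chart_inv_bchart:
  assumes c: "c \<in> A" and x: "x \<in> chart_image (bchart c)"
  shows "chart_inv (bchart c) x = chart_inv c x"
proof -
  obtain q where q: "q \<in> fst c" "q \<in> bdry" "x = snd c q"
    using x by (auto simp: chart_image_def bchart_def)
  have inj: "inj_on (snd c) (fst c)" using chart_inv_apply[OF chart[OF c]] by (metis inj_onI)
  have "inv_into (fst c \<inter> bdry) (snd c) (snd c q) = q"
    by (rule inv_into_f_f) (use inj q in \<open>auto intro: inj_on_subset\<close>)
  then show ?thesis using q chart_inv_apply[OF chart[OF c] q(1)] by (simp add: chart_inv_def bchart_def)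
qed

lemma chart_inv_in_bdry: "c \<in> A \<Longrightarrow> x \<in> chart_image (bchart c) \<Longrightarrow> chart_inv c x \<in> bdry"
  using boundary_iff[of c "chart_inv c x"] chart_inv_in[OF chart] chart_apply_inv[OF chart]
  by (simp add: chart_image_bchart)

lemma model_bdry: "model (UNIV - {bdry_index}) = model UNIV \<inter> {x. x $ bdry_index = 0}"
  by (auto simp: model_def coord_space_def)

lemma is_chart_bchart:
  assumes c: "c \<in> A" shows "is_chart (UNIV - {bdry_index}) bdry (bchart c)"
  unfolding is_chart_def
proof (intro conjI)
  show "openin (top_of_set bdry) (fst (bchart c))"
    using is_chartD(1)[OF chart[OF c]] bdry_subset by (auto simp: openin_open bchart_def)
  obtain W where "open W" "chart_image c = model UNIV \<inter> W"
    using openin_chart_image[OF c] by (auto simp: openin_open)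
  then show "openin (top_of_set (model (UNIV - {bdry_index}))) (chart_image (bchart c))"
    unfolding chart_image_bchart[OF c] model_bdry by (auto simp: openin_open)
  have "homeomorphism (fst (bchart c)) (chart_image (bchart c)) (snd c) (chart_inv c)"
    by (rule homeomorphism_of_subsets[OF is_chartD(3)[OF chart[OF c]]])
      (auto simp: bchart_def chart_image_def)
  then show "homeomorphism (fst (bchart c)) (chart_image (bchart c)) (snd (bchart c)) (chart_inv (bchart c))"
    by (rule homeomorphism_cong) (simp_all add: bchart_def chart_inv_bchart[OF c, unfolded bchart_def])
qed

lemma bchart_has_derivative:
  assumes c: "c \<in> A" and x: "x \<in> chart_image (bchart c)"
    and f': "((\<psi> \<circ> chart_inv c) has_derivative f') (at x within chart_image c)"
  shows "((\<psi> \<circ> chart_inv (bchart c)) has_derivative f') (at x within chart_image (bchart c))"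
proof (rule has_derivative_transform[OF x])
  show "((\<psi> \<circ> chart_inv c) has_derivative f') (at x within chart_image (bchart c))"
    by (rule has_derivative_subset[OF f']) (simp add: chart_image_bchart[OF c])
qed (simp add: chart_inv_bchart[OF c])

lemma bchart_differentiable_partial:
  assumes c: "c \<in> A" and x: "x \<in> chart_image (bchart c)"
  shows "(\<psi> \<circ> chart_inv (bchart c)) differentiable (at x within chart_image (bchart c))"
    and "i \<noteq> bdry_index \<Longrightarrow> pderiv_in (chart_image (bchart c)) i (\<psi> \<circ> chart_inv (bchart c)) x = partial c x i"
proof -
  have xc: "x \<in> chart_image c" using x by (simp add: chart_image_bchart[OF c])
  obtain f' where f': "((\<psi> \<circ> chart_inv c) has_derivative f') (at x within chart_image c)"
    using smooth_on_differentiable[OF smooth_immersion[OF c] xc] by (auto simp: differentiable_def)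
  note b = bchart_has_derivative[OF c x f']
  show "(\<psi> \<circ> chart_inv (bchart c)) differentiable (at x within chart_image (bchart c))"
    using b by (auto simp: differentiable_def)
  show "pderiv_in (chart_image (bchart c)) i (\<psi> \<circ> chart_inv (bchart c)) x = partial c x i" if "i \<noteq> bdry_index"
    unfolding partial_eq[OF c] pderiv_in_eq[OF openin_chart_image[OF c] xc UNIV_I f']
    using that by (intro pderiv_in_eq[OF is_chartD(2)[OF is_chart_bchart[OF c]] x _ b]) simp
qed

lemma bchart_transition_differentiable:
  assumes c: "c \<in> A" and d: "d \<in> A" and x: "x \<in> snd (bchart c) ` (fst (bchart c) \<inter> fst (bchart d))"
  shows "transition (bchart c) (bchart d) differentiable (at x within snd (bchart c) ` (fst (bchart c) \<inter> fst (bchart d)))"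
proof -
  let ?E = "snd (bchart c) ` (fst (bchart c) \<inter> fst (bchart d))"
  have E: "?E \<subseteq> snd c ` (fst c \<inter> fst d)" "?E \<subseteq> chart_image (bchart c)" by (auto simp: bchart_def chart_image_def)
  obtain T' where T': "(transition c d has_derivative T') (at x within snd c ` (fst c \<inter> fst d))"
    using smooth_on_differentiable[OF transition_smooth[OF c d]] x E(1) unfolding differentiable_def by blast
  have "(transition (bchart c) (bchart d) has_derivative T') (at x within ?E)"
  proof (rule has_derivative_transform[OF x _ has_derivative_subset[OF T' E(1)]])
    show "transition (bchart c) (bchart d) y = transition c d y" if "y \<in> ?E" for y
      using chart_inv_bchart[OF c] E(2) that by (auto simp: transition_def bchart_def)
  qed
  then show ?thesis by (auto simp: differentiable_def)
qed

end

section \<open>The global divergence theorem\<close>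

text \<open>One partition of unity is fixed for \<open>M\<close> and its boundary alike, so that
  both volumes become sums over the same charts and can be subtracted term by term.\<close>

locale minimal_hypersurface_partition = minimal_hypersurface M A \<psi> N z \<rho>
  for M :: "'a::{t2_space,second_countable_topology} set" and A :: "('a, 'n::finite) chart set"
    and \<psi> N :: "'a \<Rightarrow> real ^ 'm::finite" and z :: "real ^ 'm" and \<rho> :: real +
  fixes P :: "'a set" and cf :: "'a \<Rightarrow> ('a, 'n) chart" and K :: "'a \<Rightarrow> (real ^ 'n) set" and \<theta> :: "'a \<Rightarrow> 'a \<Rightarrow> real"
  assumes P: "finite P" and cf: "p \<in> P \<Longrightarrow> cf p \<in> A" and K_compact: "p \<in> P \<Longrightarrow> compact (K p)"
    and K_subset: "p \<in> P \<Longrightarrow> K p \<subseteq> chart_image (cf p)" and \<theta>_C1: "p \<in> P \<Longrightarrow> C1_fun (\<theta> p)"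
    and \<theta>_nonneg: "p \<in> P \<Longrightarrow> q \<in> M \<Longrightarrow> 0 \<le> \<theta> p q"
    and \<theta>_support: "p \<in> P \<Longrightarrow> q \<in> M \<Longrightarrow> q \<notin> chart_inv (cf p) ` K p \<Longrightarrow> \<theta> p q = 0"
    and \<theta>_sum: "q \<in> M \<Longrightarrow> (\<Sum>p\<in>P. \<theta> p q) = 1"
begin

lemma support_in_chart: "p \<in> P \<Longrightarrow> chart_inv (cf p) ` K p \<subseteq> fst (cf p)"
  using K_subset chart_inv_in[OF chart[OF cf]] by blast

lemma exists_positive: "q \<in> M \<Longrightarrow> \<exists>p\<in>P. q \<in> fst (cf p) \<and> \<theta> p q > 0"
proof -
  assume q: "q \<in> M"
  then obtain p where p: "p \<in> P" "\<theta> p q \<noteq> 0"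
    using \<theta>_sum[OF q] by (metis sum.neutral zero_neq_one)
  then have "\<theta> p q > 0" using \<theta>_nonneg[OF p(1) q] by simp
  moreover have "q \<in> fst (cf p)" using \<theta>_support[OF p(1) q] p(2) support_in_chart[OF p(1)] by blast
  ultimately show ?thesis using p(1) by blast
qed

lemma support_zero:
  assumes p: "p \<in> P" and x: "x \<in> chart_image (cf p) - K p"
  shows "\<theta> p (chart_inv (cf p) x) = 0"
proof (rule \<theta>_support[OF p])
  show "chart_inv (cf p) x \<in> M" using x chart_image_in_M[OF cf[OF p]] by simp
  show "chart_inv (cf p) x \<notin> chart_inv (cf p) ` K p"
    using chart_inv_in_image_iff[OF chart[OF cf[OF p]] _ K_subset[OF p]] x by blast
qed

sublocale V: chart_cover UNIV M A \<psi> "cf ` P"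
proof
  show "\<Union> (fst ` cf ` P) = M"
    using exists_positive is_chartD(4)[OF chart[OF cf]] by fastforce
  show "continuous_on (chart_image c) (pderiv_in (chart_image c) i (\<psi> \<circ> chart_inv c))" if "c \<in> A" for c i
    by (rule smooth_on_continuous_on[OF smooth_on_pderiv_in[OF openin_chart_image[OF that] _ smooth_immersion[OF that]]]) simp
qed (use P cf chart in \<open>auto intro: smooth_on_differentiable[OF smooth_immersion] smooth_on_differentiable[OF transition_smooth]\<close>)

sublocale B: chart_cover "UNIV - {bdry_index}" bdry "boundary_atlas A" \<psi> "bchart ` cf ` P"
proof
  show "is_chart (UNIV - {bdry_index}) bdry c" if "c \<in> boundary_atlas A" for c
    using that is_chart_bchart by (auto simp: boundary_atlas_eq)
  show "finite (bchart ` cf ` P)" "bchart ` cf ` P \<subseteq> boundary_atlas A" using P cf by (auto simp: boundary_atlas_eq)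
  show "\<Union> (fst ` bchart ` cf ` P) = bdry"
    using V.C_cover bdry_subset by (auto simp: bchart_def)
  show "transition c d differentiable (at x within snd c ` (fst c \<inter> fst d))"
    if "c \<in> boundary_atlas A" "d \<in> boundary_atlas A" "x \<in> snd c ` (fst c \<inter> fst d)" for c d x
    using that bchart_transition_differentiable unfolding boundary_atlas_eq by blast
  show "(\<psi> \<circ> chart_inv c) differentiable (at x within chart_image c)"
    if "c \<in> boundary_atlas A" "x \<in> chart_image c" for c x
    using that bchart_differentiable_partial(1) unfolding boundary_atlas_eq by blast
  show "continuous_on (chart_image c) (pderiv_in (chart_image c) i (\<psi> \<circ> chart_inv c))"
    if c: "c \<in> boundary_atlas A" and i: "i \<in> UNIV - {bdry_index}" for c i
  proof -
    obtain c' where c': "c' \<in> A" "c = bchart c'" using c by (auto simp: boundary_atlas_eq)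
    have "continuous_on (chart_image c) (\<lambda>x. partial c' x i)"
      using C1_on_continuous_on[OF minimal_patch.C1_partial[OF patch[OF c'(1)]]]
      by (rule continuous_on_subset) (simp add: c' chart_image_bchart)
    then show ?thesis
      by (rule continuous_on_eq) (use bchart_differentiable_partial(2)[OF c'(1)] c'(2) i in auto)
  qed
qed

lemma vol_density_eq: "c \<in> A \<Longrightarrow> x \<in> chart_image c \<Longrightarrow> V.vol_density c x = w c x"
proof -
  assume c: "c \<in> A" and x: "x \<in> chart_image c"
  interpret p: minimal_patch "chart_image c" "\<psi> \<circ> chart_inv c" "N \<circ> chart_inv c" z by (rule patch[OF c])
  have "metric_matrix c \<psi> x = p.fform x"
    by (simp add: vec_eq_iff metric_matrix_def p.gram_entry[OF x] p.partial_def)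
  then show ?thesis by (simp add: V.vol_density_def p.w_def minor_UNIV)
qed

text \<open>The metric of the boundary is a principal submatrix of the metric of \<open>M\<close>.
  Both densities thus come from one Gram matrix, as \<open>sqrt_minor_complement\<close>
  requires.\<close>

lemma boundary_vol_density_eq:
  assumes c: "c \<in> A" and x: "x \<in> chart_image (bchart c)"
  shows "B.vol_density (bchart c) x = sqrt (minor (UNIV - {bdry_index}) (hypersurface_frame.gram (partial c x)))"
proof -
  have xc: "x \<in> chart_image c" using x by (simp add: chart_image_bchart[OF c])
  have "minor_matrix (UNIV - {bdry_index}) (metric_matrix (bchart c) \<psi> x)
    = minor_matrix (UNIV - {bdry_index}) (hypersurface_frame.gram (partial c x))"
    by (simp add: vec_eq_iff minor_matrix_def metric_matrix_def bchart_differentiable_partial(2)[OF c x]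
        minimal_patch.gram_entry[OF patch[OF c] xc])
  then show ?thesis by (simp add: B.vol_density_def minor_eq_det)
qed

lemma finite_V: "emeasure V.volume M < \<infinity>"
  by (rule V.finite_volume[OF P cf K_compact K_subset C1_fun_continuous[OF \<theta>_C1] \<theta>_nonneg \<theta>_support \<theta>_sum])

definition bK :: "'a \<Rightarrow> (real ^ 'n) set" where
  "bK p = K p \<inter> {x. x $ bdry_index = 0}"

lemma bK: "p \<in> P \<Longrightarrow> compact (bK p)" "p \<in> P \<Longrightarrow> bK p \<subseteq> chart_image (bchart (cf p))"
proof -
  have "closed {x :: real ^ 'n. x $ bdry_index = 0}" by (intro closed_Collect_eq continuous_intros)
  then show "p \<in> P \<Longrightarrow> compact (bK p)" using K_compact by (auto simp: bK_def intro: compact_Int_closed)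
  show "p \<in> P \<Longrightarrow> bK p \<subseteq> chart_image (bchart (cf p))"
    using K_subset by (auto simp: bK_def chart_image_bchart[OF cf])
qed

lemma bsupport_zero:
  assumes p: "p \<in> P" and q: "q \<in> bdry" "q \<notin> chart_inv (bchart (cf p)) ` bK p"
  shows "\<theta> p q = 0"
proof (rule \<theta>_support[OF p])
  show "q \<in> M" using q bdry_subset by blast
  show "q \<notin> chart_inv (cf p) ` K p"
  proof
    assume "q \<in> chart_inv (cf p) ` K p"
    then obtain x where x: "x \<in> K p" "q = chart_inv (cf p) x" by auto
    have xc: "x \<in> chart_image (cf p)" using x K_subset[OF p] by blast
    have "q \<in> fst (cf p)" "snd (cf p) q = x"
      using x(2) xc chart_inv_in[OF chart[OF cf[OF p]]] chart_apply_inv[OF chart[OF cf[OF p]]] by auto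
    then have "x \<in> bK p" using boundary_iff[OF cf[OF p]] q(1) x(1) by (simp add: bK_def)
    then have "q = chart_inv (bchart (cf p)) x" using chart_inv_bchart[OF cf[OF p]] bK(2)[OF p] x(2) by auto
    then show False using q(2) \<open>x \<in> bK p\<close> by blast
  qed
qed

lemma finite_B: "emeasure B.volume bdry < \<infinity>"
  by (rule B.finite_volume[where cf = "\<lambda>p. bchart (cf p)", OF P _ bK _ _ bsupport_zero])
    (use bdry_subset cf in \<open>auto simp: boundary_atlas_eq subset_iff intro: continuous_on_subset[OF C1_fun_continuous[OF \<theta>_C1]] \<theta>_nonneg \<theta>_sum\<close>)

lemma integrable_V:
  assumes u: "continuous_on M u"
  shows "integrable V.volume (u :: 'a \<Rightarrow> real)"
proof -
  interpret finite_measure V.volume using finite_V by (intro finite_measureI) simp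
  have "compact (u ` M)" using compact_continuous_image[OF u compact_M] .
  then obtain b where b: "\<And>q. q \<in> M \<Longrightarrow> norm (u q) \<le> b"
    using compact_imp_bounded[of "u ` M"] by (auto simp: bounded_iff)
  have "u \<in> borel_measurable V.volume"
    using borel_measurable_continuous_on_restrict[OF u] by (simp add: measurable_cong_sets[OF V.sets_volume refl])
  then show ?thesis using b by (intro integrable_const_bound[of _ b]) auto
qed

lemma divergence_theorem_local:
  fixes \<eta> :: "'a \<Rightarrow> real"
  assumes p: "p \<in> P" and \<eta>: "C1_fun \<eta>" and supp: "\<And>q. q \<in> M \<Longrightarrow> q \<notin> chart_inv (cf p) ` K p \<Longrightarrow> \<eta> q = 0"
    and supp': "\<And>x. x \<in> chart_image (cf p) - K p \<Longrightarrow> \<eta> (chart_inv (cf p) x) = 0"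
  shows "(\<integral>q. X \<eta> q + CARD('n) * \<eta> q \<partial>V.volume)
    = - (\<integral>y. \<eta> (chart_inv (cf p) y) * (vf (cf p) y $ bdry_index * w (cf p) y) * indicator (chart_image (cf p)) y
          \<partial>coord_lborel (UNIV - {bdry_index}))"
proof -
  note c = cf[OF p]
  let ?S = "chart_image (cf p)"
  interpret patch: minimal_patch ?S "\<psi> \<circ> chart_inv (cf p)" "N \<circ> chart_inv (cf p)" z by (rule patch[OF c])
  have Z: "compact (chart_inv (cf p) ` K p)"
    using is_chartD(3)[OF chart[OF c]] K_compact[OF p] K_subset[OF p]
    by (intro compact_continuous_image) (auto simp: homeomorphism_def intro: continuous_on_subset)
  have "(\<integral>q. X \<eta> q + CARD('n) * \<eta> q \<partial>V.volume)
    = (\<integral>x. V.vol_density (cf p) x * (X \<eta> (chart_inv (cf p) x) + CARD('n) * \<eta> (chart_inv (cf p) x)) * indicator ?S x \<partial>coord_lborel UNIV)"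
  proof (rule V.integral_volume_chart[OF c])
    show "(\<lambda>q. X \<eta> q + CARD('n) * \<eta> q) \<in> borel_measurable (restrict_space borel M)"
      by (intro borel_measurable_continuous_on_restrict continuous_intros X_continuous[OF \<eta>] C1_fun_continuous[OF \<eta>])
    show "X \<eta> q + CARD('n) * \<eta> q = 0" if "q \<in> M" "q \<notin> fst (cf p)" for q
    proof -
      have q: "q \<notin> chart_inv (cf p) ` K p" using that(2) support_in_chart[OF p] by blast
      show ?thesis using X_zero_off_support[OF \<eta> Z supp that(1) q] supp[OF that(1) q] by simp
    qed
  qed
  also have "\<dots> = (\<integral>x. w (cf p) x * ((\<Sum>i\<in>UNIV. vf (cf p) x $ i * pderiv_in ?S i (\<eta> \<circ> chart_inv (cf p)) x)
      + CARD('n) * (\<eta> \<circ> chart_inv (cf p)) x) * indicator ?S x \<partial>lborel)"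
    unfolding coord_lborel_UNIV
    by (intro Bochner_Integration.integral_cong refl)
      (simp add: indicator_def vol_density_eq[OF c] X_chart_inv[OF c _ \<eta>])
  also have "\<dots> = - (\<integral>y. (\<eta> \<circ> chart_inv (cf p)) y * (vf (cf p) y $ bdry_index * w (cf p) y) * indicator ?S y
          \<partial>coord_lborel (UNIV - {bdry_index}))"
    by (rule patch.local_divergence_theorem[OF C1_funD[OF \<eta> c] K_compact[OF p] K_subset[OF p]]) (simp add: supp')
  finally show ?thesis by simp
qed

text \<open>The local version is applied to the products \<open>v * \<theta> p\<close>, and
  additivity of \<open>X\<close> reassembles the left-hand sides, so derivatives of the partition
  never show up. The boundary side stays a sum over charts until it is compared with the boundary
  density in \<open>volume_defect\<close>.\<close>

lemma divergence_theorem: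
  fixes v :: "'a \<Rightarrow> real"
  assumes v: "C1_fun v"
  shows "(\<integral>q. X v q + CARD('n) * v q \<partial>V.volume)
    = - (\<Sum>p\<in>P. \<integral>y. v (chart_inv (cf p) y) * \<theta> p (chart_inv (cf p) y) * (vf (cf p) y $ bdry_index * w (cf p) y)
          * indicator (chart_image (cf p)) y \<partial>coord_lborel (UNIV - {bdry_index}))"
proof -
  have C1: "C1_fun (\<lambda>q. v q * \<theta> p q)" if "p \<in> P" for p by (rule C1_fun_mult[OF v \<theta>_C1[OF that]])
  have v_sum: "v q = (\<Sum>p\<in>P. v q * \<theta> p q)" if "q \<in> M" for q
    using \<theta>_sum[OF that] by (simp add: sum_distrib_left[symmetric])
  have "(\<integral>q. X v q + CARD('n) * v q \<partial>V.volume)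
    = (\<integral>q. (\<Sum>p\<in>P. X (\<lambda>q. v q * \<theta> p q) q + CARD('n) * (v q * \<theta> p q)) \<partial>V.volume)"
  proof (rule Bochner_Integration.integral_cong[OF refl])
    fix q assume "q \<in> space V.volume"
    then have q: "q \<in> M" by simp
    have "X v q = (\<Sum>p\<in>P. X (\<lambda>q. v q * \<theta> p q) q)" by (rule X_sum[OF C1 v_sum q])
    then show "X v q + CARD('n) * v q = (\<Sum>p\<in>P. X (\<lambda>q. v q * \<theta> p q) q + CARD('n) * (v q * \<theta> p q))"
      using v_sum[OF q] by (simp add: sum.distrib sum_distrib_left[symmetric])
  qed
  also have "\<dots> = (\<Sum>p\<in>P. \<integral>q. X (\<lambda>q. v q * \<theta> p q) q + CARD('n) * (v q * \<theta> p q) \<partial>V.volume)"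
    by (intro Bochner_Integration.integral_sum integrable_V continuous_on_add continuous_on_mult continuous_on_const
        X_continuous C1 C1_fun_continuous[OF v] C1_fun_continuous[OF \<theta>_C1])
  also have "\<dots> = (\<Sum>p\<in>P. - (\<integral>y. v (chart_inv (cf p) y) * \<theta> p (chart_inv (cf p) y) * (vf (cf p) y $ bdry_index * w (cf p) y)
          * indicator (chart_image (cf p)) y \<partial>coord_lborel (UNIV - {bdry_index})))"
    by (intro sum.cong refl divergence_theorem_local C1) (auto simp: \<theta>_support support_zero)
  finally show ?thesis by (simp add: sum_negf)
qed

end


section \<open>The maximum principle and the volume bound\<close>

context minimal_hypersurface_partition
begin

text \<open>The maximum principle comes from the divergence theorem applied to the truncation
  \<open>v = (max 0 (\<bar>\<psi> - z\<bar>\<^sup>2 - \<rho>\<^sup>2))\<^sup>2\<close>, which vanishes on the boundary and satisfies \<open>X v \<ge> 0\<close>.\<close>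

lemma norm_le: "p \<in> M \<Longrightarrow> norm (\<psi> p - z) \<le> \<rho>"
proof -
  assume pM: "p \<in> M"
  define s where "s q = (\<psi> q - z) \<bullet> (\<psi> q - z) + - (\<rho>\<^sup>2)" for q
  define v where "v q = (max 0 (s q))\<^sup>2" for q
  have s_diff: "C1_on (chart_image c) (\<lambda>x. s (chart_inv c x))" if c: "c \<in> A" for c
  proof -
    interpret c: minimal_patch "chart_image c" "\<psi> \<circ> chart_inv c" "N \<circ> chart_inv c" z by (rule patch[OF c])
    show ?thesis
      unfolding s_def using C1_on_add[OF C1_on_inner[OF c.C1_pos c.C1_pos] C1_on_const[of _ "- (\<rho>\<^sup>2)"]] by simp
  qed
  have v: "C1_fun v"
    unfolding C1_fun_def comp_def v_def
    by (intro ballI C1_on_compose_real[OF s_diff, where \<phi> = "\<lambda>s. (max 0 s)\<^sup>2" and \<phi>' = "\<lambda>s. 2 * max 0 s"]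
        has_real_derivative_pos_part_squared continuous_intros)
  \<comment> \<open>The value is \<open>4 * max 0 (s q)\<close> times the squared length of the
    tangential part of \<open>\<psi> - z\<close>.\<close>
  have Xv: "X v q \<ge> 0" if q: "q \<in> M" for q
  proof -
    define c where "c = chart_at q"
    have c: "c \<in> A" "q \<in> fst c" using chart_at[OF q] by (auto simp: c_def)
    define x where "x = snd c q"
    have x: "x \<in> chart_image c" "chart_inv c x = q" using c chart_inv_apply[OF chart[OF c(1)]] by (auto simp: x_def chart_image_def)
    interpret c: minimal_patch "chart_image c" "\<psi> \<circ> chart_inv c" "N \<circ> chart_inv c" z by (rule patch[OF c(1)])
    note pd = openin_chart_image[OF c(1)] x(1) UNIV_I
    note diff = C1_on_differentiable[OF _ x(1)]
    have ds: "pderiv_in (chart_image c) i (\<lambda>x. s (chart_inv c x)) x = 2 * (partial c x i \<bullet> (\<psi> q - z))" for i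
    proof -
      have "pderiv_in (chart_image c) i (\<lambda>x. s (chart_inv c x)) x
        = pderiv_in (chart_image c) i (\<lambda>x. ((\<psi> \<circ> chart_inv c) x - z) \<bullet> ((\<psi> \<circ> chart_inv c) x - z) - \<rho>\<^sup>2) x"
        by (simp add: s_def)
      also have "\<dots> = 2 * (partial c x i \<bullet> (\<psi> q - z))"
        unfolding pderiv_in_diff_const[OF pd diff[OF C1_on_inner[OF c.C1_pos c.C1_pos]]]
          pderiv_in_inner[OF pd diff[OF c.C1_pos] diff[OF c.C1_pos]] pderiv_in_diff_const[OF pd diff[OF c.C1_f]]
        by (simp add: partial_eq[OF c(1)] x(2) inner_commute)
      finally show ?thesis .
    qed
    have "pderiv_in (chart_image c) i (v \<circ> chart_inv c) x = 2 * max 0 (s q) * (2 * (partial c x i \<bullet> (\<psi> q - z)))" for i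
    proof -
      have "v \<circ> chart_inv c = (\<lambda>x. (max 0 (s (chart_inv c x)))\<^sup>2)" by (simp add: fun_eq_iff v_def)
      then show ?thesis
        using pderiv_in_compose_real[OF pd diff[OF s_diff[OF c(1)]] has_real_derivative_pos_part_squared]
        by (simp add: ds x(2))
    qed
    then have "X v q = 4 * max 0 (s q) * (\<Sum>i\<in>UNIV. vf c x $ i * (partial c x i \<bullet> (\<psi> q - z)))"
      using X_chart_inv[OF c(1) x(1) v] x(2) by (simp add: sum_distrib_left mult_ac)
    also have "(\<Sum>i\<in>UNIV. vf c x $ i * (partial c x i \<bullet> (\<psi> q - z))) = (\<Sum>i\<in>UNIV. vf c x $ i *\<^sub>R partial c x i) \<bullet> (\<psi> q - z)"
      by (simp add: inner_sum_left)
    also have "\<dots> = (\<psi> q - z) \<bullet> (\<psi> q - z) - ((\<psi> q - z) \<bullet> N q)\<^sup>2"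
    proof -
      have "(u - (u \<bullet> n) *\<^sub>R n) \<bullet> u = u \<bullet> u - (u \<bullet> n)\<^sup>2" for u n :: "real ^ 'm"
        by (simp only: inner_diff_left inner_scaleR_left power2_eq_square inner_commute[of n u])
      then show ?thesis unfolding tangential_part[OF c, folded x_def] .
    qed
    finally have "X v q = 4 * max 0 (s q) * ((\<psi> q - z) \<bullet> (\<psi> q - z) - ((\<psi> q - z) \<bullet> N q)\<^sup>2)" .
    moreover have "((\<psi> q - z) \<bullet> N q)\<^sup>2 \<le> (\<psi> q - z) \<bullet> (\<psi> q - z)"
      using Cauchy_Schwarz_ineq[of "\<psi> q - z" "N q"] c.norm_N[OF x(1)] by (simp add: x(2) norm_eq_1)
    ultimately show ?thesis by simp
  qed
  \<comment> \<open>The measure on the face charges only boundary points, and there \<open>v\<close>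
    is 0.\<close>
  have "(\<integral>q. X v q + CARD('n) * v q \<partial>V.volume) = 0"
  proof -
    have "(\<integral>y. v (chart_inv (cf p) y) * \<theta> p (chart_inv (cf p) y) * (vf (cf p) y $ bdry_index * w (cf p) y)
          * indicator (chart_image (cf p)) y \<partial>coord_lborel (UNIV - {bdry_index})) = 0" if p: "p \<in> P" for p
    proof (rule integral_eq_zero_AE)
      show "AE y in coord_lborel (UNIV - {bdry_index}). v (chart_inv (cf p) y) * \<theta> p (chart_inv (cf p) y)
          * (vf (cf p) y $ bdry_index * w (cf p) y) * indicator (chart_image (cf p)) y = 0"
        using AE_coord_lborel_coord_space
      proof eventually_elim
        case (elim y)
        show ?case
        proof (cases "y \<in> chart_image (cf p)")
          case True
          then have "y \<in> chart_image (bchart (cf p))"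
            using elim by (simp add: chart_image_bchart[OF cf[OF p]] coord_space_def)
          then have "norm (\<psi> (chart_inv (cf p) y) - z) = \<rho>"
            using chart_inv_in_bdry[OF cf[OF p]] boundary_in_sphere by blast
          then have "v (chart_inv (cf p) y) = 0"
            by (simp add: v_def s_def power2_norm_eq_inner[symmetric])
          then show ?thesis by simp
        qed simp
      qed
    qed
    then show ?thesis unfolding divergence_theorem[OF v] by simp
  qed
  moreover have vn: "v q \<ge> 0" for q by (simp add: v_def)
  moreover have "integrable V.volume (\<lambda>q. X v q + CARD('n) * v q)"
    by (intro integrable_V continuous_on_add continuous_on_mult continuous_on_const X_continuous[OF v] C1_fun_continuous[OF v])
  ultimately have AE: "AE q in V.volume. X v q + CARD('n) * v q = 0"
    using Xv by (subst (asm) integral_nonneg_eq_0_iff_AE) (auto intro!: AE_I2)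
  have "AE q in V.volume. v q = 0"
    using AE AE_space
  proof eventually_elim
    case (elim q)
    then show ?case using Xv[of q] vn[of q] by (simp add: add_nonneg_eq_0_iff)
  qed
  \<comment> \<open>From almost everywhere to everywhere: in a chart around \<open>p\<close> both
    \<open>v\<close> and the density are continuous, and the density is positive.\<close>
  define c where "c = chart_at p"
  have c: "c \<in> A" "p \<in> fst c" using chart_at[OF pM] by (auto simp: c_def)
  have x: "snd c p \<in> chart_image c" "chart_inv c (snd c p) = p"
    using c chart_inv_apply[OF chart[OF c(1)]] by (auto simp: chart_image_def)
  have vm: "(\<lambda>q. ennreal (v q) * indicator (fst c) q) \<in> borel_measurable (restrict_space borel M)"
    using borel_measurable_continuous_on_restrict[OF C1_fun_continuous[OF v]] V.chart_domain_measurable[OF c(1)]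
    by measurable
  have "(\<integral>\<^sup>+ q. ennreal (v q) * indicator (fst c) q \<partial>V.volume) = 0"
    using \<open>AE q in V.volume. v q = 0\<close> vm
    by (subst nn_integral_0_iff_AE) (auto simp: measurable_cong_sets[OF V.sets_volume refl])
  then have "0 = (\<integral>\<^sup>+ q. ennreal (v q) * indicator (fst c) q \<partial>V.volume)" ..
  also have "\<dots> = (\<integral>\<^sup>+ x. ennreal (V.vol_density c x) * (ennreal (v (chart_inv c x)) * indicator (fst c) (chart_inv c x))
      * indicator (chart_image c) x \<partial>coord_lborel UNIV)"
    by (rule V.nn_integral_volume_chart[OF c(1) vm]) simp
  also have "\<dots> = (\<integral>\<^sup>+ x. ennreal (V.vol_density c x * v (chart_inv c x)) * indicator (chart_image c) x \<partial>coord_lborel UNIV)"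
    using chart_inv_in[OF chart[OF c(1)]] vn by (intro nn_integral_cong) (auto simp: indicator_def ennreal_mult)
  finally have "V.vol_density c (snd c p) * v (chart_inv c (snd c p)) \<le> 0"
    using C1_on_continuous_on[OF C1_funD[OF v c(1)]] V.vol_density_continuous[OF c(1)]
    by (intro nn_integral_zero_imp_zero[OF openin_chart_image[OF c(1)] _ _ x(1)]) (auto intro!: continuous_intros simp: comp_def)
  moreover have "V.vol_density c (snd c p) > 0"
    using minimal_patch.det_gram_pos[OF patch[OF c(1)] x(1)]
    by (simp add: vol_density_eq[OF c(1) x(1)] minimal_patch.w_def[OF patch[OF c(1)]])
  ultimately have "v p = 0" using vn[of p] x(2) by (simp add: mult_le_0_iff)
  then have "(norm (\<psi> p - z))\<^sup>2 \<le> \<rho>\<^sup>2"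
    by (simp add: v_def s_def power2_norm_eq_inner)
  then show "norm (\<psi> p - z) \<le> \<rho>" using \<rho>_pos by (simp add: abs_le_square_iff[symmetric])
qed

section \<open>Defect of the inequality and the equality case\<close>

text \<open>The squared distance \<open>s\<close> from the centre is constant along the face, so its
  derivatives in face directions are 0. By \<open>norm_le\<close> it is nowhere larger inside, so it
  cannot increase in the inward direction.\<close>

lemma boundary_partials:
  assumes c: "c \<in> A" and x: "x \<in> chart_image (bchart c)"
  shows "i \<noteq> bdry_index \<Longrightarrow> partial c x i \<bullet> (\<psi> (chart_inv c x) - z) = 0"
    and "partial c x bdry_index \<bullet> (\<psi> (chart_inv c x) - z) \<le> 0"
proof -
  let ?S = "chart_image c" and ?B = "chart_image (bchart c)"
  have xc: "x \<in> ?S" and BS: "?B \<subseteq> ?S" using x by (auto simp: chart_image_bchart[OF c])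
  interpret c: minimal_patch ?S "\<psi> \<circ> chart_inv c" "N \<circ> chart_inv c" z by (rule patch[OF c])
  define s where "s x = ((\<psi> \<circ> chart_inv c) x - z) \<bullet> ((\<psi> \<circ> chart_inv c) x - z)" for x
  note pd = openin_chart_image[OF c] xc UNIV_I
  note diff = C1_on_differentiable[OF _ xc]
  have "C1_on ?S s" unfolding s_def by (rule C1_on_inner[OF c.C1_pos c.C1_pos])
  from diff[OF this] obtain s' where s': "(s has_derivative s') (at x within ?S)" by (auto simp: differentiable_def)
  have ds: "s' (axis i 1) = 2 * (partial c x i \<bullet> (\<psi> (chart_inv c x) - z))" for i
    unfolding pderiv_in_eq[OF pd s', symmetric] s_def[abs_def]
      pderiv_in_inner[OF pd diff[OF c.C1_pos] diff[OF c.C1_pos]] pderiv_in_diff_const[OF pd diff[OF c.C1_f]]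
    by (simp add: partial_eq[OF c] inner_commute)
  have sB: "s y = \<rho>\<^sup>2" if "y \<in> ?B" for y
    using boundary_in_sphere[OF chart_inv_in_bdry[OF c that]] by (simp add: s_def power2_norm_eq_inner[symmetric])
  have sS: "s y \<le> \<rho>\<^sup>2" if "y \<in> ?S" for y
    using norm_le[OF chart_image_in_M[OF c that]] by (simp add: s_def power2_norm_eq_inner[symmetric] power_mono)
  show "partial c x i \<bullet> (\<psi> (chart_inv c x) - z) = 0" if i: "i \<noteq> bdry_index"
  proof -
    have "((\<lambda>_. \<rho>\<^sup>2) has_derivative s') (at x within ?B)"
      by (rule has_derivative_transform[OF x _ has_derivative_subset[OF s' BS]]) (simp add: sB)
    then have "s' (axis i 1) = 0"
      using has_derivative_within_axis_unique[OF is_chartD(2)[OF is_chart_bchart[OF c]] x _ _ has_derivative_const] i by blast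
    then show ?thesis using ds[of i] by simp
  qed
  show "partial c x bdry_index \<bullet> (\<psi> (chart_inv c x) - z) \<le> 0"
  proof (rule ccontr)
    assume "\<not> ?thesis"
    then have pos: "s' (axis bdry_index 1) > 0" using ds[of bdry_index] by simp
    obtain e where e: "e > 0" "\<And>t. t \<in> {0..e} \<Longrightarrow> x + t *\<^sub>R axis bdry_index 1 \<in> ?S"
      using openin_model_axis_segment[OF pd] by blast
    let ?l = "\<lambda>t. x + t *\<^sub>R axis bdry_index 1"
    have "(s has_derivative s') (at (?l 0) within ?l ` {0..e})"
      using has_derivative_subset[OF s', of "?l ` {0..e}"] e by force
    then have "((\<lambda>t. s (?l t)) has_derivative (\<lambda>t. s' (t *\<^sub>R axis bdry_index 1))) (at 0 within {0..e})"
      by (rule has_derivative_in_compose[rotated]) (auto intro!: derivative_eq_intros)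
    moreover have "s' (t *\<^sub>R axis bdry_index 1) = s' (axis bdry_index 1) * t" for t
      using has_derivative_bounded_linear[OF s'] by (simp add: linear_simps)
    ultimately have "((\<lambda>t. s (?l t)) has_real_derivative s' (axis bdry_index 1)) (at 0 within {0..e})"
      by (simp add: has_field_derivative_def)
    then obtain d where d: "d > 0" "\<And>h. 0 < h \<Longrightarrow> 0 + h \<in> {0..e} \<Longrightarrow> h < d \<Longrightarrow> s (?l 0) < s (?l (0 + h))"
      using has_real_derivative_pos_inc_right[of "\<lambda>t. s (?l t)"] pos by blast
    define h where "h = min e d / 2"
    have "h > 0" "h \<in> {0..e}" "h < d" using e(1) d(1) by (auto simp: h_def)
    then have "s x < s (?l h)" using d(2)[of h] by simp
    moreover have "s (?l h) \<le> s x" using sS[OF e(2)[OF \<open>h \<in> {0..e}\<close>]] sB[OF x] by simp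
    ultimately show False by simp
  qed
qed

text \<open>The density of \<open>\<rho> - \<langle>\<psi> - z, \<nu>\<rangle>\<close> on the boundary, for the outer unit conormal \<open>\<nu>\<close>.\<close>

definition gap :: "('a, 'n) chart \<Rightarrow> real ^ 'n \<Rightarrow> real" where
  "gap c y = \<rho> * B.vol_density (bchart c) y + vf c y $ bdry_index * w c y"

lemma gap:
  assumes c: "c \<in> A" and y: "y \<in> chart_image (bchart c)"
  shows "gap c y \<ge> 0" and "gap c y = 0 \<longleftrightarrow> N (chart_inv c y) \<bullet> (\<psi> (chart_inv c y) - z) = 0"
proof -
  have yc: "y \<in> chart_image c" using y by (simp add: chart_image_bchart[OF c])
  interpret c: minimal_patch "chart_image c" "\<psi> \<circ> chart_inv c" "N \<circ> chart_inv c" z by (rule patch[OF c])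
  interpret f: hypersurface_frame "partial c y" "N (chart_inv c y)" using c.frame[OF yc] by simp
  let ?v = "\<psi> (chart_inv c y) - z"
  have nv: "norm ?v = \<rho>" by (rule boundary_in_sphere[OF chart_inv_in_bdry[OF c y]])
  \<comment> \<open>Since \<open>norm ?v = \<rho>\<close> here, \<open>gap\<close> is the difference
    of the two sides of \<open>flux_le\<close>.\<close>
  have g: "gap c y = norm ?v * sqrt (minor (UNIV - {bdry_index}) f.gram) - (- (f.coords ?v $ bdry_index) * sqrt (det f.gram))"
    by (simp add: gap_def boundary_vol_density_eq[OF c y] nv c.vf_def c.w_def)
  show "gap c y \<ge> 0" unfolding g using f.flux_le[of ?v bdry_index] by simp
  show "gap c y = 0 \<longleftrightarrow> N (chart_inv c y) \<bullet> ?v = 0"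
  proof
    assume "gap c y = 0"
    then have "- (f.coords ?v $ bdry_index) * sqrt (det f.gram) = norm ?v * sqrt (minor (UNIV - {bdry_index}) f.gram)"
      unfolding g by linarith
    then show "N (chart_inv c y) \<bullet> ?v = 0" by (rule f.flux_eq_imp_tangent)
  next
    assume "N (chart_inv c y) \<bullet> ?v = 0"
    then show "gap c y = 0"
      unfolding g using f.tangent_imp_flux_eq[OF _ boundary_partials[OF c y]] by simp
  qed
qed

text \<open>The volume of \<open>M\<close> comes from the divergence theorem for the constant
  function 1, that of the boundary from the definition of the volume measure. Both are spread over
  the same partition, and the integrands combine to \<open>gap\<close>.\<close>

lemma volume_defect:
  "\<rho> * vol (UNIV - {bdry_index}) bdry (boundary_atlas A) \<psi> - CARD('n) * vol UNIV M A \<psi>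
    = (\<Sum>p\<in>P. \<integral>y. \<theta> p (chart_inv (cf p) y) * gap (cf p) y * indicator (chart_image (bchart (cf p))) y
        \<partial>coord_lborel (UNIV - {bdry_index}))"
proof -
  let ?L = "coord_lborel (UNIV - {bdry_index}) :: (real ^ 'n) measure"
  define T where "T p y = \<theta> p (chart_inv (cf p) y)" for p y
  define J where "J p y = (indicator (chart_image (bchart (cf p))) y :: real)" for p y
  have bc: "bchart (cf p) \<in> boundary_atlas A" if "p \<in> P" for p using cf[OF that] by (simp add: boundary_atlas_eq)
  have contB: "continuous_on bdry (\<theta> p)" if "p \<in> P" for p
    using C1_fun_continuous[OF \<theta>_C1[OF that]] bdry_subset by (rule continuous_on_subset)
  have T0: "T p y = 0" if "p \<in> P" "y \<in> chart_image (bchart (cf p)) - bK p" for p y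
  proof -
    have "y \<in> chart_image (cf p) - K p" using that by (auto simp: chart_image_bchart[OF cf] bK_def)
    then show ?thesis using support_zero[OF that(1)] by (simp add: T_def)
  qed
  have T_cont: "continuous_on (chart_image (bchart (cf p))) (T p)" if p: "p \<in> P" for p
  proof -
    have "\<theta> p \<circ> chart_inv (cf p) = T p" by (simp add: fun_eq_iff T_def)
    then have "continuous_on (chart_image (cf p)) (T p)"
      using C1_on_continuous_on[OF C1_funD[OF \<theta>_C1[OF p] cf[OF p]]] by simp
    then show ?thesis by (rule continuous_on_subset) (simp add: chart_image_bchart[OF cf[OF p]])
  qed
  have int1: "integrable ?L (\<lambda>y. T p y * (\<rho> * B.vol_density (bchart (cf p)) y) * J p y)" if p: "p \<in> P" for p
    unfolding J_def
    by (rule integrable_coord_lborel_compact_support[OF is_chartD(2)[OF is_chart_bchart[OF cf[OF p]]] _ bK[OF p]])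
      (auto intro!: continuous_intros T_cont[OF p] B.vol_density_continuous[OF bc[OF p]] simp: T0[OF p])
  have int2: "integrable ?L (\<lambda>y. T p y * (vf (cf p) y $ bdry_index * w (cf p) y) * J p y)" if p: "p \<in> P" for p
  proof -
    have "continuous_on (chart_image (cf p)) (\<lambda>y. vf (cf p) y $ bdry_index * w (cf p) y)"
      by (intro C1_on_continuous_on[OF C1_on_mult] minimal_patch.C1_vf[OF patch] minimal_patch.C1_w[OF patch] cf p)
    then have cont: "continuous_on (chart_image (bchart (cf p))) (\<lambda>y. vf (cf p) y $ bdry_index * w (cf p) y)"
      by (rule continuous_on_subset) (simp add: chart_image_bchart[OF cf[OF p]])
    show ?thesis
      unfolding J_def
      by (rule integrable_coord_lborel_compact_support[OF is_chartD(2)[OF is_chart_bchart[OF cf[OF p]]]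
          continuous_on_mult[OF T_cont[OF p] cont] bK[OF p]]) (simp add: T0[OF p])
  qed
  have "vol (UNIV - {bdry_index}) bdry (boundary_atlas A) \<psi> = (\<integral>q. 1 \<partial>B.volume)"
    by (simp add: vol_def)
  also have "\<dots> = (\<integral>q. (\<Sum>p\<in>P. \<theta> p q) \<partial>B.volume)"
    using \<theta>_sum bdry_subset by (intro Bochner_Integration.integral_cong refl) auto
  also have "\<dots> = (\<Sum>p\<in>P. \<integral>q. \<theta> p q \<partial>B.volume)"
  proof (rule Bochner_Integration.integral_sum)
    fix p assume p: "p \<in> P"
    interpret finite_measure B.volume using finite_B by (intro finite_measureI) simp
    have le1: "\<theta> p q \<le> 1" if "q \<in> M" for q
      using member_le_sum[OF p, of "\<lambda>p. \<theta> p q"] \<theta>_nonneg[OF _ that] \<theta>_sum[OF that] P by auto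
    show "integrable B.volume (\<theta> p)"
      using borel_measurable_continuous_on_restrict[OF contB[OF p]] bdry_subset le1 \<theta>_nonneg[OF p]
      by (intro integrable_const_bound[of _ 1]) (auto simp: measurable_cong_sets[OF B.sets_volume refl] intro!: AE_I2)
  qed
  also have "\<dots> = (\<Sum>p\<in>P. \<integral>y. B.vol_density (bchart (cf p)) y * \<theta> p (chart_inv (bchart (cf p)) y)
      * indicator (chart_image (bchart (cf p))) y \<partial>?L)"
  proof (intro sum.cong refl B.integral_volume_chart bc)
    fix p assume p: "p \<in> P"
    show "\<theta> p \<in> borel_measurable (restrict_space borel bdry)"
      by (rule borel_measurable_continuous_on_restrict[OF contB[OF p]])
    fix q assume q: "q \<in> bdry" "q \<notin> fst (bchart (cf p))"
    then have "q \<notin> chart_inv (cf p) ` K p" using support_in_chart[OF p] by (auto simp: bchart_def)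
    then show "\<theta> p q = 0" using \<theta>_support[OF p] q(1) bdry_subset by blast
  qed
  also have "\<dots> = (\<Sum>p\<in>P. \<integral>y. B.vol_density (bchart (cf p)) y * T p y * J p y \<partial>?L)"
    by (intro sum.cong refl Bochner_Integration.integral_cong)
      (auto simp: T_def J_def indicator_def chart_inv_bchart[OF cf])
  finally have 1: "\<rho> * vol (UNIV - {bdry_index}) bdry (boundary_atlas A) \<psi>
    = (\<Sum>p\<in>P. \<integral>y. T p y * (\<rho> * B.vol_density (bchart (cf p)) y) * J p y \<partial>?L)"
    by (simp add: sum_distrib_left integral_mult_right_zero[symmetric] mult_ac del: integral_mult_right_zero)
  have X1: "X (\<lambda>_. 1) q = 0" if "q \<in> M" for q
  proof -
    define c where "c = chart_at q"
    have c: "c \<in> A" "q \<in> fst c" using chart_at[OF that] by (auto simp: c_def)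
    have "snd c q \<in> chart_image c" using c by (simp add: chart_image_def)
    then have "pderiv_in (chart_image c) i ((\<lambda>_. 1 :: real) \<circ> chart_inv c) (snd c q) = 0" for i
      unfolding comp_def by (rule pderiv_in_const[OF openin_chart_image[OF c(1)] _ UNIV_I])
    then show ?thesis unfolding X_def c_def[symmetric] chart_deriv_def by simp
  qed
  have "CARD('n) * vol UNIV M A \<psi> = (\<integral>q. X (\<lambda>_. 1) q + CARD('n) * 1 \<partial>V.volume)"
  proof -
    have "(\<integral>q. X (\<lambda>_. 1) q + CARD('n) * 1 \<partial>V.volume) = (\<integral>q. CARD('n) \<partial>V.volume)"
      by (intro Bochner_Integration.integral_cong refl) (simp add: X1)
    then show ?thesis by (simp add: vol_def)
  qed
  also have "\<dots> = - (\<Sum>p\<in>P. \<integral>y. 1 * \<theta> p (chart_inv (cf p) y) * (vf (cf p) y $ bdry_index * w (cf p) y)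
          * indicator (chart_image (cf p)) y \<partial>?L)"
    using divergence_theorem[OF C1_fun_const[of 1]] by simp
  also have "\<dots> = - (\<Sum>p\<in>P. \<integral>y. T p y * (vf (cf p) y $ bdry_index * w (cf p) y) * J p y \<partial>?L)"
  proof (intro arg_cong[of _ _ uminus] sum.cong refl)
    fix p assume p: "p \<in> P"
    have meas: "(\<lambda>y. T p y * (vf (cf p) y $ bdry_index * w (cf p) y) * indicator (chart_image (cf p)) y) \<in> borel_measurable ?L"
      using continuous_on_imp_indicator_measurable[OF openin_chart_image[OF cf[OF p]], of "\<lambda>y. T p y * (vf (cf p) y $ bdry_index * w (cf p) y)"]
        C1_on_continuous_on[OF C1_on_mult[OF C1_funD[OF \<theta>_C1[OF p] cf[OF p]]
            C1_on_mult[OF minimal_patch.C1_vf[OF patch[OF cf[OF p]]] minimal_patch.C1_w[OF patch[OF cf[OF p]]]]]]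
      by (simp add: T_def comp_def)
    show "(\<integral>y. 1 * \<theta> p (chart_inv (cf p) y) * (vf (cf p) y $ bdry_index * w (cf p) y) * indicator (chart_image (cf p)) y \<partial>?L)
      = (\<integral>y. T p y * (vf (cf p) y $ bdry_index * w (cf p) y) * J p y \<partial>?L)"
    proof (rule Bochner_Integration.integral_cong_AE)
      show "(\<lambda>y. 1 * \<theta> p (chart_inv (cf p) y) * (vf (cf p) y $ bdry_index * w (cf p) y) * indicator (chart_image (cf p)) y) \<in> borel_measurable ?L"
        using meas by (simp add: T_def)
      show "(\<lambda>y. T p y * (vf (cf p) y $ bdry_index * w (cf p) y) * J p y) \<in> borel_measurable ?L"
        using int2[OF p] by (rule borel_measurable_integrable)
      \<comment> \<open>The measure is concentrated on the face, and within it the two chart images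
        coincide.\<close>
      show "AE y in ?L. 1 * \<theta> p (chart_inv (cf p) y) * (vf (cf p) y $ bdry_index * w (cf p) y) * indicator (chart_image (cf p)) y
        = T p y * (vf (cf p) y $ bdry_index * w (cf p) y) * J p y"
        using AE_coord_lborel_coord_space
        by eventually_elim (simp add: T_def J_def indicator_def chart_image_bchart[OF cf[OF p]] coord_space_def)
    qed
  qed
  finally have 2: "CARD('n) * vol UNIV M A \<psi> = - (\<Sum>p\<in>P. \<integral>y. T p y * (vf (cf p) y $ bdry_index * w (cf p) y) * J p y \<partial>?L)" .
  have "\<rho> * vol (UNIV - {bdry_index}) bdry (boundary_atlas A) \<psi> - CARD('n) * vol UNIV M A \<psi>
    = (\<Sum>p\<in>P. (\<integral>y. T p y * (\<rho> * B.vol_density (bchart (cf p)) y) * J p y \<partial>?L)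
        + (\<integral>y. T p y * (vf (cf p) y $ bdry_index * w (cf p) y) * J p y \<partial>?L))"
    unfolding 1 2 by (simp add: sum.distrib)
  also have "\<dots> = (\<Sum>p\<in>P. \<integral>y. T p y * gap (cf p) y * J p y \<partial>?L)"
  proof (rule sum.cong[OF refl])
    fix p assume p: "p \<in> P"
    show "(\<integral>y. T p y * (\<rho> * B.vol_density (bchart (cf p)) y) * J p y \<partial>?L)
        + (\<integral>y. T p y * (vf (cf p) y $ bdry_index * w (cf p) y) * J p y \<partial>?L) = (\<integral>y. T p y * gap (cf p) y * J p y \<partial>?L)"
      unfolding Bochner_Integration.integral_add[OF int1[OF p] int2[OF p], symmetric]
      by (simp add: gap_def algebra_simps)
  qed
  finally show ?thesis by (simp add: T_def J_def)
qed

text \<open>The integrand is continuous and nonnegative, so a zero integral forces it to vanish at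
  every point. This is why equality yields orthogonality along the whole boundary and not just
  almost everywhere.\<close>

lemma defect_terms:
  assumes p: "p \<in> P"
  defines "D \<equiv> \<lambda>y. \<theta> p (chart_inv (cf p) y) * gap (cf p) y"
  shows "(\<integral>y. D y * indicator (chart_image (bchart (cf p))) y \<partial>coord_lborel (UNIV - {bdry_index})) \<ge> 0"
    and "(\<integral>y. D y * indicator (chart_image (bchart (cf p))) y \<partial>coord_lborel (UNIV - {bdry_index})) = 0 \<Longrightarrow>
      y \<in> chart_image (bchart (cf p)) \<Longrightarrow> D y = 0"
proof -
  let ?B = "chart_image (bchart (cf p))"
  let ?L = "coord_lborel (UNIV - {bdry_index}) :: (real ^ 'n) measure"
  note c = cf[OF p]
  have BS: "?B \<subseteq> chart_image (cf p)" by (simp add: chart_image_bchart[OF c])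
  have nn: "D y \<ge> 0" if "y \<in> ?B" for y
    unfolding D_def using gap(1)[OF c that] \<theta>_nonneg[OF p chart_image_in_M[OF c]] BS that by auto
  have nn': "D y * indicator ?B y \<ge> 0" for y using nn by (auto simp: indicator_def)
  then show "(\<integral>y. D y * indicator ?B y \<partial>?L) \<ge> 0" by (rule Bochner_Integration.integral_nonneg)
  have contD: "continuous_on ?B D"
  proof -
    have cont: "continuous_on ?B (\<lambda>y. \<theta> p (chart_inv (cf p) y))" "continuous_on ?B (\<lambda>y. vf (cf p) y $ bdry_index)" "continuous_on ?B (w (cf p))"
      using C1_on_continuous_on[OF C1_funD[OF \<theta>_C1[OF p] c]] C1_on_continuous_on[OF minimal_patch.C1_vf[OF patch[OF c]]]
        C1_on_continuous_on[OF minimal_patch.C1_w[OF patch[OF c]]]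
      by (auto intro: continuous_on_subset[OF _ BS] simp: comp_def)
    have "continuous_on ?B (B.vol_density (bchart (cf p)))"
      by (rule B.vol_density_continuous) (simp add: boundary_atlas_eq c)
    then show ?thesis unfolding D_def gap_def by (intro continuous_on_mult continuous_on_add continuous_on_const cont)
  qed
  have int: "integrable ?L (\<lambda>y. D y * indicator ?B y)"
  proof (rule integrable_coord_lborel_compact_support[OF is_chartD(2)[OF is_chart_bchart[OF c]] contD bK[OF p]])
    show "D y = 0" if "y \<in> ?B - bK p" for y
      unfolding D_def using that support_zero[OF p, of y] by (auto simp: chart_image_bchart[OF c] bK_def)
  qed
  assume "(\<integral>y. D y * indicator ?B y \<partial>?L) = 0" and y: "y \<in> ?B"
  then have "AE y in ?L. D y * indicator ?B y = 0"
    using integral_nonneg_eq_0_iff_AE[OF int] nn' by simp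
  then have "(\<integral>\<^sup>+ y. ennreal (D y * indicator ?B y) \<partial>?L) = 0"
    using int by (subst nn_integral_0_iff_AE) auto
  also have "(\<integral>\<^sup>+ y. ennreal (D y * indicator ?B y) \<partial>?L) = (\<integral>\<^sup>+ y. ennreal (D y) * indicator ?B y \<partial>?L)"
    by (intro nn_integral_cong) (auto simp: indicator_def)
  finally have "D y \<le> 0"
    using nn_integral_zero_imp_zero[OF is_chartD(2)[OF is_chart_bchart[OF c]] contD _ y] by blast
  then show "D y = 0" using nn[OF y] by simp
qed

lemma volume_bound:
  "CARD('n) * vol UNIV M A \<psi> \<le> \<rho> * vol (UNIV - {bdry_index}) bdry (boundary_atlas A) \<psi>"
  "CARD('n) * vol UNIV M A \<psi> = \<rho> * vol (UNIV - {bdry_index}) bdry (boundary_atlas A) \<psi>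
    \<longleftrightarrow> orthogonal_to_sphere A \<psi> N z \<rho>"
proof -
  let ?I = "\<lambda>p. \<integral>y. \<theta> p (chart_inv (cf p) y) * gap (cf p) y * indicator (chart_image (bchart (cf p))) y
        \<partial>coord_lborel (UNIV - {bdry_index})"
  have "(\<Sum>p\<in>P. ?I p) \<ge> 0" by (intro sum_nonneg defect_terms(1))
  then show "CARD('n) * vol UNIV M A \<psi> \<le> \<rho> * vol (UNIV - {bdry_index}) bdry (boundary_atlas A) \<psi>"
    using volume_defect by simp
  have orth: "orthogonal_to_sphere A \<psi> N z \<rho> \<longleftrightarrow> (\<forall>q\<in>bdry. N q \<bullet> (\<psi> q - z) = 0)"
    using \<rho>_pos by (simp add: orthogonal_to_sphere_def sphere_normal_def)
  have "CARD('n) * vol UNIV M A \<psi> = \<rho> * vol (UNIV - {bdry_index}) bdry (boundary_atlas A) \<psi> \<longleftrightarrow> (\<Sum>p\<in>P. ?I p) = 0"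
    using volume_defect by auto
  also have "\<dots> \<longleftrightarrow> (\<forall>p\<in>P. ?I p = 0)"
    by (intro sum_nonneg_eq_0_iff P defect_terms(1))
  also have "\<dots> \<longleftrightarrow> (\<forall>q\<in>bdry. N q \<bullet> (\<psi> q - z) = 0)"
  proof
    assume zero: "\<forall>p\<in>P. ?I p = 0"
    show "\<forall>q\<in>bdry. N q \<bullet> (\<psi> q - z) = 0"
    proof
      fix q assume q: "q \<in> bdry"
      \<comment> \<open>Positivity of \<open>\<theta> p q\<close> allows this factor to be cancelled
        from the vanishing integrand.\<close>
      then obtain p where p: "p \<in> P" "q \<in> fst (cf p)" "\<theta> p q > 0" using exists_positive bdry_subset by blast
      note c = cf[OF p(1)]
      define y where "y = snd (cf p) q"
      have inv: "chart_inv (cf p) y = q" using chart_inv_apply[OF chart[OF c] p(2)] by (simp add: y_def)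
      have y: "y \<in> chart_image (bchart (cf p))" using p(2) q by (simp add: y_def chart_image_def bchart_def)
      have "\<theta> p q * gap (cf p) y = 0" using defect_terms(2)[OF p(1) _ y] zero p(1) inv by simp
      then have "gap (cf p) y = 0" using p(3) by simp
      then show "N q \<bullet> (\<psi> q - z) = 0" using gap(2)[OF c y] inv by simp
    qed
  next
    assume orth: "\<forall>q\<in>bdry. N q \<bullet> (\<psi> q - z) = 0"
    show "\<forall>p\<in>P. ?I p = 0"
    proof
      fix p assume p: "p \<in> P"
      have zero: "\<theta> p (chart_inv (cf p) y) * gap (cf p) y * indicator (chart_image (bchart (cf p))) y = 0" for y
        using gap(2)[OF cf[OF p]] orth chart_inv_in_bdry[OF cf[OF p]] by (cases "y \<in> chart_image (bchart (cf p))") auto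
      show "?I p = 0" by (simp only: zero Bochner_Integration.integral_zero)
    qed
  qed
  finally show "CARD('n) * vol UNIV M A \<psi> = \<rho> * vol (UNIV - {bdry_index}) bdry (boundary_atlas A) \<psi>
    \<longleftrightarrow> orthogonal_to_sphere A \<psi> N z \<rho>"
    unfolding orth .
qed

end

section \<open>The sharp volume bound\<close>

lemma (in minimal_hypersurface) partition_exists:
  "\<exists>P cf K \<theta>. minimal_hypersurface_partition M A \<psi> N z \<rho> P cf K \<theta>"
proof (rule partition_of_unity)
  fix P :: "'a set" and cf K \<theta>
  assume "finite P" "\<And>p. p \<in> P \<Longrightarrow> cf p \<in> A" "\<And>p. p \<in> P \<Longrightarrow> compact (K p)"
    "\<And>p. p \<in> P \<Longrightarrow> K p \<subseteq> chart_image (cf p)" "\<And>p. p \<in> P \<Longrightarrow> C1_fun (\<theta> p)"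
    "\<And>p q. p \<in> P \<Longrightarrow> q \<in> M \<Longrightarrow> 0 \<le> \<theta> p q"
    "\<And>p q. p \<in> P \<Longrightarrow> q \<in> M \<Longrightarrow> q \<notin> chart_inv (cf p) ` K p \<Longrightarrow> \<theta> p q = 0"
    "\<And>q. q \<in> M \<Longrightarrow> (\<Sum>p\<in>P. \<theta> p q) = 1"
  then have "minimal_hypersurface_partition M A \<psi> N z \<rho> P cf K \<theta>"
    by unfold_locales
  then show ?thesis by blast
qed

theorem corollary8p4:
  fixes M :: "'a::{t2_space,second_countable_topology} set"
    and A :: "('a, 'n::finite) chart set"
    and \<psi> N :: "'a \<Rightarrow> real ^ 'm::finite"
    and \<Sigma> :: "(real ^ 'm) set"
    and B :: "(real ^ 'm, 'n) chart set"
    and z :: "real ^ 'm"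
    and \<rho> :: real
  assumes "CARD('m) = CARD('n) + 1"
    and "\<rho> > 0"
    and "embedded_submanifold (UNIV - {bdry_index}) \<Sigma> B"
    and "orientable (UNIV - {bdry_index}) B"
    and "compact \<Sigma>"
    and "\<Sigma> \<subseteq> sphere z \<rho>"
    and "smooth_manifold UNIV M A"
    and "connected M"
    and "orientable UNIV A"
    and "compact M"
    and "immersion UNIV A \<psi>"
    and "unit_normal_field A \<psi> N"
    and "minimal A \<psi> N"
    and "diffeomorphism (mfd_boundary A) (boundary_atlas A) \<Sigma> B \<psi>"
  shows "vol UNIV M A \<psi>
           \<le> \<rho> / real CARD('n) * vol (UNIV - {bdry_index}) (mfd_boundary A) (boundary_atlas A) \<psi> \<and>
         (vol UNIV M A \<psi>
           = \<rho> / real CARD('n) * vol (UNIV - {bdry_index}) (mfd_boundary A) (boundary_atlas A) \<psi>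
           \<longleftrightarrow> orthogonal_to_sphere A \<psi> N z \<rho>)"
proof -
  interpret minimal_hypersurface M A \<psi> N z \<rho>
  proof
    have "\<psi> ` mfd_boundary A = \<Sigma>"
      using assms(14) by (simp add: diffeomorphism_def bij_betw_def)
    then show "norm (\<psi> p - z) = \<rho>" if "p \<in> mfd_boundary A" for p
      using assms(6) that by (auto simp: dist_norm norm_minus_commute)
  qed (use assms in simp_all)
  obtain P c K \<theta> where "minimal_hypersurface_partition M A \<psi> N z \<rho> P c K \<theta>"
    using partition_exists by blast
  then interpret minimal_hypersurface_partition M A \<psi> N z \<rho> P c K \<theta> .
  have "real CARD('n) > 0" by simp
  then show ?thesis using volume_bound by (simp add: field_simps)
qed

end
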